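(* Let $M$ be a $C^\infty$ strictly pseudoconvex real hypersurface of dimension $2n+1$, $n\ge1$, in a complex manifold $X$ of dimension $n+1$. Let $\theta$ be a contact form on $M$, $\Upsilon\in C^\infty(M)$ real-valued and $\hat\theta=e^\Upsilon\theta$. Let $P'$ and $\widehat P'$ be the $P$-prime operators of $\theta$ and $\hat\theta$, and let $P$ be the critical GJMS operator. Then $$\widehat P'f=P'f+P(\Upsilon f)\qquad\text{for all } f\in\mathcal P .$$
   Context: CR structure on $M\subset X$: $T^{1,0}=\mathbb CTM\cap T^{1,0}X$. A contact form is a real 1-form $\theta$ on $M$ with $\ker\theta=\operatorname{Re}T^{1,0}$ and with positive definite Levi form $-i\,d\theta(Z,\overline W)$ on $T^{1,0}$. A defining function $\rho$ is a smooth real function near $M$ with $M=\{\rho=0\}$, $d\rho\ne0$ on $M$, $\rho>0$ on the pseudoconvex side; $\rho$ is normalized by $\theta$ if $\theta=\frac i2(\partial-\bar\partial)\rho|_{TM}$. Ambient space. Near $M$ let $\mathcal L_X$ be a line bundle with $\mathcal L_X^{n+2}=\mathcal K_X$ (canonical bundle); it exists locally, and all constructions patch globally. Let $\mathcal L_X^*$ be $\mathcal L_X$ minus its zero section and $\mathcal N$ its restriction over $M$. $\widetilde{\mathcal E}(w)$ is the space of $C^\infty$ functions $f$ on $\mathcal L_X^*$ (near $\mathcal N$, or only on the side $\rho\ge0$ and smooth up to $\rho=0$) with $f(\lambda\xi)=|\lambda|^{2w}f(\xi)$ for $\lambda\in\mathbb C^*$. $\mathcal E(w)$ is the space of functions on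 $\mathcal N$ with the same homogeneity; $\mathcal E=\mathcal E(0)=C^\infty(M)$, and $\widetilde{\mathcal E}(0)$ is identified with functions on $X$. Local coordinates $z=(z^1,\dots,z^{n+1})$ on $X$ give a fiber coordinate $z^0$ relative to the section $(dz^1\wedge\dots\wedge dz^{n+1})^{1/(n+2)}$. Put $\mathcal J_z[r]=(-1)^{n+1}\det\begin{pmatrix} r&\partial_j r\\ \partial_{\bar k}r&\partial_j\partial_{\bar k}r\end{pmatrix}$. Fix a defining function $r_\sharp\in\widetilde{\mathcal E}(1)$ of $\mathcal N$, positive on the pseudoconvex side, such that in all such coordinates $r_\sharp=|z^0|^2r(z)$ with $\mathcal J_z[r]=1+O(\rho^{n+2})$; it exists and is unique modulo $O(\rho^{n+3})$. The ambient metric has components $\tilde g_{I\bar J}=-\partial_I\partial_{\bar J}r_\sharp$ ($I,J=0,\dots,n+1$), and $\widetilde\Delta=-\tilde g^{I\bar J}\partial_I\partial_{\bar J}$. Operators. $P\colon\mathcal E\to\mathcal E(-n-1)$, $Pf=\widetilde\Delta^{n+1}\tilde f|_{\mathcal N}$ for any extension $\tilde f\in\widetilde{\mathcal E}(0)$ of $f$ (independent of the extension). $\mathcal P$ is the space of CR pluriharmonic functions on $M$ (real $C^\infty$ functions locally equal to real parts of CR functions); each has a pluriharmonic extension $\tilde f$ to the pseudoconvex side near $M$. With $\rho$ normalized by $\theta$ and $h_\theta=r_\sharp/\rho$, $P'\colon\mathcal P\to\mathcal E(-n-1)$ is $P'f=-\widetilde\Delta^{n+1}(\tilde f\log h_\theta)|_{\mathcal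 N}$ (independent of the choice of $\rho$). *)

theory Defs
  imports "HOL-Analysis.Analysis" "HOL-Library.Landau_Symbols"
begin

text \<open>
  The complex manifold is a type \<open>'x\<close> with an atlas of charts into \<open>complex^'m\<close>, so its complex
  dimension \<open>n + 1\<close> is \<open>CARD('m)\<close> and \<open>n + 2\<close> is \<open>CARD('m option)\<close>.
\<close>

section \<open>Smooth functions and Wirtinger derivatives\<close>

definition dir_deriv ::
  "'a::real_normed_vector \<Rightarrow> ('a \<Rightarrow> 'b::real_normed_vector) \<Rightarrow> 'a \<Rightarrow> 'b" where
  "dir_deriv v f x = frechet_derivative f (at x) v"

text \<open>For open \<open>S\<close>: all iterated directional derivatives exist and are Frechet differentiable
  (hence continuous) on \<open>S\<close>, i.e. \<open>f\<close> is \<open>C\<^sup>\<infinity>\<close> on \<open>S\<close>.\<close>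

definition smooth_on :: "'a::real_normed_vector set \<Rightarrow> ('a \<Rightarrow> 'b::real_normed_vector) \<Rightarrow> bool" where
  "smooth_on S f \<longleftrightarrow> (\<forall>vs. \<forall>x\<in>S. foldr dir_deriv vs f differentiable (at x))"

text \<open>Smoothness on a not necessarily open set such as a hypersurface: local smooth extendability.\<close>

definition smooth_along :: "'a::real_normed_vector set \<Rightarrow> ('a \<Rightarrow> 'b::real_normed_vector) \<Rightarrow> bool" where
  "smooth_along S f \<longleftrightarrow>
     (\<forall>x\<in>S. \<exists>V g. open V \<and> x \<in> V \<and> smooth_on V g \<and> (\<forall>y\<in>V \<inter> S. g y = f y))"

definition pd :: "'k::finite \<Rightarrow> (complex^'k \<Rightarrow> complex) \<Rightarrow> complex^'k \<Rightarrow> complex" where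
  "pd j f z = (frechet_derivative f (at z) (axis j 1) - \<i> * frechet_derivative f (at z) (axis j \<i>)) / 2"

definition pdbar :: "'k::finite \<Rightarrow> (complex^'k \<Rightarrow> complex) \<Rightarrow> complex^'k \<Rightarrow> complex" where
  "pdbar j f z = (frechet_derivative f (at z) (axis j 1) + \<i> * frechet_derivative f (at z) (axis j \<i>)) / 2"

definition holomorphic_map :: "(complex^'k) set \<Rightarrow> (complex^'k \<Rightarrow> complex^'l) \<Rightarrow> bool" where
  "holomorphic_map S f \<longleftrightarrow>
     (\<forall>z\<in>S. \<exists>D. (f has_derivative D) (at z) \<and> (\<forall>c v. D (c *s v) = c *s D v))"


section \<open>Complex manifolds\<close>

type_synonym ('x, 'm) chart = "'x set \<times> ('x \<Rightarrow> complex^'m)"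

definition pt :: "('x, 'm) chart \<Rightarrow> complex^'m \<Rightarrow> 'x" where
  "pt c = inv_into (fst c) (snd c)"

definition cimg :: "('x, 'm) chart \<Rightarrow> 'x set \<Rightarrow> (complex^'m) set" where
  "cimg c S = snd c ` (fst c \<inter> S)"

definition transition :: "('x, 'm) chart \<Rightarrow> ('x, 'm) chart \<Rightarrow> complex^'m \<Rightarrow> complex^'m" where
  "transition c d = snd d \<circ> pt c"

definition jacobian :: "('x, 'm::finite) chart \<Rightarrow> ('x, 'm) chart \<Rightarrow> complex^'m \<Rightarrow> complex" where
  "jacobian c d z = det (\<chi> i j. pd j (\<lambda>y. transition c d y $ i) z)"

definition is_chart :: "('x::topological_space, 'm::finite) chart \<Rightarrow> bool" where
  "is_chart c \<longleftrightarrow> open (fst c) \<and> open (snd c ` fst c) \<and> homeomorphism (fst c) (snd c ` fst c) (snd c) (pt c)"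

definition compatible :: "('x, 'm::finite) chart \<Rightarrow> ('x, 'm) chart \<Rightarrow> bool" where
  "compatible c d \<longleftrightarrow> holomorphic_map (cimg c (fst d)) (transition c d)
                    \<and> holomorphic_map (cimg d (fst c)) (transition d c)"

definition complex_atlas :: "('x::topological_space, 'm::finite) chart set \<Rightarrow> bool" where
  "complex_atlas A \<longleftrightarrow> (\<forall>c\<in>A. is_chart c) \<and> (\<Union>c\<in>A. fst c) = UNIV \<and> (\<forall>c\<in>A. \<forall>d\<in>A. compatible c d)"

text \<open>All local holomorphic coordinates (the maximal atlas):\<close>

definition charts :: "('x::topological_space, 'm::finite) chart set \<Rightarrow> ('x, 'm) chart set" where
  "charts A = {c. is_chart c \<and> (\<forall>d\<in>A. compatible c d)}"

definition smooth_fun ::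
  "('x::topological_space, 'm::finite) chart set \<Rightarrow> 'x set \<Rightarrow> ('x \<Rightarrow> 'b::real_normed_vector) \<Rightarrow> bool" where
  "smooth_fun A W F \<longleftrightarrow> (\<forall>c\<in>charts A. smooth_on (cimg c W) (F \<circ> pt c))"

definition smooth_fun_along ::
  "('x::topological_space, 'm::finite) chart set \<Rightarrow> 'x set \<Rightarrow> ('x \<Rightarrow> 'b::real_normed_vector) \<Rightarrow> bool" where
  "smooth_fun_along A M f \<longleftrightarrow> (\<forall>c\<in>charts A. smooth_along (cimg c M) (f \<circ> pt c))"


section \<open>Real hypersurfaces and their CR structure\<close>

text \<open>A real tangent vector \<open>\<Sum>\<^sub>j (v\<^sub>j \<partial>\<^sub>j + cnj v\<^sub>j \<partial>bar\<^sub>j)\<close> is represented by its complex coordinates \<open>v\<close>.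
  It is tangent to \<open>M\<close> iff it annihilates every smooth function that vanishes on \<open>M\<close>.\<close>

definition tangent_space ::
  "'x set \<Rightarrow> ('x, 'm::finite) chart \<Rightarrow> complex^'m \<Rightarrow> (complex^'m) set" where
  "tangent_space M c z =
     {v. \<forall>V (u::complex^'m \<Rightarrow> real).
           open V \<and> z \<in> V \<and> smooth_on V u \<and> (\<forall>y\<in>V \<inter> cimg c M. u y = 0)
           \<longrightarrow> frechet_derivative u (at z) v = 0}"

text \<open>The \<open>(1,0)\<close>-vector \<open>\<Sum>\<^sub>j Z\<^sub>j \<partial>\<^sub>j\<close> equals \<open>(Z - \<i> J Z) / 2\<close> for the real vector with coordinates
  \<open>Z\<close>, so it lies in the complexified tangent space of \<open>M\<close> iff \<open>Z\<close> and \<open>J Z = \<i> *s Z\<close> are tangent.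
  The real part of this \<open>(1,0)\<close>-vector has coordinates \<open>Z / 2\<close>; the same set therefore also
  represents \<open>Re T\<^sup>1\<^sup>,\<^sup>0\<close>.\<close>

definition T10 :: "'x set \<Rightarrow> ('x, 'm::finite) chart \<Rightarrow> complex^'m \<Rightarrow> (complex^'m) set" where
  "T10 M c z = {Z. Z \<in> tangent_space M c z \<and> \<i> *s Z \<in> tangent_space M c z}"

definition cut_out ::
  "('x::topological_space, 'm::finite) chart set \<Rightarrow> 'x set \<Rightarrow> 'x set \<Rightarrow> ('x \<Rightarrow> real) \<Rightarrow> bool" where
  "cut_out A M W \<rho> \<longleftrightarrow>
     open W \<and> smooth_fun A W \<rho> \<and> M = {x\<in>W. \<rho> x = 0}
     \<and> (\<forall>c\<in>charts A. \<forall>z\<in>cimg c M. \<exists>v. frechet_derivative (\<rho> \<circ> pt c) (at z) v \<noteq> 0)"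

text \<open>\<open>-\<partial>\<partial>bar \<rho>\<close> is positive definite on \<open>T\<^sup>1\<^sup>,\<^sup>0\<close>, i.e. \<open>M\<close> is strictly pseudoconvex as a boundary of
  \<open>{\<rho> > 0}\<close>.\<close>

definition levi_positive ::
  "('x::topological_space, 'm::finite) chart set \<Rightarrow> 'x set \<Rightarrow> ('x \<Rightarrow> real) \<Rightarrow> bool" where
  "levi_positive A M \<rho> \<longleftrightarrow>
     (\<forall>c\<in>charts A. \<forall>z\<in>cimg c M. \<forall>Z\<in>T10 M c z. Z \<noteq> 0 \<longrightarrow>
        0 < Re (- (\<Sum>j\<in>UNIV. \<Sum>k\<in>UNIV.
                    pd j (pdbar k (\<lambda>y. complex_of_real (\<rho> (pt c y)))) z * Z $ j * cnj (Z $ k))))"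

definition strictly_pseudoconvex_hypersurface ::
  "('x::topological_space, 'm::finite) chart set \<Rightarrow> 'x set \<Rightarrow> bool" where
  "strictly_pseudoconvex_hypersurface A M \<longleftrightarrow>
     (\<forall>p\<in>M. \<exists>V \<rho>. p \<in> V \<and> cut_out A (M \<inter> V) V \<rho> \<and> levi_positive A (M \<inter> V) \<rho>)"

text \<open>A defining function on the neighbourhood \<open>W\<close> of \<open>M\<close>, positive on the pseudoconvex side.\<close>

definition defining_function ::
  "('x::topological_space, 'm::finite) chart set \<Rightarrow> 'x set \<Rightarrow> 'x set \<Rightarrow> ('x \<Rightarrow> real) \<Rightarrow> bool" where
  "defining_function A M W \<rho> \<longleftrightarrow> cut_out A M W \<rho> \<and> levi_positive A M \<rho>"


section \<open>Contact forms\<close>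

text \<open>A real 1-form on \<open>M\<close> assigns to a chart, a point of \<open>M\<close> and a tangent vector of \<open>M\<close> (both in
  coordinates) a real number; only the values on tangent vectors of \<open>M\<close> matter.\<close>

type_synonym ('x, 'm) form1 = "('x, 'm) chart \<Rightarrow> complex^'m \<Rightarrow> complex^'m \<Rightarrow> real"

definition form_extension ::
  "'x set \<Rightarrow> ('x, 'm::finite) form1 \<Rightarrow> ('x, 'm) chart \<Rightarrow> (complex^'m) set
     \<Rightarrow> (complex^'m \<Rightarrow> complex^'m \<Rightarrow> real) \<Rightarrow> bool" where
  "form_extension M \<theta> c V \<alpha> \<longleftrightarrow>
     open V \<and> (\<forall>y\<in>V. linear (\<alpha> y)) \<and> (\<forall>v. smooth_on V (\<lambda>y. \<alpha> y v))
     \<and> (\<forall>y\<in>V \<inter> cimg c M. \<forall>v\<in>tangent_space M c y. \<alpha> y v = \<theta> c y v)"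

definition real_1form ::
  "('x::topological_space, 'm::finite) chart set \<Rightarrow> 'x set \<Rightarrow> ('x, 'm) form1 \<Rightarrow> bool" where
  "real_1form A M \<theta> \<longleftrightarrow>
     (\<forall>c\<in>charts A. \<forall>z\<in>cimg c M. \<exists>V \<alpha>. z \<in> V \<and> form_extension M \<theta> c V \<alpha>)
     \<and> (\<forall>c\<in>charts A. \<forall>d\<in>charts A. \<forall>z\<in>cimg c (fst d \<inter> M). \<forall>v\<in>tangent_space M c z.
          \<theta> d (transition c d z) (frechet_derivative (transition c d) (at z) v) = \<theta> c z v)"

definition ext_deriv ::
  "(complex^'m::finite \<Rightarrow> complex^'m \<Rightarrow> real) \<Rightarrow> complex^'m \<Rightarrow> complex^'m \<Rightarrow> complex^'m \<Rightarrow> real" where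
  "ext_deriv \<alpha> z v w = dir_deriv v (\<lambda>y. \<alpha> y w) z - dir_deriv w (\<lambda>y. \<alpha> y v) z"

text \<open>\<open>-\<i> d\<alpha>(Z, cnj W)\<close> for the \<open>(1,0)\<close>-vectors \<open>(Z - \<i> J Z) / 2\<close> and \<open>(W - \<i> J W) / 2\<close>, where
  \<open>d\<alpha>\<close> is extended complex bilinearly.\<close>

definition levi_form ::
  "(complex^'m::finite \<Rightarrow> complex^'m \<Rightarrow> real) \<Rightarrow> complex^'m \<Rightarrow> complex^'m \<Rightarrow> complex^'m \<Rightarrow> complex" where
  "levi_form \<alpha> z Z W =
     - \<i> * (complex_of_real (ext_deriv \<alpha> z Z W + ext_deriv \<alpha> z (\<i> *s Z) (\<i> *s W))
            + \<i> * complex_of_real (ext_deriv \<alpha> z Z (\<i> *s W) - ext_deriv \<alpha> z (\<i> *s Z) W)) / 4"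

text \<open>The Levi form on \<open>T\<^sup>1\<^sup>,\<^sup>0\<close> does not depend on the extension \<open>\<alpha>\<close> of \<open>\<theta>\<close>, since exterior
  derivatives commute with restriction to \<open>M\<close>.\<close>

definition contact_form ::
  "('x::topological_space, 'm::finite) chart set \<Rightarrow> 'x set \<Rightarrow> ('x, 'm) form1 \<Rightarrow> bool" where
  "contact_form A M \<theta> \<longleftrightarrow>
     real_1form A M \<theta>
     \<and> (\<forall>c\<in>charts A. \<forall>z\<in>cimg c M.
          {v \<in> tangent_space M c z. \<theta> c z v = 0} = T10 M c z
          \<and> (\<forall>V \<alpha>. z \<in> V \<and> form_extension M \<theta> c V \<alpha> \<longrightarrow>
               (\<forall>Z\<in>T10 M c z. Z \<noteq> 0 \<longrightarrow> 0 < Re (levi_form \<alpha> z Z Z))))"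

definition rescale_form :: "('x \<Rightarrow> real) \<Rightarrow> ('x, 'm::finite) form1 \<Rightarrow> ('x, 'm) form1" where
  "rescale_form \<Upsilon> \<theta> = (\<lambda>c z v. exp (\<Upsilon> (pt c z)) * \<theta> c z v)"

text \<open>\<open>\<theta> = (\<i>/2) (\<partial> - \<partial>bar) \<rho>\<close> on tangent vectors of \<open>M\<close>.\<close>

definition normalized_by ::
  "('x::topological_space, 'm::finite) chart set \<Rightarrow> 'x set \<Rightarrow> ('x, 'm) form1 \<Rightarrow> ('x \<Rightarrow> real) \<Rightarrow> bool" where
  "normalized_by A M \<theta> \<rho> \<longleftrightarrow>
     (\<forall>c\<in>charts A. \<forall>z\<in>cimg c M. \<forall>v\<in>tangent_space M c z.
        complex_of_real (\<theta> c z v) =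
          \<i> / 2 * ((\<Sum>j\<in>UNIV. pd j (\<lambda>y. complex_of_real (\<rho> (pt c y))) z * v $ j)
                  - (\<Sum>j\<in>UNIV. pdbar j (\<lambda>y. complex_of_real (\<rho> (pt c y))) z * cnj (v $ j))))"


section \<open>Densities on the ambient space\<close>

text \<open>Over a chart with coordinates \<open>z\<close>, the bundle \<open>L\<close> with \<open>L\<^sup>n\<^sup>+\<^sup>2 = K\<close> is trivialised by
  \<open>(dz\<^sup>1 \<and> \<dots> \<and> dz\<^sup>n\<^sup>+\<^sup>1)\<^sup>1\<^sup>/\<^sup>(\<^sup>n\<^sup>+\<^sup>2\<^sup>)\<close>. A point of \<open>L\<^sup>*\<close> has coordinates \<open>Z :: complex^('m option)\<close>: the fibre
  coordinate \<open>z\<^sup>0 = Z $ None \<noteq> 0\<close>, and \<open>z\<^sup>j = Z $ Some j\<close>.\<close>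

definition base :: "complex^('m::finite option) \<Rightarrow> complex^'m" where
  "base Z = (\<chi> j. Z $ Some j)"

definition unit_lift :: "complex^'m::finite \<Rightarrow> complex^('m option)" where
  "unit_lift z = (\<chi> I. case I of None \<Rightarrow> 1 | Some j \<Rightarrow> z $ j)"

definition fibre_scale :: "complex \<Rightarrow> complex^('m::finite option) \<Rightarrow> complex^('m option)" where
  "fibre_scale \<mu> Z = (\<chi> I. case I of None \<Rightarrow> \<mu> * Z $ None | Some j \<Rightarrow> Z $ Some j)"

definition over :: "('x, 'm::finite) chart \<Rightarrow> 'x set \<Rightarrow> (complex^('m option)) set" where
  "over c S = {Z. Z $ None \<noteq> 0 \<and> base Z \<in> cimg c S}"

text \<open>A global \<open>L\<close> need not exist, so a homogeneous function on \<open>L\<^sup>*\<close> is a family of functions, one for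
  each chart, that agree whenever the \<open>(n+2)\<close>-nd powers \<open>(z\<^sup>0)\<^sup>n\<^sup>+\<^sup>2 dz\<close> of two points are the same
  element of \<open>K\<close>. For homogeneous functions this is agreement under the transition
  functions of \<open>L\<close>, for any choice of the \<open>(n+2)\<close>-nd roots of the Jacobians, since these choices
  differ by factors of modulus one.\<close>

type_synonym ('x, 'm, 'b) family = "('x, 'm) chart \<Rightarrow> complex^('m option) \<Rightarrow> 'b"

definition homogeneous_family ::
  "('x::topological_space, 'm::finite) chart set \<Rightarrow> int \<Rightarrow> 'x set
     \<Rightarrow> ('x, 'm, 'b::real_normed_vector) family \<Rightarrow> bool" where
  "homogeneous_family A w S f \<longleftrightarrow>
     (\<forall>c\<in>charts A. \<forall>Z\<in>over c S. \<forall>\<mu>. \<mu> \<noteq> 0 \<longrightarrow>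
        f c (fibre_scale \<mu> Z) = (norm \<mu> powi (2 * w)) *\<^sub>R f c Z)
     \<and> (\<forall>c\<in>charts A. \<forall>d\<in>charts A. \<forall>Z\<in>over c S. \<forall>Z'\<in>over d S.
          pt c (base Z) = pt d (base Z')
          \<and> (Z $ None) ^ CARD('m option) = (Z' $ None) ^ CARD('m option) * jacobian c d (base Z)
          \<longrightarrow> f c Z = f d Z')"

text \<open>The spaces of densities of weight \<open>w\<close> over an open subset \<open>W\<close> of the manifold, and over \<open>M\<close>.\<close>

definition ambient_density ::
  "('x::topological_space, 'm::finite) chart set \<Rightarrow> int \<Rightarrow> 'x set
     \<Rightarrow> ('x, 'm, 'b::real_normed_vector) family \<Rightarrow> bool" where
  "ambient_density A w W f \<longleftrightarrow>
     homogeneous_family A w W f \<and> (\<forall>c\<in>charts A. smooth_on (over c W) (f c))"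

definition CR_density ::
  "('x::topological_space, 'm::finite) chart set \<Rightarrow> int \<Rightarrow> 'x set
     \<Rightarrow> ('x, 'm, 'b::real_normed_vector) family \<Rightarrow> bool" where
  "CR_density A w M f \<longleftrightarrow>
     homogeneous_family A w M f \<and> (\<forall>c\<in>charts A. smooth_along (over c M) (f c))"


section \<open>The ambient metric and its Laplacian\<close>

definition monge_ampere :: "(complex^'m::finite \<Rightarrow> real) \<Rightarrow> complex^'m \<Rightarrow> complex" where
  "monge_ampere r z = (let R = (\<lambda>y. complex_of_real (r y)) in
     (-1) ^ CARD('m) *
     det (\<chi> K J. case (K, J) of
            (None, None) \<Rightarrow> R z
          | (None, Some j) \<Rightarrow> pd j R z
          | (Some k, None) \<Rightarrow> pdbar k R z
          | (Some k, Some j) \<Rightarrow> pd j (pdbar k R) z))"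

definition fefferman_defining ::
  "('x::topological_space, 'm::finite) chart set \<Rightarrow> 'x set \<Rightarrow> ('x, 'm, real) family \<Rightarrow> bool" where
  "fefferman_defining A M r \<longleftrightarrow>
     (\<exists>W \<rho>. defining_function A M W \<rho> \<and> ambient_density A 1 W r
        \<and> (\<forall>c\<in>charts A. \<forall>Z\<in>over c W. sgn (r c Z) = sgn (\<rho> (pt c (base Z))))
        \<and> (\<forall>c\<in>charts A. \<forall>Z\<in>over c M. \<exists>v. frechet_derivative (r c) (at Z) v \<noteq> 0)
        \<and> (\<forall>c\<in>charts A. \<forall>z\<in>cimg c M.
             (\<lambda>y. monge_ampere (\<lambda>y. r c (unit_lift y)) y - 1)
               \<in> O[nhds z](\<lambda>y. complex_of_real (\<rho> (pt c y) ^ CARD('m option)))))"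

definition ambient_metric ::
  "(complex^'k::finite \<Rightarrow> real) \<Rightarrow> complex^'k \<Rightarrow> complex^'k^'k" where
  "ambient_metric r Z = (\<chi> I J. - pd I (pdbar J (\<lambda>Y. complex_of_real (r Y))) Z)"

text \<open>With \<open>G\<^sub>I\<^sub>J\<close> the coefficient of \<open>dz\<^sup>I dzbar\<^sup>J\<close>, the inverse with \<open>\<Sum>\<^sub>J g\<^sup>I\<^sup>J G\<^sub>K\<^sub>J = \<delta>\<close> is the matrix
  inverse of the transpose of \<open>G\<close>.\<close>

definition ambient_laplacian ::
  "(complex^'k::finite \<Rightarrow> real) \<Rightarrow> (complex^'k \<Rightarrow> complex) \<Rightarrow> complex^'k \<Rightarrow> complex" where
  "ambient_laplacian r f Z =
     - (\<Sum>I\<in>UNIV. \<Sum>J\<in>UNIV.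
          matrix_inv (transpose (ambient_metric r Z)) $ I $ J * pd I (pdbar J f) Z)"


section \<open>The operators\<close>

text \<open>The value of \<open>P f\<close> is computed from some smooth extension \<open>F\<close> of \<open>f\<close>, viewed as a function of
  weight 0 on the ambient space; it does not depend on \<open>F\<close>. The power is \<open>n + 1\<close>.\<close>

definition critical_GJMS ::
  "('x::topological_space, 'm::finite) chart set \<Rightarrow> 'x set \<Rightarrow> ('x, 'm, real) family
     \<Rightarrow> (('x \<Rightarrow> complex) \<Rightarrow> ('x, 'm, complex) family) \<Rightarrow> bool" where
  "critical_GJMS A M r P \<longleftrightarrow>
     (\<forall>f. smooth_fun_along A M f \<longrightarrow>
        CR_density A (- int CARD('m)) M (P f)
        \<and> (\<exists>W F. open W \<and> M \<subseteq> W \<and> smooth_fun A W F \<and> (\<forall>x\<in>M. F x = f x)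
             \<and> (\<forall>c\<in>charts A. \<forall>Z\<in>over c M.
                  P f c Z = (ambient_laplacian (r c) ^^ CARD('m)) (\<lambda>Y. F (pt c (base Y))) Z)))"

definition CR_function ::
  "('x::topological_space, 'm::finite) chart set \<Rightarrow> 'x set \<Rightarrow> ('x \<Rightarrow> complex) \<Rightarrow> bool" where
  "CR_function A M g \<longleftrightarrow>
     (\<forall>p\<in>M. \<exists>V G. open V \<and> p \<in> V \<and> smooth_fun A V G \<and> (\<forall>x\<in>M \<inter> V. G x = g x)
        \<and> (\<forall>c\<in>charts A. \<forall>z\<in>cimg c (M \<inter> V). \<forall>Z\<in>T10 M c z.
             (\<Sum>j\<in>UNIV. cnj (Z $ j) * pdbar j (G \<circ> pt c) z) = 0))"

definition CR_pluriharmonic ::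
  "('x::topological_space, 'm::finite) chart set \<Rightarrow> 'x set \<Rightarrow> ('x \<Rightarrow> real) \<Rightarrow> bool" where
  "CR_pluriharmonic A M f \<longleftrightarrow>
     smooth_fun_along A M f
     \<and> (\<forall>p\<in>M. \<exists>V g. open V \<and> p \<in> V \<and> CR_function A (M \<inter> V) g \<and> (\<forall>x\<in>M \<inter> V. f x = Re (g x)))"

text \<open>The pluriharmonic extension lives on \<open>{\<rho> \<ge> 0}\<close> and is smooth up to \<open>{\<rho> = 0}\<close>, i.e. it is
  the restriction of a function \<open>F\<close> that is smooth on a full neighbourhood \<open>W\<close>. The values of \<open>F\<close> on
  \<open>{\<rho> < 0}\<close> are arbitrary and do not influence its derivatives along \<open>M\<close>.\<close>

definition pluriharmonic_extension ::
  "('x::topological_space, 'm::finite) chart set \<Rightarrow> 'x set \<Rightarrow> 'x set \<Rightarrow> ('x \<Rightarrow> real)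
     \<Rightarrow> ('x \<Rightarrow> real) \<Rightarrow> ('x \<Rightarrow> real) \<Rightarrow> bool" where
  "pluriharmonic_extension A M W \<rho> f F \<longleftrightarrow>
     smooth_fun A W F \<and> (\<forall>x\<in>M. F x = f x)
     \<and> (\<forall>c\<in>charts A. \<forall>z\<in>cimg c {x\<in>W. 0 < \<rho> x}. \<forall>j k.
          pd j (pdbar k (\<lambda>y. complex_of_real (F (pt c y)))) z = 0)"

text \<open>\<open>h\<close> is \<open>h\<^sub>\<theta> = r / \<rho>\<close>, extended smoothly across \<open>M\<close> (where the quotient reads \<open>0 / 0\<close>).
  Again the value of \<open>P' f\<close> does not depend on the choice of \<open>\<rho>\<close> and \<open>F\<close>.\<close>

definition P_prime_operator ::
  "('x::topological_space, 'm::finite) chart set \<Rightarrow> 'x set \<Rightarrow> ('x, 'm, real) family \<Rightarrow> ('x, 'm) form1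
     \<Rightarrow> (('x \<Rightarrow> real) \<Rightarrow> ('x, 'm, complex) family) \<Rightarrow> bool" where
  "P_prime_operator A M r \<theta> P' \<longleftrightarrow>
     (\<forall>f. CR_pluriharmonic A M f \<longrightarrow>
        CR_density A (- int CARD('m)) M (P' f)
        \<and> (\<exists>W \<rho> h F. defining_function A M W \<rho> \<and> normalized_by A M \<theta> \<rho>
             \<and> ambient_density A 1 W h
             \<and> (\<forall>c\<in>charts A. \<forall>Z\<in>over c W. r c Z = h c Z * \<rho> (pt c (base Z)))
             \<and> pluriharmonic_extension A M W \<rho> f F
             \<and> (\<forall>c\<in>charts A. \<forall>Z\<in>over c M.
                  P' f c Z = - (ambient_laplacian (r c) ^^ CARD('m))
                                 (\<lambda>Y. complex_of_real (F (pt c (base Y)) * ln (h c Y))) Z)))"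

end

theory Submission
  imports Defs
begin

text \<open>
  Over \<open>M\<close> the two normalised defining functions satisfy \<open>d\<rho>\<^sub>2 = e\<^sup>\<Upsilon> d\<rho>\<^sub>1\<close>, so that
  \<open>h\<^sub>1 \<rho>\<^sub>1 = r = h\<^sub>2 \<rho>\<^sub>2\<close> gives \<open>log h\<^sub>1 - log h\<^sub>2 = \<Upsilon>\<close> on \<open>M\<close>; the difference is a function of weight 0.
  Therefore \<open>F\<^sub>1 log h\<^sub>1 - F\<^sub>2 log h\<^sub>2\<close> is the sum of \<open>(F\<^sub>1 - F\<^sub>2) log h\<^sub>1\<close>, of an arbitrary extension \<open>G\<close> of
  \<open>\<Upsilon> f\<close>, and of a weight 0 function vanishing on \<open>M\<close>. The first summand is flat along \<open>M\<close>: a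
  pluriharmonic function vanishing on a strictly pseudoconvex hypersurface vanishes there to infinite
  order. The last summand is, up to high order, \<open>r \<phi>\<close> with \<open>\<phi>\<close> of weight \<open>-1\<close>, and
  \<open>\<Delta>\<^sup>n\<^sup>+\<^sup>1 (r \<phi>) = r \<Delta>\<^sup>n\<^sup>+\<^sup>1 \<phi>\<close> because \<open>[\<Delta>, r] = n + 2 + 2 w\<close> on functions of weight \<open>w\<close>.
\<close>

section \<open>Calculus of smooth functions\<close>

text \<open>The definitions of \<open>P'\<close> and \<open>P\<close> only assert that some
  admissible choice of \<rho>, h and extension computes the value. The operators therefore bring
  unrelated data, and independence of the choices has to be proved along with the transformation
  law. All of it is local, so the work takes place in one chart, on the fibres over a small
  neighbourhood of the base point. Division by \<rho> is carried out only up to an error that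
  vanishes to a prescribed order: n+1 Laplacians take at most 2n+2 derivatives, so an error whose
  derivatives up to that order vanish at the point is invisible. The weight -1 is what remains of
  weight 0 after division by r. Commuting r through n+1 Laplacians contributes n+2+2(w-j) for j = 0,
  ..., n, in total (n+1)(2+2w), which is zero exactly for w = -1; the term that survives carries a
  factor r and vanishes on M. The hypothesis n \<ge> 1 supplies a nonzero vector in
  \<open>T10\<close>. In complex dimension one the real part of z vanishes on a line without being
  flat there.\<close>

lemma dir_deriv_eqI: "(f has_derivative f') (at x) \<Longrightarrow> dir_deriv v f x = f' v"
  unfolding dir_deriv_def using frechet_derivative_at by metis

lemma dir_deriv_has_derivative:
  "f differentiable (at x) \<Longrightarrow> (f has_derivative (\<lambda>v. dir_deriv v f x)) (at x)"
  unfolding dir_deriv_def by (metis frechet_derivative_works)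

lemma dir_deriv_cong:
  assumes "open S" "x \<in> S" "\<And>y. y \<in> S \<Longrightarrow> f y = g y"
  shows "dir_deriv v f x = dir_deriv v g x"
proof -
  have "(f has_derivative D) (at x) \<longleftrightarrow> (g has_derivative D) (at x)" for D
    using has_derivative_transform_within_open[OF _ assms(1,2)] assms(3) by metis
  then show ?thesis
    unfolding dir_deriv_def frechet_derivative_def by simp
qed

lemma differentiable_cong:
  assumes "open S" "x \<in> S" "\<And>y. y \<in> S \<Longrightarrow> f y = g y" "f differentiable (at x)"
  shows "g differentiable (at x)"
  using assms has_derivative_transform_within_open[OF _ assms(1,2)] unfolding differentiable_def by metis

lemma foldr_dir_deriv_cong:
  assumes "open S" "\<And>y. y \<in> S \<Longrightarrow> f y = g y" "x \<in> S"
  shows "foldr dir_deriv vs f x = foldr dir_deriv vs g x"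
  using assms(3)
proof (induction vs arbitrary: x)
  case (Cons v vs)
  then show ?case using dir_deriv_cong[OF assms(1) Cons.prems Cons.IH] by simp
qed (simp add: assms)

lemma smooth_on_cong:
  assumes "open S" "smooth_on S f" "\<And>y. y \<in> S \<Longrightarrow> f y = g y"
  shows "smooth_on S g"
  unfolding smooth_on_def
proof (intro allI ballI)
  fix vs x assume x: "x \<in> S"
  show "foldr dir_deriv vs g differentiable at x"
    by (rule differentiable_cong[OF assms(1) x foldr_dir_deriv_cong[OF assms(1) assms(3)]])
      (use assms(2) x in \<open>auto simp: smooth_on_def\<close>)
qed

lemma smooth_on_subset: "smooth_on S f \<Longrightarrow> T \<subseteq> S \<Longrightarrow> smooth_on T f"
  unfolding smooth_on_def by blast

lemma smooth_on_differentiable: "smooth_on S f \<Longrightarrow> x \<in> S \<Longrightarrow> f differentiable (at x)"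
  unfolding smooth_on_def by (metis foldr_Nil id_apply)

lemma smooth_on_foldr: "smooth_on S f \<Longrightarrow> smooth_on S (foldr dir_deriv vs f)"
  unfolding smooth_on_def by (metis foldr_append comp_apply)

lemma smooth_on_dir_deriv: "smooth_on S f \<Longrightarrow> smooth_on S (dir_deriv v f)"
  using smooth_on_foldr[of S f "[v]"] by simp

lemma smooth_on_isCont: "smooth_on S f \<Longrightarrow> x \<in> S \<Longrightarrow> isCont f x"
  using smooth_on_differentiable differentiable_imp_continuous_within by blast

lemma smooth_on_continuous: "smooth_on S f \<Longrightarrow> continuous_on S f"
  by (simp add: smooth_on_isCont continuous_at_imp_continuous_on)

text \<open>Derivatives of sums, products and quotients are again of the same kind, so it suffices
  to exhibit a class \<open>P\<close> stable under directional derivatives. Agreement is asked only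
  on \<open>S\<close>, since elsewhere \<open>frechet_derivative\<close> may be applied to a
  function without a derivative; openness of \<open>S\<close> lets the agreement pass to the next
  derivative.\<close>

lemma smooth_on_coinduct:
  assumes "open S" and "P f"
    and "\<And>f x. P f \<Longrightarrow> x \<in> S \<Longrightarrow> f differentiable (at x)"
    and "\<And>f v. P f \<Longrightarrow> \<exists>g. P g \<and> (\<forall>x\<in>S. dir_deriv v f x = g x)"
  shows "smooth_on S f"
proof -
  have ex: "\<exists>g. P g \<and> (\<forall>x\<in>S. foldr dir_deriv vs f x = g x)" for vs
  proof (induction vs)
    case Nil
    then show ?case using assms(2) by auto
  next
    case (Cons v vs)
    then obtain g where g: "P g" "\<And>x. x \<in> S \<Longrightarrow> foldr dir_deriv vs f x = g x" by blast
    obtain g' where g': "P g'" "\<And>x. x \<in> S \<Longrightarrow> dir_deriv v g x = g' x" using assms(4) g(1) by blast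
    have "foldr dir_deriv (v # vs) f x = g' x" if "x \<in> S" for x
      using dir_deriv_cong[OF assms(1) that g(2)] g'(2)[OF that] by simp
    then show ?case using g'(1) by blast
  qed
  show ?thesis
    unfolding smooth_on_def
  proof (intro allI ballI)
    fix vs x assume x: "x \<in> S"
    obtain g where g: "P g" "\<And>x. x \<in> S \<Longrightarrow> foldr dir_deriv vs f x = g x" using ex by blast
    show "foldr dir_deriv vs f differentiable at x"
      by (rule differentiable_cong[OF assms(1) x g(2)[symmetric] assms(3)[OF g(1) x]])
  qed
qed

lemma smooth_onI_dir_deriv:
  assumes "\<And>x. x \<in> S \<Longrightarrow> f differentiable (at x)" "\<And>v. smooth_on S (dir_deriv v f)"
  shows "smooth_on S f"
  unfolding smooth_on_def
proof (intro allI ballI)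
  fix vs x assume x: "x \<in> S"
  show "foldr dir_deriv vs f differentiable at x"
  proof (cases vs rule: rev_cases)
    case Nil
    then show ?thesis using assms(1) x by simp
  next
    case (snoc ys y)
    then show ?thesis using assms(2)[of y] x by (simp add: smooth_on_def)
  qed
qed

lemma dir_deriv_const [simp]: "dir_deriv v (\<lambda>x. c) = (\<lambda>x. 0)"
  unfolding dir_deriv_def by simp

lemma foldr_dir_deriv_zero: "foldr dir_deriv vs (\<lambda>x. 0) = (\<lambda>x. 0)"
  by (induction vs) auto

lemma smooth_on_const [simp]: "smooth_on S (\<lambda>x. c)"
  by (rule smooth_onI_dir_deriv) (auto simp: smooth_on_def foldr_dir_deriv_zero)

lemma dir_deriv_add:
  "f differentiable (at x) \<Longrightarrow> g differentiable (at x) \<Longrightarrow>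
   dir_deriv v (\<lambda>x. f x + g x) x = dir_deriv v f x + dir_deriv v g x"
  by (rule dir_deriv_eqI, rule has_derivative_add) (auto intro: dir_deriv_has_derivative)

lemma dir_deriv_diff:
  "f differentiable (at x) \<Longrightarrow> g differentiable (at x) \<Longrightarrow>
   dir_deriv v (\<lambda>x. f x - g x) x = dir_deriv v f x - dir_deriv v g x"
  by (rule dir_deriv_eqI, rule has_derivative_diff) (auto intro: dir_deriv_has_derivative)

lemma dir_deriv_mult:
  fixes f g :: "'a::real_normed_vector \<Rightarrow> 'b::real_normed_field"
  shows "f differentiable (at x) \<Longrightarrow> g differentiable (at x) \<Longrightarrow>
   dir_deriv v (\<lambda>x. f x * g x) x = dir_deriv v f x * g x + f x * dir_deriv v g x"
  by (rule trans[OF dir_deriv_eqI[OF has_derivative_mult]]) (auto intro: dir_deriv_has_derivative)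

lemma dir_deriv_bounded_linear:
  "bounded_linear L \<Longrightarrow> f differentiable (at x) \<Longrightarrow>
   dir_deriv v (\<lambda>x. L (f x)) x = L (dir_deriv v f x)"
  by (rule dir_deriv_eqI, rule bounded_linear.has_derivative) (auto intro: dir_deriv_has_derivative)

lemma dir_deriv_affine:
  assumes "bounded_linear L" "f differentiable (at (L x + b))"
  shows "dir_deriv v (\<lambda>x. f (L x + b)) x = dir_deriv (L v) f (L x + b)"
proof -
  have "((\<lambda>x. L x + b) has_derivative L) (at x)"
    by (auto intro!: derivative_eq_intros bounded_linear_imp_has_derivative assms(1))
  from diff_chain_at[OF this dir_deriv_has_derivative[OF assms(2)]]
  show ?thesis by (intro dir_deriv_eqI[THEN trans]) (auto simp: o_def)
qed

lemma dir_deriv_linear_arg: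
  assumes "f differentiable (at x)"
  shows "dir_deriv (v + w) f x = dir_deriv v f x + dir_deriv w f x"
    and "dir_deriv (a *\<^sub>R v) f x = a *\<^sub>R dir_deriv v f x"
    and "dir_deriv (v - w) f x = dir_deriv v f x - dir_deriv w f x"
    and "dir_deriv (- v) f x = - dir_deriv v f x"
    and "dir_deriv 0 f x = 0"
proof -
  interpret linear "\<lambda>v. dir_deriv v f x"
    using dir_deriv_has_derivative[OF assms] has_derivative_linear by blast
  show "dir_deriv (v + w) f x = dir_deriv v f x + dir_deriv w f x"
    and "dir_deriv (a *\<^sub>R v) f x = a *\<^sub>R dir_deriv v f x"
    and "dir_deriv (v - w) f x = dir_deriv v f x - dir_deriv w f x"
    and "dir_deriv (- v) f x = - dir_deriv v f x"
    and "dir_deriv 0 f x = 0"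
    by (rule add, rule scale, rule diff, rule neg, rule zero)
qed

section \<open>Closure properties of smooth functions\<close>

lemma smooth_on_add:
  assumes "open S" "smooth_on S f" "smooth_on S g"
  shows "smooth_on S (\<lambda>x. f x + g x)"
proof (rule smooth_on_coinduct[where P = "\<lambda>h. \<exists>f g. smooth_on S f \<and> smooth_on S g \<and> h = (\<lambda>x. f x + g x)"])
  fix h v assume "\<exists>f g. smooth_on S f \<and> smooth_on S g \<and> h = (\<lambda>x. f x + g x)"
  then obtain f g where "smooth_on S f" "smooth_on S g" "h = (\<lambda>x. f x + g x)" by blast
  then show "\<exists>k. (\<exists>f g. smooth_on S f \<and> smooth_on S g \<and> k = (\<lambda>x. f x + g x)) \<and> (\<forall>x\<in>S. dir_deriv v h x = k x)"
    by (intro exI[of _ "\<lambda>x. dir_deriv v f x + dir_deriv v g x"])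
      (auto intro: smooth_on_dir_deriv dir_deriv_add smooth_on_differentiable)
qed (use assms smooth_on_differentiable in \<open>auto intro!: differentiable_add\<close>)

lemma smooth_on_bounded_linear:
  assumes "open S" "bounded_linear L" "smooth_on S f"
  shows "smooth_on S (\<lambda>x. L (f x))"
proof (rule smooth_on_coinduct[where P = "\<lambda>h. \<exists>f. smooth_on S f \<and> h = (\<lambda>x. L (f x))"])
  fix h v assume "\<exists>f. smooth_on S f \<and> h = (\<lambda>x. L (f x))"
  then obtain f where "smooth_on S f" "h = (\<lambda>x. L (f x))" by blast
  then show "\<exists>k. (\<exists>f. smooth_on S f \<and> k = (\<lambda>x. L (f x))) \<and> (\<forall>x\<in>S. dir_deriv v h x = k x)"
    by (intro exI[of _ "\<lambda>x. L (dir_deriv v f x)"])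
      (auto intro: smooth_on_dir_deriv dir_deriv_bounded_linear[OF assms(2)] smooth_on_differentiable)
next
  fix h x assume "\<exists>f. smooth_on S f \<and> h = (\<lambda>x. L (f x))" "x \<in> S"
  then show "h differentiable at x"
    using bounded_linear.has_derivative[OF assms(2)] smooth_on_differentiable
    unfolding differentiable_def by blast
qed (use assms in auto)

lemmas smooth_on_minus = smooth_on_bounded_linear[OF _ bounded_linear_minus[OF bounded_linear_ident]]
lemmas smooth_on_of_real = smooth_on_bounded_linear[OF _ bounded_linear_of_real]

lemma smooth_on_diff:
  assumes "open S" "smooth_on S f" "smooth_on S g"
  shows "smooth_on S (\<lambda>x. f x - g x)"
  using smooth_on_add[OF assms(1,2) smooth_on_minus[OF assms(1,3)]] by simp

lemma smooth_on_affine: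
  assumes "open S" "bounded_linear L" "smooth_on T f" "\<And>x. x \<in> S \<Longrightarrow> L x + b \<in> T"
  shows "smooth_on S (\<lambda>x. f (L x + b))"
proof (rule smooth_on_coinduct[where P = "\<lambda>h. \<exists>f. smooth_on T f \<and> h = (\<lambda>x. f (L x + b))"])
  fix h v assume "\<exists>f. smooth_on T f \<and> h = (\<lambda>x. f (L x + b))"
  then obtain f where "smooth_on T f" "h = (\<lambda>x. f (L x + b))" by blast
  then show "\<exists>k. (\<exists>f. smooth_on T f \<and> k = (\<lambda>x. f (L x + b))) \<and> (\<forall>x\<in>S. dir_deriv v h x = k x)"
    by (intro exI[of _ "\<lambda>x. dir_deriv (L v) f (L x + b)"])
      (auto intro: smooth_on_dir_deriv dir_deriv_affine[OF assms(2)] smooth_on_differentiable assms(4))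
next
  fix h x assume "\<exists>f. smooth_on T f \<and> h = (\<lambda>x. f (L x + b))" "x \<in> S"
  then obtain f where f: "smooth_on T f" "h = (\<lambda>x. f (L x + b))" by blast
  have "(\<lambda>x. L x + b) differentiable at x"
    using assms(2) by (intro differentiable_add differentiable_const bounded_linear_imp_differentiable)
  from differentiable_chain_at[OF this smooth_on_differentiable[OF f(1) assms(4)[OF \<open>x \<in> S\<close>]]]
  show "h differentiable at x" by (simp add: f(2) o_def)
qed (use assms in auto)

text \<open>The derivative of a product is a sum of two products, so products of smooth functions
  alone are not visibly stable under differentiation. Closing under sums as well gives a class to
  which \<open>smooth_on_coinduct\<close> applies.\<close>

inductive smooth_algebra for S :: "'a::real_normed_vector set" where
  base: "smooth_on S f \<Longrightarrow> smooth_algebra S (f :: 'a \<Rightarrow> 'b::real_normed_field)"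
| add: "smooth_algebra S f \<Longrightarrow> smooth_algebra S g \<Longrightarrow> smooth_algebra S (\<lambda>x. f x + g x)"
| mult: "smooth_algebra S f \<Longrightarrow> smooth_algebra S g \<Longrightarrow> smooth_algebra S (\<lambda>x. f x * g x)"

lemma smooth_algebra_differentiable: "smooth_algebra S f \<Longrightarrow> x \<in> S \<Longrightarrow> f differentiable (at x)"
  by (induction rule: smooth_algebra.induct) (auto simp: smooth_on_differentiable)

lemma smooth_algebra_dir_deriv:
  "smooth_algebra S f \<Longrightarrow> \<exists>g. smooth_algebra S g \<and> (\<forall>x\<in>S. dir_deriv v f x = g x)"
proof (induction rule: smooth_algebra.induct)
  case (base f)
  then show ?case using smooth_on_dir_deriv smooth_algebra.base by blast
next
  case (add f g)
  then obtain f' g' where "smooth_algebra S f'" "\<forall>x\<in>S. dir_deriv v f x = f' x"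
    "smooth_algebra S g'" "\<forall>x\<in>S. dir_deriv v g x = g' x" by blast
  with add.hyps show ?case
    by (intro exI[of _ "\<lambda>x. f' x + g' x"])
      (auto intro: smooth_algebra.add simp: dir_deriv_add smooth_algebra_differentiable)
next
  case (mult f g)
  then obtain f' g' where "smooth_algebra S f'" "\<forall>x\<in>S. dir_deriv v f x = f' x"
    "smooth_algebra S g'" "\<forall>x\<in>S. dir_deriv v g x = g' x" by blast
  with mult.hyps show ?case
    by (intro exI[of _ "\<lambda>x. f' x * g x + f x * g' x"])
      (auto intro!: smooth_algebra.add smooth_algebra.mult simp: dir_deriv_mult smooth_algebra_differentiable)
qed

lemma smooth_on_mult:
  fixes f g :: "'a::real_normed_vector \<Rightarrow> 'b::real_normed_field"
  assumes "open S" "smooth_on S f" "smooth_on S g"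
  shows "smooth_on S (\<lambda>x. f x * g x)"
  by (rule smooth_on_coinduct[where P = "smooth_algebra S"])
    (use assms smooth_algebra_differentiable smooth_algebra_dir_deriv in
      \<open>auto intro: smooth_algebra.intros\<close>)

lemma smooth_on_power:
  fixes f :: "'a::real_normed_vector \<Rightarrow> 'b::real_normed_field"
  assumes "open S" "smooth_on S f"
  shows "smooth_on S (\<lambda>x. f x ^ k)"
  by (induction k) (auto intro: smooth_on_mult assms)

lemma smooth_on_sum:
  assumes "open S" "\<And>i. i \<in> I \<Longrightarrow> smooth_on S (f i)"
  shows "smooth_on S (\<lambda>x. \<Sum>i\<in>I. f i x)"
  using assms(2) by (induction I rule: infinite_finite_induct) (auto intro: smooth_on_add assms(1))

lemma smooth_on_prod:
  fixes f :: "'i \<Rightarrow> 'a::real_normed_vector \<Rightarrow> 'b::real_normed_field"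
  assumes "open S" "\<And>i. i \<in> I \<Longrightarrow> smooth_on S (f i)"
  shows "smooth_on S (\<lambda>x. \<Prod>i\<in>I. f i x)"
  using assms(2) by (induction I rule: infinite_finite_induct) (auto intro: smooth_on_mult assms(1))

lemma smooth_on_det:
  fixes f :: "'k::finite \<Rightarrow> 'k \<Rightarrow> 'a::real_normed_vector \<Rightarrow> 'b::real_normed_field"
  assumes "open S" "\<And>i j. smooth_on S (f i j)"
  shows "smooth_on S (\<lambda>x. det (\<chi> i j. f i j x))"
  unfolding det_def
  by (intro smooth_on_sum smooth_on_mult smooth_on_prod smooth_on_const) (auto intro: assms)

text \<open>The functions \<open>a x * inverse (g x) ^ k\<close> with smooth \<open>a\<close> form a
  stable class: differentiation raises \<open>k\<close> by one and replaces \<open>a\<close> by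
  another smooth numerator.\<close>

lemma smooth_on_inverse:
  fixes g :: "'a::real_normed_vector \<Rightarrow> 'b::real_normed_field"
  assumes S: "open S" and g: "smooth_on S g" "\<And>x. x \<in> S \<Longrightarrow> g x \<noteq> 0"
  shows "smooth_on S (\<lambda>x. inverse (g x))"
proof (rule smooth_on_coinduct[where P = "\<lambda>h. \<exists>a k. smooth_on S a \<and> h = (\<lambda>x. a x * inverse (g x) ^ k)"])
  have diff: "(\<lambda>x. inverse (g x) ^ k) differentiable at x" if "x \<in> S" for k x
    using that g smooth_on_differentiable by (intro differentiable_power differentiable_inverse) auto
  fix h assume "\<exists>a k. smooth_on S a \<and> h = (\<lambda>x. a x * inverse (g x) ^ k)"
  then obtain a k where a: "smooth_on S a" and h: "h = (\<lambda>x. a x * inverse (g x) ^ k)" by blast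
  show "h differentiable at x" if "x \<in> S" for x
    unfolding h using a that diff smooth_on_differentiable by (intro differentiable_mult) auto
  have pow: "dir_deriv v (\<lambda>x. inverse (g x) ^ k) x = - of_nat k * dir_deriv v g x * inverse (g x) ^ Suc k"
    if x: "x \<in> S" for x v
  proof -
    have "g x \<noteq> 0" using g x by auto
    then have "((\<lambda>x. inverse (g x)) has_derivative
       (\<lambda>v. - (inverse (g x) * dir_deriv v g x * inverse (g x)))) (at x)"
      by (intro Deriv.has_derivative_inverse dir_deriv_has_derivative smooth_on_differentiable[OF g(1) x])
    note D = dir_deriv_eqI[OF has_derivative_power[OF this]]
    show ?thesis by (rule trans[OF D]) (cases k; simp add: algebra_simps)
  qed
  fix v
  have "dir_deriv v h x = (dir_deriv v a x * g x - of_nat k * a x * dir_deriv v g x) * inverse (g x) ^ Suc k"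
    if x: "x \<in> S" for x
    unfolding h dir_deriv_mult[OF smooth_on_differentiable[OF a x] diff[OF x]] pow[OF x]
    using g(2)[OF x] by (simp add: field_simps)
  moreover have "smooth_on S (\<lambda>x. dir_deriv v a x * g x - of_nat k * a x * dir_deriv v g x)"
    by (intro smooth_on_diff smooth_on_mult S a g(1) smooth_on_dir_deriv smooth_on_const)
  ultimately show "\<exists>h'. (\<exists>a k. smooth_on S a \<and> h' = (\<lambda>x. a x * inverse (g x) ^ k)) \<and>
      (\<forall>x\<in>S. dir_deriv v h x = h' x)"
    by blast
qed (use S in \<open>auto intro!: exI[of _ "\<lambda>x. 1"] exI[of _ 1]\<close>)

lemma smooth_on_divide:
  fixes f g :: "'a::real_normed_vector \<Rightarrow> 'b::real_normed_field"
  assumes "open S" "smooth_on S f" "smooth_on S g" "\<And>x. x \<in> S \<Longrightarrow> g x \<noteq> 0"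
  shows "smooth_on S (\<lambda>x. f x / g x)"
  unfolding divide_inverse by (intro smooth_on_mult smooth_on_inverse assms)

text \<open>Isabelle's \<open>ln x\<close> is \<open>ln \<bar>x\<bar>\<close>, so the sign of the argument does not matter.\<close>

lemma has_derivative_ln_nonzero:
  fixes g :: "'a::real_normed_vector \<Rightarrow> real"
  assumes "(g has_derivative g') (at x)" "g x \<noteq> 0"
  shows "((\<lambda>x. ln (g x)) has_derivative (\<lambda>v. g' v / g x)) (at x)"
proof (cases "g x > 0")
  case True
  then show ?thesis using assms by (auto intro!: derivative_eq_intros simp: field_simps)
next
  case False
  then have "((\<lambda>x. ln (- g x)) has_derivative (\<lambda>v. g' v / g x)) (at x)"
    using assms by (auto intro!: derivative_eq_intros simp: field_simps)
  then show ?thesis by (simp add: ln_minus)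
qed

lemma smooth_on_ln:
  fixes g :: "'a::real_normed_vector \<Rightarrow> real"
  assumes S: "open S" and g: "smooth_on S g" "\<And>x. x \<in> S \<Longrightarrow> g x \<noteq> 0"
  shows "smooth_on S (\<lambda>x. ln (g x))"
proof (rule smooth_onI_dir_deriv)
  have D: "((\<lambda>x. ln (g x)) has_derivative (\<lambda>v. dir_deriv v g x / g x)) (at x)" if "x \<in> S" for x
    by (intro has_derivative_ln_nonzero dir_deriv_has_derivative smooth_on_differentiable[OF g(1)] g(2) that)
  show "(\<lambda>x. ln (g x)) differentiable at x" if "x \<in> S" for x
    using D[OF that] differentiable_def by blast
  fix v
  show "smooth_on S (dir_deriv v (\<lambda>x. ln (g x)))"
    by (rule smooth_on_cong[OF S smooth_on_divide[OF S smooth_on_dir_deriv[OF g(1)] g(1) g(2)]])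
      (auto simp: dir_deriv_eqI[OF D])
qed

section \<open>Smooth dependence of the inverse matrix\<close>

lemma matrix_inv_nonsingular:
  fixes A :: "'a::field^'k::finite^'k"
  assumes "det A \<noteq> 0"
  shows "A ** matrix_inv A = mat 1" "matrix_inv A ** A = mat 1"
proof -
  have "\<exists>B. A ** B = mat 1 \<and> B ** A = mat 1"
    using assms by (simp add: invertible_det_nz[symmetric] invertible_def)
  then have "A ** matrix_inv A = mat 1 \<and> matrix_inv A ** A = mat 1"
    unfolding matrix_inv_def by (rule someI_ex)
  then show "A ** matrix_inv A = mat 1" "matrix_inv A ** A = mat 1" by auto
qed

text \<open>Cramer's rule for the column \<open>J\<close> of the inverse, which solves a linear
  system with right-hand side \<open>axis J 1\<close>. The quotient of determinants makes smoothness
  of the inverse evident.\<close>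

lemma matrix_inv_cofactor:
  fixes A :: "'a::field^'k::finite^'k"
  assumes "det A \<noteq> 0"
  shows "matrix_inv A $ I $ J = det (\<chi> i j. if j = I then (if i = J then 1 else 0) else A$i$j) / det A"
proof -
  note inv = matrix_inv_nonsingular(1)[OF assms]
  have "(A *v column J (matrix_inv A)) = axis J 1"
  proof -
    have "(A *v column J (matrix_inv A)) $ i = (A ** matrix_inv A) $ i $ J" for i
      by (simp add: matrix_vector_mult_def matrix_matrix_mult_def column_def)
    then show ?thesis by (simp add: vec_eq_iff inv mat_def axis_def)
  qed
  then have "column J (matrix_inv A) $ I = det (\<chi> i j. if j = I then axis J 1 $ i else A$i$j) / det A"
    unfolding cramer[OF assms] by simp
  then show ?thesis by (simp add: column_def axis_def if_distrib cong: if_cong)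
qed

lemma smooth_on_matrix_inv:
  fixes A :: "'a::real_normed_vector \<Rightarrow> 'b::real_normed_field^'k::finite^'k"
  assumes S: "open S" and A: "\<And>i j. smooth_on S (\<lambda>x. A x $ i $ j)"
    and nz: "\<And>x. x \<in> S \<Longrightarrow> det (A x) \<noteq> 0"
  shows "smooth_on S (\<lambda>x. matrix_inv (A x) $ I $ J)"
proof -
  have *: "smooth_on S (\<lambda>x. if j = I then (if i = J then 1 else 0) else A x $ i $ j)" for i j
    by (cases "j = I") (auto simp: A)
  have "smooth_on S (\<lambda>x. det (\<chi> i j. if j = I then (if i = J then 1 else 0) else A x$i$j) / det (\<chi> i j. A x $ i $ j))"
    using nz by (intro smooth_on_divide smooth_on_det S A *) (auto simp: vec_lambda_eta)
  then show ?thesis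
    by (rule smooth_on_cong[OF S]) (use nz in \<open>auto simp: matrix_inv_cofactor vec_lambda_eta\<close>)
qed

section \<open>Symmetry of second derivatives\<close>

lemma dir_deriv_segment:
  assumes "f differentiable (at (x + t *\<^sub>R v))"
  shows "((\<lambda>t. f (x + t *\<^sub>R v)) has_vector_derivative dir_deriv v f (x + t *\<^sub>R v)) (at t)"
proof -
  have "((\<lambda>t. x + t *\<^sub>R v) has_derivative (\<lambda>s. s *\<^sub>R v)) (at t)"
    by (auto intro!: derivative_eq_intros)
  from diff_chain_at[OF this dir_deriv_has_derivative[OF assms]]
  show ?thesis by (simp add: has_vector_derivative_def o_def dir_deriv_linear_arg[OF assms])
qed

text \<open>The mean value theorem is applied in direction \<open>v\<close> and then in direction
  \<open>w\<close>. The second difference itself is symmetric in \<open>v\<close> and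
  \<open>w\<close>, which is the source of the symmetry of second derivatives.\<close>

lemma second_difference:
  fixes f :: "'a::real_normed_vector \<Rightarrow> real"
  assumes h: "h > 0" and sm: "smooth_on S f"
    and S: "\<And>s t. 0 \<le> s \<Longrightarrow> s \<le> h \<Longrightarrow> 0 \<le> t \<Longrightarrow> t \<le> h \<Longrightarrow> x + s *\<^sub>R v + t *\<^sub>R w \<in> S"
  shows "\<exists>s t. 0 \<le> s \<and> s \<le> h \<and> 0 \<le> t \<and> t \<le> h \<and>
    f (x + h *\<^sub>R v + h *\<^sub>R w) - f (x + h *\<^sub>R v) - f (x + h *\<^sub>R w) + f x
      = h * (h * dir_deriv w (dir_deriv v f) (x + s *\<^sub>R v + t *\<^sub>R w))"
proof -
  have D1: "((\<lambda>s. f (x + t *\<^sub>R w + s *\<^sub>R v)) has_real_derivative dir_deriv v f (x + t *\<^sub>R w + s *\<^sub>R v)) (at s)"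
    if "0 \<le> s" "s \<le> h" "0 \<le> t" "t \<le> h" for s t
    unfolding has_real_derivative_iff_has_vector_derivative
    by (intro dir_deriv_segment smooth_on_differentiable[OF sm]) (use S[OF that] in \<open>simp add: algebra_simps\<close>)
  have "\<exists>s. s > 0 \<and> s < h \<and>
      (\<lambda>s. f (x + h *\<^sub>R w + s *\<^sub>R v) - f (x + 0 *\<^sub>R w + s *\<^sub>R v)) h - (\<lambda>s. f (x + h *\<^sub>R w + s *\<^sub>R v) - f (x + 0 *\<^sub>R w + s *\<^sub>R v)) 0
       = (h - 0) * (dir_deriv v f (x + h *\<^sub>R w + s *\<^sub>R v) - dir_deriv v f (x + 0 *\<^sub>R w + s *\<^sub>R v))"
    by (rule MVT2[OF h]) (intro DERIV_diff D1, auto simp: h less_imp_le)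
  then obtain s where s: "0 < s" "s < h" and e1: "f (x + h *\<^sub>R v + h *\<^sub>R w) - f (x + h *\<^sub>R v) - f (x + h *\<^sub>R w) + f x
       = h * (dir_deriv v f (x + s *\<^sub>R v + h *\<^sub>R w) - dir_deriv v f (x + s *\<^sub>R v))"
    by (auto simp: algebra_simps)
  have D2: "((\<lambda>t. dir_deriv v f (x + s *\<^sub>R v + t *\<^sub>R w)) has_real_derivative
      dir_deriv w (dir_deriv v f) (x + s *\<^sub>R v + t *\<^sub>R w)) (at t)" if "0 \<le> t" "t \<le> h" for t
    unfolding has_real_derivative_iff_has_vector_derivative
    by (intro dir_deriv_segment smooth_on_differentiable[OF smooth_on_dir_deriv[OF sm]] S) (use that s in auto)
  obtain t where "0 < t" "t < h" "dir_deriv v f (x + s *\<^sub>R v + h *\<^sub>R w) - dir_deriv v f (x + s *\<^sub>R v + 0 *\<^sub>R w)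
     = (h - 0) * dir_deriv w (dir_deriv v f) (x + s *\<^sub>R v + t *\<^sub>R w)"
    using MVT2[OF h D2] by blast
  with s e1 show ?thesis by (intro exI[of _ s] exI[of _ t]) auto
qed

lemma dir_deriv_commute_real:
  fixes f :: "'a::real_normed_vector \<Rightarrow> real"
  assumes S: "open S" "x \<in> S" and sm: "smooth_on S f"
  shows "dir_deriv w (dir_deriv v f) x = dir_deriv v (dir_deriv w f) x"
proof (rule ccontr)
  let ?p = "dir_deriv w (dir_deriv v f)" and ?q = "dir_deriv v (dir_deriv w f)"
  assume ne: "?p x \<noteq> ?q x"
  define e where "e = \<bar>?p x - ?q x\<bar> / 2"
  have e: "e > 0" using ne by (simp add: e_def)
  have "isCont ?p x" "isCont ?q x"
    using sm S by (auto intro!: smooth_on_isCont smooth_on_dir_deriv)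
  then obtain d1 d2 where d: "d1 > 0" "\<And>y. dist y x < d1 \<Longrightarrow> dist (?p y) (?p x) < e"
      "d2 > 0" "\<And>y. dist y x < d2 \<Longrightarrow> dist (?q y) (?q x) < e"
    using e by (metis continuous_at_eps_delta dist_commute)
  obtain d0 where d0: "d0 > 0" "ball x d0 \<subseteq> S" using S openE by blast
  define d where "d = min d0 (min d1 d2)"
  have dpos: "d > 0" using d d0 by (simp add: d_def)
  \<comment> \<open>Small enough that the parallelogram spanned by \<open>h *\<^sub>R v\<close> and
    \<open>h *\<^sub>R w\<close> stays within distance \<open>d\<close> of \<open>x\<close>; the
    summand 1 keeps the denominator positive.\<close>
  define h where "h = d / (2 * (norm v + norm w + 1))"
  have nn: "norm v + norm w + 1 > 0" by (smt (verit) norm_ge_zero)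
  have h: "h > 0" using dpos nn by (simp add: h_def)
  have near: "dist (x + s *\<^sub>R v + t *\<^sub>R w) x < d" if "0 \<le> s" "s \<le> h" "0 \<le> t" "t \<le> h" for s t
  proof -
    have "dist (x + s *\<^sub>R v + t *\<^sub>R w) x = norm (s *\<^sub>R v + t *\<^sub>R w)" by (simp add: dist_norm algebra_simps)
    also have "\<dots> \<le> s * norm v + t * norm w" using that norm_triangle_ineq[of "s *\<^sub>R v" "t *\<^sub>R w"] by simp
    also have "\<dots> \<le> h * norm v + h * norm w" using that by (intro add_mono mult_right_mono) auto
    also have "\<dots> < h * (2 * (norm v + norm w + 1))"
      using h nn by (simp add: algebra_simps) (smt (verit) h mult_nonneg_nonneg norm_ge_zero)
    also have "\<dots> = d" using nn by (simp add: h_def)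
    finally show ?thesis .
  qed
  have inS: "x + s *\<^sub>R v + t *\<^sub>R w \<in> S" if "0 \<le> s" "s \<le> h" "0 \<le> t" "t \<le> h" for s t
    using near[OF that] d0 by (auto simp: d_def dist_commute subset_iff)
  have inS': "x + s *\<^sub>R w + t *\<^sub>R v \<in> S" if "0 \<le> s" "s \<le> h" "0 \<le> t" "t \<le> h" for s t
    using inS[OF that(3,4,1,2)] by (simp add: algebra_simps)
  obtain s t where st: "0 \<le> s" "s \<le> h" "0 \<le> t" "t \<le> h"
    "f (x + h *\<^sub>R v + h *\<^sub>R w) - f (x + h *\<^sub>R v) - f (x + h *\<^sub>R w) + f x
      = h * (h * ?p (x + s *\<^sub>R v + t *\<^sub>R w))"
    using second_difference[OF h sm inS] by blast
  obtain s' t' where st': "0 \<le> s'" "s' \<le> h" "0 \<le> t'" "t' \<le> h"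
    "f (x + h *\<^sub>R w + h *\<^sub>R v) - f (x + h *\<^sub>R w) - f (x + h *\<^sub>R v) + f x
      = h * (h * ?q (x + s' *\<^sub>R w + t' *\<^sub>R v))"
    using second_difference[OF h sm inS'] by blast
  have "h * (h * ?p (x + s *\<^sub>R v + t *\<^sub>R w)) = h * (h * ?q (x + t' *\<^sub>R v + s' *\<^sub>R w))"
    using st(5) st'(5) by (simp add: algebra_simps)
  then have "?p (x + s *\<^sub>R v + t *\<^sub>R w) = ?q (x + t' *\<^sub>R v + s' *\<^sub>R w)" using h by simp
  moreover have "dist (?p (x + s *\<^sub>R v + t *\<^sub>R w)) (?p x) < e"
    using near[OF st(1-4)] d(2) by (simp add: d_def)
  moreover have "dist (?q (x + t' *\<^sub>R v + s' *\<^sub>R w)) (?q x) < e"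
    using near[OF st'(3,4,1,2)] d(4) by (simp add: d_def)
  ultimately have "\<bar>?p x - ?q x\<bar> < 2 * e" by (auto simp: dist_real_def)
  then show False by (simp add: e_def)
qed

lemma dir_deriv_commute:
  fixes f :: "'a::real_normed_vector \<Rightarrow> 'b::real_inner"
  assumes S: "open S" "x \<in> S" and sm: "smooth_on S f"
  shows "dir_deriv w (dir_deriv v f) x = dir_deriv v (dir_deriv w f) x"
proof (rule vector_eq_ldot[THEN iffD1], rule allI)
  fix b :: 'b
  have bl: "bounded_linear ((\<bullet>) b)" by (rule bounded_linear_inner_right)
  have *: "dir_deriv w (dir_deriv v (\<lambda>x. b \<bullet> f x)) x = b \<bullet> dir_deriv w (dir_deriv v f) x" for v w
  proof -
    have "dir_deriv w (dir_deriv v (\<lambda>x. b \<bullet> f x)) x = dir_deriv w (\<lambda>x. b \<bullet> dir_deriv v f x) x"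
      by (rule dir_deriv_cong[OF S]) (auto intro: dir_deriv_bounded_linear[OF bl] smooth_on_differentiable[OF sm])
    also have "\<dots> = b \<bullet> dir_deriv w (dir_deriv v f) x"
      by (intro dir_deriv_bounded_linear[OF bl] smooth_on_differentiable[OF smooth_on_dir_deriv[OF sm]] S)
    finally show ?thesis .
  qed
  show "b \<bullet> dir_deriv w (dir_deriv v f) x = b \<bullet> dir_deriv v (dir_deriv w f) x"
    using dir_deriv_commute_real[OF S smooth_on_bounded_linear[OF S(1) bl sm]] by (simp add: *)
qed

lemma foldr_dir_deriv_commute:
  fixes f :: "'a::real_normed_vector \<Rightarrow> 'b::real_inner"
  assumes S: "open S" "x \<in> S" and sm: "smooth_on S f"
  shows "foldr dir_deriv vs (dir_deriv v f) x = dir_deriv v (foldr dir_deriv vs f) x"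
  using S(2)
proof (induction vs arbitrary: x)
  case (Cons w vs)
  have "foldr dir_deriv (w # vs) (dir_deriv v f) x = dir_deriv w (dir_deriv v (foldr dir_deriv vs f)) x"
    using dir_deriv_cong[OF S(1) Cons.prems Cons.IH] by simp
  also have "\<dots> = dir_deriv v (foldr dir_deriv (w # vs) f) x"
    using dir_deriv_commute[OF S(1) Cons.prems smooth_on_foldr[OF sm]] by simp
  finally show ?case .
qed simp

section \<open>Order of vanishing along a hypersurface\<close>

text \<open>The count starts with the value itself: order 1 means a zero at \<open>x\<close>, and
  order \<open>k\<close> leaves derivatives of order \<open>k\<close> unconstrained. The condition
  concerns a single point.\<close>

definition vanishes_to_order ::
  "nat \<Rightarrow> ('a::real_normed_vector \<Rightarrow> 'b::real_normed_vector) \<Rightarrow> 'a \<Rightarrow> bool" where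
  "vanishes_to_order k f x \<longleftrightarrow> (\<forall>vs. length vs < k \<longrightarrow> foldr dir_deriv vs f x = 0)"

lemma vanishes_to_order_0 [simp]: "vanishes_to_order 0 f x"
  by (simp add: vanishes_to_order_def)

lemma vanishes_to_order_mono: "vanishes_to_order k f x \<Longrightarrow> j \<le> k \<Longrightarrow> vanishes_to_order j f x"
  by (auto simp: vanishes_to_order_def)

lemma vanishes_to_order_Suc:
  "vanishes_to_order (Suc k) f x \<longleftrightarrow> f x = 0 \<and> (\<forall>v. vanishes_to_order k (dir_deriv v f) x)"
proof safe
  assume *: "vanishes_to_order (Suc k) f x"
  then show "f x = 0" unfolding vanishes_to_order_def by (elim allE[of _ "[]"]) simp
  fix v show "vanishes_to_order k (dir_deriv v f) x"
    unfolding vanishes_to_order_def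
  proof (intro allI impI)
    fix vs :: "'a list" assume "length vs < k"
    then show "foldr dir_deriv vs (dir_deriv v f) x = 0"
      using *[unfolded vanishes_to_order_def, rule_format, of "vs @ [v]"] by simp
  qed
next
  assume *: "f x = 0" "\<forall>v. vanishes_to_order k (dir_deriv v f) x"
  show "vanishes_to_order (Suc k) f x"
    unfolding vanishes_to_order_def
  proof (intro allI impI)
    fix vs :: "'a list" assume "length vs < Suc k"
    then show "foldr dir_deriv vs f x = 0"
      using * by (cases vs rule: rev_cases) (auto simp: vanishes_to_order_def)
  qed
qed

lemma vanishes_to_order_cong:
  assumes "open S" "x \<in> S" "\<And>y. y \<in> S \<Longrightarrow> f y = g y" "vanishes_to_order k f x"
  shows "vanishes_to_order k g x"
  using assms(4) foldr_dir_deriv_cong[OF assms(1,3,2)] by (simp add: vanishes_to_order_def)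

lemma vanishes_to_order_add:
  assumes "open S" "x \<in> S" "smooth_on S f" "smooth_on S g"
    "vanishes_to_order k f x" "vanishes_to_order k g x"
  shows "vanishes_to_order k (\<lambda>x. f x + g x) x"
  using assms(3-)
proof (induction k arbitrary: f g)
  case (Suc k)
  have "vanishes_to_order k (dir_deriv v (\<lambda>x. f x + g x)) x" for v
    by (rule vanishes_to_order_cong[OF assms(1,2) _ Suc.IH[of "dir_deriv v f" "dir_deriv v g"]])
      (use Suc.prems in \<open>auto simp: dir_deriv_add smooth_on_differentiable vanishes_to_order_Suc
        intro: smooth_on_dir_deriv\<close>)
  then show ?case using Suc.prems by (simp add: vanishes_to_order_Suc)
qed simp

lemma vanishes_to_order_mult:
  fixes f g :: "'a::real_normed_vector \<Rightarrow> 'b::real_normed_field"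
  assumes S: "open S" "x \<in> S" and "smooth_on S f" "smooth_on S g" "vanishes_to_order k f x"
  shows "vanishes_to_order k (\<lambda>x. f x * g x) x"
  using assms(3-)
proof (induction k arbitrary: f g)
  case (Suc k)
  have "vanishes_to_order k (\<lambda>x. dir_deriv v f x * g x + f x * dir_deriv v g x) x" for v
    using Suc.prems
    by (intro vanishes_to_order_add[OF S] smooth_on_mult S Suc.IH smooth_on_dir_deriv)
      (auto simp: vanishes_to_order_Suc[of k] intro: vanishes_to_order_mono[OF Suc.prems(3)])
  then have "vanishes_to_order k (dir_deriv v (\<lambda>x. f x * g x)) x" for v
    by (rule vanishes_to_order_cong[OF S, rotated])
      (use Suc.prems in \<open>auto simp: dir_deriv_mult smooth_on_differentiable\<close>)
  then show ?case using Suc.prems by (simp add: vanishes_to_order_Suc)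
qed simp

text \<open>In the product rule one summand keeps the factor \<open>g\<close> with its zero, so the
  induction hypothesis applies to it, while the other keeps the full order of
  \<open>f\<close>.\<close>

lemma vanishes_to_order_mult_zero:
  fixes f g :: "'a::real_normed_vector \<Rightarrow> 'b::real_normed_field"
  assumes S: "open S" "x \<in> S" and "smooth_on S f" "smooth_on S g" "vanishes_to_order k f x" "g x = 0"
  shows "vanishes_to_order (Suc k) (\<lambda>x. f x * g x) x"
  using assms(3-)
proof (induction k arbitrary: f g)
  case 0
  then show ?case by (auto simp: vanishes_to_order_Suc)
next
  case (Suc k)
  have "vanishes_to_order (Suc k) (\<lambda>x. dir_deriv v f x * g x + f x * dir_deriv v g x) x" for v
    using Suc.prems
    by (intro vanishes_to_order_add[OF S] smooth_on_mult S smooth_on_dir_deriv Suc.IH vanishes_to_order_mult[OF S])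
      (auto simp: vanishes_to_order_Suc[of k])
  then have "vanishes_to_order (Suc k) (dir_deriv v (\<lambda>x. f x * g x)) x" for v
    by (rule vanishes_to_order_cong[OF S, rotated])
      (use Suc.prems in \<open>auto simp: dir_deriv_mult smooth_on_differentiable\<close>)
  then show ?case using Suc.prems by (simp add: vanishes_to_order_Suc[of "Suc k"])
qed

lemma vanishes_to_order_power:
  fixes f :: "'a::real_normed_vector \<Rightarrow> 'b::real_normed_field"
  assumes S: "open S" "x \<in> S" and "smooth_on S f" "f x = 0"
  shows "vanishes_to_order k (\<lambda>x. f x ^ k) x"
proof (induction k)
  case (Suc k)
  then have "vanishes_to_order (Suc k) (\<lambda>x. f x ^ k * f x) x"
    by (intro vanishes_to_order_mult_zero[OF S] smooth_on_power assms)
  then show ?case by (simp add: mult.commute)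
qed simp

lemma vanishes_to_order_sum:
  assumes "open S" "x \<in> S" "\<And>i. i \<in> I \<Longrightarrow> smooth_on S (f i)" "\<And>i. i \<in> I \<Longrightarrow> vanishes_to_order k (f i) x"
  shows "vanishes_to_order k (\<lambda>x. \<Sum>i\<in>I. f i x) x"
proof -
  have 0: "vanishes_to_order k (\<lambda>x. 0 :: 'c) x"
    by (simp add: vanishes_to_order_def foldr_dir_deriv_zero)
  show ?thesis
    using assms(3,4)
  proof (induction I rule: infinite_finite_induct)
    case (insert i I)
    have "vanishes_to_order k (\<lambda>x. f i x + (\<Sum>i\<in>I. f i x)) x"
      by (intro vanishes_to_order_add[OF assms(1,2)] smooth_on_sum assms(1) insert.IH insert.prems) auto
    then show ?case using insert.hyps by simp
  qed (use 0 in auto)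
qed

lemma vanishes_to_order_affine:
  assumes "open S" "x \<in> S" "bounded_linear L" "smooth_on T f" "\<And>x. x \<in> S \<Longrightarrow> L x + b \<in> T"
    "vanishes_to_order k f (L x + b)"
  shows "vanishes_to_order k (\<lambda>x. f (L x + b)) x"
  using assms(4,6)
proof (induction k arbitrary: f)
  case (Suc k)
  have "vanishes_to_order k (dir_deriv v (\<lambda>x. f (L x + b))) x" for v
    by (rule vanishes_to_order_cong[OF assms(1,2) _ Suc.IH[of "dir_deriv (L v) f"]])
      (use Suc.prems assms(5) in \<open>auto simp: dir_deriv_affine[OF assms(3)] smooth_on_differentiable
        vanishes_to_order_Suc intro: smooth_on_dir_deriv\<close>)
  then show ?case using Suc.prems by (simp add: vanishes_to_order_Suc)
qed simp

text \<open>For small \<open>t\<close> the intermediate value theorem yields \<open>s \<in> [-1, 1]\<close> such that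
  \<open>z + t (v + \<epsilon> s e)\<close> lies on the hypersurface; then let \<open>\<epsilon> \<rightarrow> 0\<close>.\<close>

lemma derivative_zero_on_kernel:
  fixes \<rho> :: "'a::real_normed_vector \<Rightarrow> real" and w :: "'a \<Rightarrow> 'b::real_normed_vector"
  assumes S: "open S" "z \<in> S" and cont: "continuous_on S \<rho>"
    and D\<rho>: "(\<rho> has_derivative \<rho>') (at z)" and Dw: "(w has_derivative w') (at z)"
    and z: "\<rho> z = 0" and w0: "\<And>y. y \<in> S \<Longrightarrow> \<rho> y = 0 \<Longrightarrow> w y = 0"
    and e: "\<rho>' e \<noteq> 0" and v: "\<rho>' v = 0"
  shows "w' v = 0"
proof -
  interpret R: bounded_linear \<rho>' using D\<rho> has_derivative_bounded_linear by blast
  interpret W: bounded_linear w' using Dw has_derivative_bounded_linear by blast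
  define e' where "e' = (1 / \<rho>' e) *\<^sub>R e"
  have e1: "\<rho>' e' = 1" using e by (simp add: e'_def R.scaleR)
  define C where "C = norm v + norm e' + 1"
  have C: "C > 0" by (simp add: C_def add_nonneg_pos)
  have bound: "norm (w' v) \<le> \<epsilon> * (norm (w' e') + 1)" if \<epsilon>: "0 < \<epsilon>" "\<epsilon> \<le> 1" for \<epsilon>
  proof -
    \<comment> \<open>With this \<eta> the linearization error along \<open>h s\<close> is at most
      half of the change \<open>\<epsilon> * t\<close> that s = 1 or s = -1 produces in the linear
      part of \<rho>, so \<rho> has opposite signs at the two ends.\<close>
    define \<eta> where "\<eta> = \<epsilon> / (2 * C)"
    have \<eta>: "\<eta> > 0" using \<epsilon> C by (simp add: \<eta>_def)
    obtain d1 where d1: "d1 > 0" "\<And>y. norm (y - z) < d1 \<Longrightarrow> norm (\<rho> y - \<rho> z - \<rho>' (y - z)) \<le> \<eta> * norm (y - z)"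
      using D\<rho> \<eta> unfolding has_derivative_at_alt by blast
    obtain d2 where d2: "d2 > 0" "\<And>y. norm (y - z) < d2 \<Longrightarrow> norm (w y - w z - w' (y - z)) \<le> \<eta> * norm (y - z)"
      using Dw \<eta> unfolding has_derivative_at_alt by blast
    obtain d0 where d0: "d0 > 0" "ball z d0 \<subseteq> S" using S openE by blast
    define d where "d = min d0 (min d1 d2)"
    have d: "d > 0" using d0 d1 d2 by (simp add: d_def)
    define t where "t = d / (2 * C)"
    have t: "t > 0" "t * C < d" using d C by (auto simp: t_def)
    define h where "h s = t *\<^sub>R (v + (\<epsilon> * s) *\<^sub>R e')" for s
    have nh: "norm (h s) \<le> t * C" if "s \<in> {-1..1}" for s
    proof -
      have "\<bar>\<epsilon> * s\<bar> \<le> 1" using that \<epsilon> mult_le_one[of \<epsilon> "\<bar>s\<bar>"] by (auto simp: abs_mult)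
      then have "norm ((\<epsilon> * s) *\<^sub>R e') \<le> norm e'"
        by (simp add: mult_left_le_one_le)
      then have "norm (v + (\<epsilon> * s) *\<^sub>R e') \<le> C"
        using norm_triangle_ineq[of v "(\<epsilon> * s) *\<^sub>R e'"] by (simp add: C_def)
      then show ?thesis using t by (simp add: h_def)
    qed
    have hd: "norm (h s) < d" if "s \<in> {-1..1}" for s using nh[OF that] t by simp
    have inS: "z + h s \<in> S" if "s \<in> {-1..1}" for s
      using hd[OF that] d0 by (auto simp: d_def dist_norm subset_iff)
    have err: "\<eta> * norm (h s) \<le> \<epsilon> * t / 2" if "s \<in> {-1..1}" for s
    proof -
      have "\<eta> * norm (h s) \<le> \<eta> * (t * C)" using nh[OF that] \<eta> by simp
      then show ?thesis using C by (simp add: \<eta>_def)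
    qed
    have \<rho>h: "\<bar>\<rho> (z + h s) - \<epsilon> * t * s\<bar> \<le> \<epsilon> * t / 2" if "s \<in> {-1..1}" for s
    proof -
      have "\<rho>' (h s) = \<epsilon> * t * s" by (simp add: h_def R.scaleR R.add e1 v)
      then show ?thesis
        using d1(2)[of "z + h s"] hd[OF that] err[OF that] by (simp add: d_def z)
    qed
    have wh: "norm (w (z + h s) - w' (h s)) \<le> \<epsilon> * t / 2" if "s \<in> {-1..1}" for s
      using d2(2)[of "z + h s"] hd[OF that] err[OF that] by (simp add: d_def w0[OF S(2) z])
    have "\<exists>s\<ge>-1. s \<le> 1 \<and> \<rho> (z + h s) = 0"
    proof (rule IVT')
      show "\<rho> (z + h (-1)) \<le> 0" "0 \<le> \<rho> (z + h 1)"
        using \<rho>h[of "-1", unfolded abs_le_iff] \<rho>h[of 1, unfolded abs_le_iff] mult_pos_pos[OF \<epsilon>(1) t(1)]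
        by simp_all
      show "continuous_on {-1..1} (\<lambda>s. \<rho> (z + h s))"
        by (rule continuous_on_compose2[OF cont]) (auto simp: h_def intro!: continuous_intros inS[unfolded h_def])
    qed simp
    then obtain s where s: "s \<in> {-1..1}" "\<rho> (z + h s) = 0" by auto
    then have "norm (w' (h s)) \<le> \<epsilon> * t / 2"
      using wh[OF s(1)] w0[OF inS[OF s(1)] s(2)] by simp
    moreover have "w' (h s) = t *\<^sub>R (w' v + (\<epsilon> * s) *\<^sub>R w' e')"
      by (simp add: h_def W.scaleR W.add)
    ultimately have "t * norm (w' v + (\<epsilon> * s) *\<^sub>R w' e') \<le> t * (\<epsilon> / 2)" using t by (simp add: mult.commute)
    then have "norm (w' v + (\<epsilon> * s) *\<^sub>R w' e') \<le> \<epsilon> / 2" using t(1) mult_le_cancel_left_pos by blast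
    moreover have "norm ((\<epsilon> * s) *\<^sub>R w' e') \<le> \<epsilon> * norm (w' e')"
    proof -
      have "\<bar>s\<bar> \<le> 1" using s(1) by auto
      then have "\<bar>s\<bar> * norm (w' e') \<le> 1 * norm (w' e')" by (intro mult_right_mono) auto
      then show ?thesis using \<epsilon> by (simp add: abs_mult mult.assoc)
    qed
    ultimately have "norm (w' v) \<le> \<epsilon> / 2 + \<epsilon> * norm (w' e')"
      using norm_triangle_ineq4[of "w' v + (\<epsilon> * s) *\<^sub>R w' e'" "(\<epsilon> * s) *\<^sub>R w' e'"] by simp
    then show ?thesis using \<epsilon> by (simp add: algebra_simps)
  qed
  have "norm (w' v) \<le> 0"
  proof (rule field_le_epsilon)
    fix x :: real assume x: "x > 0"
    define \<epsilon> where "\<epsilon> = min 1 (x / (norm (w' e') + 1))"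
    have pos: "norm (w' e') + 1 > 0" by (simp add: add_nonneg_pos)
    then have "\<epsilon> * (norm (w' e') + 1) \<le> x / (norm (w' e') + 1) * (norm (w' e') + 1)"
      by (intro mult_right_mono) (auto simp: \<epsilon>_def)
    also have "\<dots> = x" using pos by simp
    finally show "norm (w' v) \<le> 0 + x" using bound[of \<epsilon>] x pos by (auto simp: \<epsilon>_def)
  qed
  then show ?thesis by simp
qed

text \<open>Subtracting a multiple of \<open>e\<close> moves \<open>v\<close> into the kernel of
  d\<rho>, where the derivative of \<open>w\<close> vanishes. Thus dw is proportional to d\<rho> on
  the zero set, and the single transversal direction \<open>e\<close> determines it.\<close>

lemma dir_deriv_on_zero_set:
  fixes \<rho> :: "'a::real_normed_vector \<Rightarrow> real" and w :: "'a \<Rightarrow> 'b::real_normed_vector"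
  assumes S: "open S" "z \<in> S" and \<rho>: "smooth_on S \<rho>" and w: "w differentiable (at z)"
    and z: "\<rho> z = 0" and w0: "\<And>y. y \<in> S \<Longrightarrow> \<rho> y = 0 \<Longrightarrow> w y = 0"
    and e: "dir_deriv e \<rho> z \<noteq> 0"
  shows "dir_deriv v w z = (dir_deriv v \<rho> z / dir_deriv e \<rho> z) *\<^sub>R dir_deriv e w z"
proof -
  define a where "a = dir_deriv v \<rho> z / dir_deriv e \<rho> z"
  have \<rho>d: "\<rho> differentiable (at z)" by (rule smooth_on_differentiable[OF \<rho> S(2)])
  have "dir_deriv (v - a *\<^sub>R e) w z = 0"
  proof (rule derivative_zero_on_kernel[OF S smooth_on_continuous[OF \<rho>] dir_deriv_has_derivative[OF \<rho>d]
        dir_deriv_has_derivative[OF w] z w0 e])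
    show "dir_deriv (v - a *\<^sub>R e) \<rho> z = 0"
      using e by (simp add: dir_deriv_linear_arg[OF \<rho>d] a_def)
  qed
  then show ?thesis by (simp add: dir_deriv_linear_arg[OF w] a_def)
qed

text \<open>Induction on the order. The outermost derivative acts on a function that vanishes on the
  whole zero set, so it can be replaced by a multiple of the derivative along \<open>e\<close>; this
  one commutes inwards until it meets \<open>R\<close>, where \<open>DR\<close> applies. Hence only
  one direction has to be examined.\<close>

lemma vanishes_to_order_Suc_transversal:
  fixes \<rho> :: "'a::real_normed_vector \<Rightarrow> real" and R :: "'a \<Rightarrow> 'b::real_inner"
  assumes S: "open S" and \<rho>: "smooth_on S \<rho>" and R: "smooth_on S R"
    and e: "\<And>y. y \<in> S \<Longrightarrow> dir_deriv e \<rho> y \<noteq> 0"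
    and R0: "\<And>y. y \<in> S \<Longrightarrow> \<rho> y = 0 \<Longrightarrow> R y = 0"
    and DR: "\<And>y. y \<in> S \<Longrightarrow> \<rho> y = 0 \<Longrightarrow> vanishes_to_order N (dir_deriv e R) y"
    and x: "x \<in> S" "\<rho> x = 0"
  shows "vanishes_to_order (Suc N) R x"
proof -
  have "j \<le> Suc N \<Longrightarrow> x \<in> S \<Longrightarrow> \<rho> x = 0 \<Longrightarrow> vanishes_to_order j R x" for j x
  proof (induction j arbitrary: x)
    case (Suc j)
    show ?case
      unfolding vanishes_to_order_def
    proof (intro allI impI)
      fix vs :: "'a list" assume len: "length vs < Suc j"
      show "foldr dir_deriv vs R x = 0"
      proof (cases vs)
        case Nil
        then show ?thesis using R0 Suc.prems by simp
      next
        case (Cons v us)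
        have "foldr dir_deriv us R y = 0" if "y \<in> S" "\<rho> y = 0" for y
          using Suc.IH[of y] Suc.prems that len by (simp add: vanishes_to_order_def Cons)
        note D = dir_deriv_on_zero_set[where w = "foldr dir_deriv us R" and v = v,
            OF S Suc.prems(2) \<rho> _ Suc.prems(3) this e[OF Suc.prems(2)]]
        have "foldr dir_deriv vs R x = dir_deriv v (foldr dir_deriv us R) x" by (simp add: Cons)
        also have "\<dots> = (dir_deriv v \<rho> x / dir_deriv e \<rho> x) *\<^sub>R dir_deriv e (foldr dir_deriv us R) x"
          by (rule D[OF smooth_on_differentiable[OF smooth_on_foldr[OF R] Suc.prems(2)]])
        also have "dir_deriv e (foldr dir_deriv us R) x = foldr dir_deriv us (dir_deriv e R) x"
          by (rule foldr_dir_deriv_commute[OF S Suc.prems(2) R, symmetric])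
        also have "foldr dir_deriv us (dir_deriv e R) x = 0"
          using DR[OF Suc.prems(2,3)] len Suc.prems(1) by (simp add: vanishes_to_order_def Cons)
        finally show ?thesis by simp
      qed
    qed
  qed simp
  then show ?thesis using x by simp
qed

text \<open>With the transversal field \<open>T = (e \<rho>)\<^sup>-\<^sup>1 e\<close>, for which \<open>T \<rho> = 1\<close>, the Taylor remainder
  \<open>R = \<Sum>\<^sub>k\<^sub>\<le>\<^sub>N (- \<rho>)\<^sup>k T\<^sup>k E / k!\<close> satisfies \<open>T R = (- \<rho>)\<^sup>N T\<^sup>N\<^sup>+\<^sup>1 E / N!\<close> and agrees with \<open>E\<close> up to a
  multiple of \<open>\<rho>\<close>.\<close>

proposition division_up_to_order:
  fixes \<rho> :: "'a::real_normed_vector \<Rightarrow> real" and E :: "'a \<Rightarrow> complex"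
  assumes S: "open S" and \<rho>: "smooth_on S \<rho>" and E: "smooth_on S E"
    and e: "\<And>y. y \<in> S \<Longrightarrow> dir_deriv e \<rho> y \<noteq> 0"
    and E0: "\<And>y. y \<in> S \<Longrightarrow> \<rho> y = 0 \<Longrightarrow> E y = 0"
  obtains \<phi> where "smooth_on S \<phi>"
    "\<And>x. x \<in> S \<Longrightarrow> \<rho> x = 0 \<Longrightarrow> vanishes_to_order N (\<lambda>x. E x - complex_of_real (\<rho> x) * \<phi> x) x"
proof -
  define P where "P x = complex_of_real (\<rho> x)" for x
  have P: "smooth_on S P" unfolding P_def by (rule smooth_on_of_real[OF S \<rho>])
  have DP: "dir_deriv e P x = of_real (dir_deriv e \<rho> x)" if "x \<in> S" for x
    unfolding P_def
    by (rule dir_deriv_bounded_linear[OF bounded_linear_of_real smooth_on_differentiable[OF \<rho> that]])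
  then have DPnz: "dir_deriv e P x \<noteq> 0" if "x \<in> S" for x using e that by simp
  define T where "T f x = dir_deriv e f x / dir_deriv e P x" for f x
  define t where "t k = (T ^^ k) E" for k
  have t: "smooth_on S (t k)" for k
    by (induction k) (auto simp: t_def E T_def[abs_def] intro!: smooth_on_divide S smooth_on_dir_deriv P DPnz)
  have Dt: "dir_deriv e (t k) x = dir_deriv e P x * t (Suc k) x" if "x \<in> S" for k x
    using DPnz[OF that] by (simp add: t_def T_def)
  define R where "R n x = (\<Sum>k\<le>n. (- P x) ^ k * t k x / fact k)" for n x
  have summand: "smooth_on S (\<lambda>x. (- P x) ^ k * t k x / fact k)" for k
    by (intro smooth_on_divide smooth_on_mult smooth_on_power smooth_on_minus S P t smooth_on_const) auto
  have R: "smooth_on S (R n)" for n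
    unfolding R_def by (intro smooth_on_sum S summand)
  \<comment> \<open>The sum telescopes: differentiating the factor \<open>(- P x) ^ Suc n\<close> of
    the new summand cancels the value found for \<open>n\<close>, and only the derivative of
    \<open>t (Suc n)\<close> is left.\<close>
  have DR: "dir_deriv e (R n) x = dir_deriv e P x * ((- P x) ^ n * t (Suc n) x / fact n)" if x: "x \<in> S" for n x
  proof (induction n)
    case 0
    then show ?case using Dt[OF x, of 0] by (simp add: R_def)
  next
    case (Suc n)
    have dP: "P differentiable (at x)" and dt: "t (Suc n) differentiable (at x)"
      using P t x by (auto intro: smooth_on_differentiable)
    then have dPn: "(\<lambda>x. (- P x) ^ Suc n) differentiable (at x)"
      by (intro differentiable_power differentiable_minus)
    have DPn: "dir_deriv e (\<lambda>x. (- P x) ^ Suc n) x = - of_nat (Suc n) * dir_deriv e P x * (- P x) ^ n"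
      by (rule trans[OF dir_deriv_eqI[OF has_derivative_power[OF has_derivative_minus[OF
              dir_deriv_has_derivative[OF dP]]]]]) (simp add: algebra_simps)
    have D: "dir_deriv e (\<lambda>x. (- P x) ^ Suc n * t (Suc n) x / fact (Suc n)) x
        = dir_deriv e (\<lambda>x. (- P x) ^ Suc n * t (Suc n) x) x / fact (Suc n)"
      by (rule dir_deriv_bounded_linear[OF bounded_linear_divide differentiable_mult[OF dPn dt]])
    have "dir_deriv e (R (Suc n)) x
        = dir_deriv e (R n) x + dir_deriv e (\<lambda>x. (- P x) ^ Suc n * t (Suc n) x / fact (Suc n)) x"
      unfolding R_def sum.atMost_Suc
      by (rule dir_deriv_add[OF smooth_on_differentiable[OF R[of n, unfolded R_def[abs_def]] x]
            smooth_on_differentiable[OF summand x]])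
    also have "dir_deriv e (\<lambda>x. (- P x) ^ Suc n * t (Suc n) x / fact (Suc n)) x =
        (- of_nat (Suc n) * dir_deriv e P x * (- P x) ^ n * t (Suc n) x
             + (- P x) ^ Suc n * (dir_deriv e P x * t (Suc (Suc n)) x)) / fact (Suc n)"
      unfolding D dir_deriv_mult[OF dPn dt] DPn Dt[OF x] ..
    finally have * : "dir_deriv e (R (Suc n)) x = dir_deriv e P x * ((- P x) ^ n * t (Suc n) x / fact n) +
        (- of_nat (Suc n) * dir_deriv e P x * (- P x) ^ n * t (Suc n) x
          + (- P x) ^ Suc n * (dir_deriv e P x * t (Suc (Suc n)) x)) / fact (Suc n)"
      unfolding Suc .
    have aux: "a * (u * s / f) + (- N * a * u * s + p * u * (a * s')) / (N * f) = a * (p * u * s' / (N * f))"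
      if "N \<noteq> 0" "f \<noteq> 0" for a u s f N p s' :: complex
      using that by (simp add: field_simps)
    show ?case unfolding * fact_Suc power_Suc by (rule aux) (simp_all del: of_nat_Suc)
  qed
  have R0: "R n x = 0" if "x \<in> S" "\<rho> x = 0" for n x
  proof -
    have "R n x = (\<Sum>k\<le>n. if k = 0 then E x else 0)"
      unfolding R_def by (rule sum.cong) (auto simp: P_def that t_def)
    then show ?thesis using E0 that by simp
  qed
  have RV: "vanishes_to_order (Suc N) (R N) x" if "x \<in> S" "\<rho> x = 0" for x
  proof (rule vanishes_to_order_Suc_transversal[OF S \<rho> R e R0 _ that])
    fix y assume y: "y \<in> S" "\<rho> y = 0"
    have nP: "smooth_on S (\<lambda>x. - P x)" by (rule smooth_on_minus[OF S P])
    have "vanishes_to_order N (\<lambda>x. (- P x) ^ N * (dir_deriv e P x * t (Suc N) x / fact N)) y"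
      by (intro vanishes_to_order_mult[OF S y(1)] vanishes_to_order_power[OF S y(1)] smooth_on_power
          smooth_on_divide smooth_on_mult smooth_on_dir_deriv S P nP t smooth_on_const)
        (auto simp: P_def y)
    then show "vanishes_to_order N (dir_deriv e (R N)) y"
      by (rule vanishes_to_order_cong[OF S y(1), rotated]) (simp add: DR)
  qed
  \<comment> \<open>All summands of \<open>R N x\<close> with positive index contain a factor
    \<open>- P x\<close>; \<phi> is what remains when it is taken out.\<close>
  define \<phi> where "\<phi> x = (\<Sum>k<N. (- P x) ^ k * t (Suc k) x / fact (Suc k))" for x
  have "smooth_on S \<phi>"
    unfolding \<phi>_def
    by (intro smooth_on_sum smooth_on_divide smooth_on_mult smooth_on_power smooth_on_minus S P t
        smooth_on_const fact_nonzero)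
  moreover have "R N x = E x - P x * \<phi> x" for x
  proof -
    have "R N x = E x + (\<Sum>k<N. (- P x) ^ Suc k * t (Suc k) x / fact (Suc k))"
      unfolding R_def by (subst sum.atMost_shift) (simp add: t_def)
    also have "(\<Sum>k<N. (- P x) ^ Suc k * t (Suc k) x / fact (Suc k)) = - (P x * \<phi> x)"
      unfolding \<phi>_def sum_distrib_left sum_negf[symmetric] by (rule sum.cong) (auto simp: algebra_simps)
    finally show ?thesis by simp
  qed
  then have "R N = (\<lambda>x. E x - P x * \<phi> x)" by blast
  ultimately show ?thesis
    using that[of \<phi>] vanishes_to_order_mono[OF RV, of _ N] by (simp add: P_def)
qed

section \<open>Wirtinger derivatives\<close>

text \<open>Both \<open>pd\<close> (for \<open>s = - \<i>\<close>) and \<open>pdbar\<close> (for \<open>s = \<i>\<close>).\<close>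

definition wirtinger :: "complex \<Rightarrow> 'k::finite \<Rightarrow> (complex^'k \<Rightarrow> complex) \<Rightarrow> complex^'k \<Rightarrow> complex" where
  "wirtinger s j f z = (dir_deriv (axis j 1) f z + s * dir_deriv (axis j \<i>) f z) / 2"

lemma pd_eq_wirtinger: "pd = wirtinger (- \<i>)"
  by (intro ext) (simp add: pd_def wirtinger_def dir_deriv_def)

lemma pdbar_eq_wirtinger: "pdbar = wirtinger \<i>"
  by (intro ext) (simp add: pdbar_def wirtinger_def dir_deriv_def)

lemma smooth_on_wirtinger: "open S \<Longrightarrow> smooth_on S f \<Longrightarrow> smooth_on S (wirtinger s j f)"
  unfolding wirtinger_def[abs_def]
  by (intro smooth_on_divide smooth_on_add smooth_on_mult smooth_on_dir_deriv smooth_on_const) auto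

lemma wirtinger_cong:
  assumes "open S" "x \<in> S" "\<And>y. y \<in> S \<Longrightarrow> f y = g y"
  shows "wirtinger s j f x = wirtinger s j g x"
  unfolding wirtinger_def using dir_deriv_cong[OF assms] by simp

lemma wirtinger_const [simp]: "wirtinger s j (\<lambda>x. c) = (\<lambda>x. 0)"
  by (simp add: wirtinger_def fun_eq_iff)

lemma wirtinger_add:
  "f differentiable (at x) \<Longrightarrow> g differentiable (at x) \<Longrightarrow>
    wirtinger s j (\<lambda>x. f x + g x) x = wirtinger s j f x + wirtinger s j g x"
  by (simp add: wirtinger_def dir_deriv_add algebra_simps add_divide_distrib)

lemma wirtinger_mult:
  "f differentiable (at x) \<Longrightarrow> g differentiable (at x) \<Longrightarrow>
    wirtinger s j (\<lambda>x. f x * g x) x = wirtinger s j f x * g x + f x * wirtinger s j g x"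
  by (simp add: wirtinger_def dir_deriv_mult algebra_simps add_divide_distrib)

lemma wirtinger_diff:
  "f differentiable (at x) \<Longrightarrow> g differentiable (at x) \<Longrightarrow>
    wirtinger s j (\<lambda>x. f x - g x) x = wirtinger s j f x - wirtinger s j g x"
  by (simp add: wirtinger_def dir_deriv_diff algebra_simps diff_divide_distrib)

lemma mixed_diff:
  assumes S: "open S" "x \<in> S" and f: "smooth_on S f" and g: "smooth_on S g"
  shows "pd j (pdbar k (\<lambda>x. f x - g x)) x = pd j (pdbar k f) x - pd j (pdbar k g) x"
proof -
  have "pd j (pdbar k (\<lambda>x. f x - g x)) x = pd j (\<lambda>x. pdbar k f x - pdbar k g x) x"
    unfolding pd_eq_wirtinger pdbar_eq_wirtinger
    by (rule wirtinger_cong[OF S]) (intro wirtinger_diff smooth_on_differentiable[OF f] smooth_on_differentiable[OF g])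
  also have "\<dots> = pd j (pdbar k f) x - pd j (pdbar k g) x"
    unfolding pd_eq_wirtinger pdbar_eq_wirtinger
    by (intro wirtinger_diff smooth_on_differentiable[OF smooth_on_wirtinger[OF S(1)]] f g S(2))
  finally show ?thesis .
qed

lemma dir_deriv_wirtinger:
  assumes S: "open S" "x \<in> S" and f: "smooth_on S f"
  shows "dir_deriv v (wirtinger s j f) x = wirtinger s j (dir_deriv v f) x"
proof -
  have d: "dir_deriv w f differentiable (at x)" for w
    by (rule smooth_on_differentiable[OF smooth_on_dir_deriv[OF f] S(2)])
  have "((wirtinger s j f) has_derivative (\<lambda>v. (dir_deriv v (dir_deriv (axis j 1) f) x
      + s * dir_deriv v (dir_deriv (axis j \<i>) f) x) / 2)) (at x)"
    unfolding wirtinger_def[abs_def]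
    by (intro bounded_linear.has_derivative[OF bounded_linear_divide] has_derivative_add
        bounded_linear.has_derivative[OF bounded_linear_mult_right] dir_deriv_has_derivative d)
  from dir_deriv_eqI[OF this] show ?thesis
    by (simp add: wirtinger_def dir_deriv_commute[OF S f, of _ v])
qed

lemma foldr_dir_deriv_wirtinger:
  assumes S: "open S" "x \<in> S" and f: "smooth_on S f"
  shows "foldr dir_deriv vs (wirtinger s j f) x = wirtinger s j (foldr dir_deriv vs f) x"
  using S(2)
proof (induction vs arbitrary: x)
  case (Cons v vs)
  have "foldr dir_deriv (v # vs) (wirtinger s j f) x = dir_deriv v (wirtinger s j (foldr dir_deriv vs f)) x"
    using dir_deriv_cong[OF S(1) Cons.prems Cons.IH] by simp
  also have "\<dots> = wirtinger s j (foldr dir_deriv (v # vs) f) x"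
    using dir_deriv_wirtinger[OF S(1) Cons.prems smooth_on_foldr[OF f]] by simp
  finally show ?case .
qed simp

lemma wirtinger_wirtinger:
  assumes S: "open S" "x \<in> S" and f: "smooth_on S f"
  shows "wirtinger s j (wirtinger t k f) x =
    (dir_deriv (axis j 1) (dir_deriv (axis k 1) f) x + t * dir_deriv (axis j 1) (dir_deriv (axis k \<i>) f) x
     + s * dir_deriv (axis j \<i>) (dir_deriv (axis k 1) f) x
     + s * t * dir_deriv (axis j \<i>) (dir_deriv (axis k \<i>) f) x) / 4"
proof -
  have "wirtinger s j (wirtinger t k f) x =
      (wirtinger t k (dir_deriv (axis j 1) f) x + s * wirtinger t k (dir_deriv (axis j \<i>) f) x) / 2"
    by (subst wirtinger_def) (simp only: dir_deriv_wirtinger[OF S f])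
  then show ?thesis
    by (simp add: wirtinger_def dir_deriv_commute[OF S f, of "axis k _" "axis j _"] algebra_simps add_divide_distrib)
qed

lemma wirtinger_commute:
  assumes S: "open S" "x \<in> S" and f: "smooth_on S f"
  shows "wirtinger s j (wirtinger t k f) x = wirtinger t k (wirtinger s j f) x"
  unfolding wirtinger_wirtinger[OF S f]
  by (simp add: dir_deriv_commute[OF S f, of "axis k _" "axis j _"] algebra_simps)

lemma vanishes_to_order_wirtinger:
  assumes "open S" "x \<in> S" "smooth_on S f" "vanishes_to_order (Suc k) f x"
  shows "vanishes_to_order k (wirtinger s j f) x"
  unfolding vanishes_to_order_def foldr_dir_deriv_wirtinger[OF assms(1-3)]
proof (intro allI impI)
  fix vs :: "(complex^'a) list" assume "length vs < k"
  then have "dir_deriv v (foldr dir_deriv vs f) x = 0" for v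
    using assms(4)[unfolded vanishes_to_order_def, rule_format, of "v # vs"] by simp
  then show "wirtinger s j (foldr dir_deriv vs f) x = 0" by (simp add: wirtinger_def)
qed

lemma dir_deriv_eq_wirtinger:
  fixes f :: "complex^'k::finite \<Rightarrow> complex"
  assumes f: "f differentiable (at x)"
  shows "dir_deriv v f x = (\<Sum>j\<in>UNIV. pd j f x * v $ j + pdbar j f x * cnj (v $ j))"
proof -
  interpret linear "\<lambda>v. dir_deriv v f x"
    using dir_deriv_has_derivative[OF f] has_derivative_linear by blast
  have "v = (\<Sum>j\<in>UNIV. Re (v $ j) *\<^sub>R axis j 1 + Im (v $ j) *\<^sub>R axis j \<i>)"
    by (simp add: vec_eq_iff axis_def if_distrib[of "\<lambda>x. _ *\<^sub>R x"] sum.distrib complex_eq_iff cong: if_cong)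
  then have "dir_deriv v f x = (\<Sum>j\<in>UNIV. Re (v $ j) *\<^sub>R dir_deriv (axis j 1) f x + Im (v $ j) *\<^sub>R dir_deriv (axis j \<i>) f x)"
    by (metis (no_types, lifting) sum add scale sum.cong)
  also have "\<dots> = (\<Sum>j\<in>UNIV. pd j f x * v $ j + pdbar j f x * cnj (v $ j))"
  proof (rule sum.cong[OF refl])
    fix j
    have "pd j f x * v $ j + pdbar j f x * cnj (v $ j) =
      dir_deriv (axis j 1) f x * ((v $ j + cnj (v $ j)) / 2) + dir_deriv (axis j \<i>) f x * (\<i> * (cnj (v $ j) - v $ j) / 2)"
      by (simp add: pd_eq_wirtinger pdbar_eq_wirtinger wirtinger_def field_simps)
    moreover have "(v $ j + cnj (v $ j)) / 2 = of_real (Re (v $ j))" "\<i> * (cnj (v $ j) - v $ j) / 2 = of_real (Im (v $ j))"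
      by (auto simp: complex_eq_iff)
    ultimately show "Re (v $ j) *\<^sub>R dir_deriv (axis j 1) f x + Im (v $ j) *\<^sub>R dir_deriv (axis j \<i>) f x
      = pd j f x * v $ j + pdbar j f x * cnj (v $ j)"
      by (simp add: scaleR_conv_of_real mult.commute)
  qed
  finally show ?thesis .
qed

lemma dir_deriv_of_real:
  "\<rho> differentiable (at x) \<Longrightarrow>
    dir_deriv v (\<lambda>y. complex_of_real (\<rho> y)) x = complex_of_real (dir_deriv v \<rho> x)"
  by (rule dir_deriv_bounded_linear[OF bounded_linear_of_real])

lemma differentiable_of_real:
  "\<rho> differentiable (at x) \<Longrightarrow> (\<lambda>y. complex_of_real (\<rho> y)) differentiable (at x)"
  unfolding differentiable_def using bounded_linear.has_derivative[OF bounded_linear_of_real] by blast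

lemma pdbar_of_real:
  "\<rho> differentiable (at x) \<Longrightarrow>
    pdbar j (\<lambda>y. complex_of_real (\<rho> y)) x = cnj (pd j (\<lambda>y. complex_of_real (\<rho> y)) x)"
  by (simp add: pd_eq_wirtinger pdbar_eq_wirtinger wirtinger_def dir_deriv_of_real)

lemma dir_deriv_real_eq_pd:
  fixes \<rho> :: "complex^'k::finite \<Rightarrow> real"
  assumes "\<rho> differentiable (at x)"
  shows "dir_deriv v \<rho> x = 2 * Re (\<Sum>j\<in>UNIV. pd j (\<lambda>y. complex_of_real (\<rho> y)) x * v $ j)"
proof -
  let ?R = "\<lambda>y. complex_of_real (\<rho> y)"
  have "complex_of_real (dir_deriv v \<rho> x) = (\<Sum>j\<in>UNIV. pd j ?R x * v $ j + cnj (pd j ?R x * v $ j))"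
    using dir_deriv_eq_wirtinger[OF differentiable_of_real[OF assms], of v]
    by (simp add: dir_deriv_of_real assms pdbar_of_real)
  also have "\<dots> = complex_of_real (2 * Re (\<Sum>j\<in>UNIV. pd j ?R x * v $ j))"
    unfolding complex_add_cnj by simp (simp add: sum_distrib_left)
  finally show ?thesis using of_real_eq_iff by blast
qed

text \<open>Together with \<open>dir_deriv_real_eq_pd\<close> this recovers the complex number
  \<partial>\<rho>(v) from two real derivatives: both vanish exactly if \<partial>\<rho>(v) does,
  which is how complex tangent vectors are recognised.\<close>

lemma dir_deriv_i_scale:
  fixes \<rho> :: "complex^'k::finite \<Rightarrow> real"
  assumes "\<rho> differentiable (at x)"
  shows "dir_deriv (\<i> *s v) \<rho> x = - 2 * Im (\<Sum>j\<in>UNIV. pd j (\<lambda>y. complex_of_real (\<rho> y)) x * v $ j)"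
proof -
  have "(\<Sum>j\<in>UNIV. pd j (\<lambda>y. complex_of_real (\<rho> y)) x * (\<i> *s v) $ j)
      = \<i> * (\<Sum>j\<in>UNIV. pd j (\<lambda>y. complex_of_real (\<rho> y)) x * v $ j)"
    by (simp add: sum_distrib_left algebra_simps)
  then show ?thesis unfolding dir_deriv_real_eq_pd[OF assms] by simp
qed

section \<open>Pluriharmonic functions vanishing on a strictly pseudoconvex hypersurface\<close>

text \<open>One of \<open>e\<close> and \<open>- e\<close> points into the side where \<rho> is
  positive, so \<open>y\<close> is approached along a ray through zeros of \<open>q\<close>. This
  carries identities known only on the pseudoconvex side over to the hypersurface.\<close>

lemma zero_on_boundary:
  fixes \<rho> :: "'a::real_normed_vector \<Rightarrow> real" and q :: "'a \<Rightarrow> 'b::real_normed_vector"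
  assumes S: "open S" "y \<in> S" and \<rho>: "\<rho> differentiable (at y)" "\<rho> y = 0" "dir_deriv e \<rho> y \<noteq> 0"
    and q: "isCont q y" "\<And>x. x \<in> S \<Longrightarrow> \<rho> x > 0 \<Longrightarrow> q x = 0"
  shows "q y = 0"
proof -
  define e' where "e' = sgn (dir_deriv e \<rho> y) *\<^sub>R e"
  have e': "dir_deriv e' \<rho> y > 0"
    using \<rho>(3) by (simp add: e'_def dir_deriv_linear_arg[OF \<rho>(1)] sgn_if)
  have "((\<lambda>t. \<rho> (y + t *\<^sub>R e')) has_real_derivative dir_deriv e' \<rho> y) (at 0)"
    unfolding has_real_derivative_iff_has_vector_derivative
    using dir_deriv_segment[of \<rho> y 0 e'] \<rho>(1) by simp
  from DERIV_pos_inc_right[OF this e'] obtain d where d: "d > 0" "\<And>h. h > 0 \<Longrightarrow> h < d \<Longrightarrow> \<rho> (y + h *\<^sub>R e') > 0"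
    using \<rho>(2) by auto
  have lim: "((\<lambda>t. y + t *\<^sub>R e') \<longlongrightarrow> y) (at_right 0)"
    by (auto intro!: tendsto_eq_intros)
  then have "((\<lambda>t. q (y + t *\<^sub>R e')) \<longlongrightarrow> q y) (at_right 0)"
    using q(1) isCont_tendsto_compose by blast
  moreover have "eventually (\<lambda>t. q (y + t *\<^sub>R e') = 0) (at_right 0)"
  proof -
    have "eventually (\<lambda>t. y + t *\<^sub>R e' \<in> S) (at_right 0)" using topological_tendstoD[OF lim S] .
    moreover have "eventually (\<lambda>t. 0 < t \<and> t < d) (at_right (0::real))"
      using d(1) eventually_at_right_less[of 0] eventually_at_right_field by (metis (no_types, lifting))
    ultimately show ?thesis by eventually_elim (use q(2) d(2) in auto)
  qed
  then have "((\<lambda>t. q (y + t *\<^sub>R e')) \<longlongrightarrow> 0) (at_right 0)" by (rule tendsto_eventually)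
  ultimately show ?thesis using tendsto_unique trivial_limit_at_right_real by blast
qed

text \<open>Write \<open>u = \<rho> \<phi>\<close> up to third order. On \<open>T\<^sup>1\<^sup>,\<^sup>0\<close> the mixed second derivatives of \<open>u\<close> are \<open>\<phi>\<close>
  times the Levi form of \<open>\<rho>\<close>, which forces \<open>\<phi> = 0\<close> on the hypersurface.\<close>

lemma pluriharmonic_first_order:
  fixes \<rho> :: "complex^'m::finite \<Rightarrow> real"
  assumes S: "open S" and \<rho>: "smooth_on S \<rho>" and e: "\<And>y. y \<in> S \<Longrightarrow> dir_deriv e \<rho> y \<noteq> 0"
    and u: "smooth_on S u" and u0: "\<And>y. y \<in> S \<Longrightarrow> \<rho> y = 0 \<Longrightarrow> u y = 0"
    and y: "y \<in> S" "\<rho> y = 0" and mixed: "\<And>j k. pd j (pdbar k u) y = 0"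
    and Z: "(\<Sum>j\<in>UNIV. pd j (\<lambda>y. complex_of_real (\<rho> y)) y * Z $ j) = 0"
    and levi: "(\<Sum>j\<in>UNIV. \<Sum>k\<in>UNIV. pd j (pdbar k (\<lambda>y. complex_of_real (\<rho> y))) y * Z $ j * cnj (Z $ k)) \<noteq> 0"
  shows "dir_deriv v u y = 0"
proof -
  let ?R = "\<lambda>y. complex_of_real (\<rho> y)"
  have R: "smooth_on S ?R" by (rule smooth_on_of_real[OF S \<rho>])
  \<comment> \<open>Order 3, because the second derivatives of the error have to vanish at
    \<open>y\<close>.\<close>
  obtain \<phi> where \<phi>: "smooth_on S \<phi>" and van: "vanishes_to_order 3 (\<lambda>x. u x - ?R x * \<phi> x) y"
    using division_up_to_order[OF S \<rho> u e u0, of 3] y by blast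
  define w where "w x = u x - ?R x * \<phi> x" for x
  have w: "smooth_on S w" unfolding w_def[abs_def] by (intro smooth_on_diff smooth_on_mult S u R \<phi>)
  have R\<phi>: "smooth_on S (\<lambda>x. ?R x * \<phi> x)" by (intro smooth_on_mult S R \<phi>)
  have vw: "vanishes_to_order 3 w y" using van by (simp add: w_def[abs_def])
  have u_eq: "u = (\<lambda>x. w x + ?R x * \<phi> x)" by (auto simp: w_def)
  note diff = smooth_on_differentiable[OF _ y(1)]
  have "pd j (pdbar k u) y = \<phi> y * pd j (pdbar k ?R) y + pdbar k ?R y * pd j \<phi> y + pd j ?R y * pdbar k \<phi> y" for j k
  proof -
    have 1: "pdbar k u x = pdbar k w x + (pdbar k ?R x * \<phi> x + ?R x * pdbar k \<phi> x)" if "x \<in> S" for x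
      unfolding u_eq pdbar_eq_wirtinger using w R \<phi> R\<phi> that
      by (simp add: wirtinger_add wirtinger_mult smooth_on_differentiable)
    have "pd j (pdbar k u) y = pd j (\<lambda>x. pdbar k w x + (pdbar k ?R x * \<phi> x + ?R x * pdbar k \<phi> x)) y"
      unfolding pd_eq_wirtinger by (rule wirtinger_cong[OF S y(1) 1])
    also have "\<dots> = pd j (pdbar k w) y + (pd j (pdbar k ?R) y * \<phi> y + pdbar k ?R y * pd j \<phi> y
        + (pd j ?R y * pdbar k \<phi> y + ?R y * pd j (pdbar k \<phi>) y))"
    proof -
      have d: "pdbar k w differentiable (at y)" "pdbar k ?R differentiable (at y)"
        "pdbar k \<phi> differentiable (at y)" "?R differentiable (at y)" "\<phi> differentiable (at y)"
        unfolding pdbar_eq_wirtinger by (intro diff smooth_on_wirtinger S w R \<phi>)+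
      have d2: "(\<lambda>x. pdbar k ?R x * \<phi> x) differentiable (at y)"
        "(\<lambda>x. ?R x * pdbar k \<phi> x) differentiable (at y)"
        by (rule differentiable_mult[OF d(2,5)], rule differentiable_mult[OF d(4,3)])
      show ?thesis
        unfolding pd_eq_wirtinger
        by (simp only: wirtinger_add[OF d(1) differentiable_add[OF d2]] wirtinger_add[OF d2]
            wirtinger_mult[OF d(2) d(5)] wirtinger_mult[OF d(4) d(3)])
    qed
    also have "pd j (pdbar k w) y = 0"
    proof -
      have "vanishes_to_order (Suc 0) (wirtinger (-\<i>) j (wirtinger \<i> k w)) y"
        using vw by (intro vanishes_to_order_wirtinger[OF S y(1)] smooth_on_wirtinger S w) (simp add: numeral_3_eq_3)
      then show ?thesis by (simp add: vanishes_to_order_Suc pd_eq_wirtinger pdbar_eq_wirtinger)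
    qed
    finally show ?thesis using y(2) by (simp add: algebra_simps)
  qed
  then have eq: "\<phi> y * pd j (pdbar k ?R) y + pdbar k ?R y * pd j \<phi> y + pd j ?R y * pdbar k \<phi> y = 0" for j k
    using mixed by simp
  have Z': "(\<Sum>k\<in>UNIV. pdbar k ?R y * cnj (Z $ k)) = 0"
    using arg_cong[OF Z, of cnj] diff[OF \<rho>] by (simp add: pdbar_of_real)
  \<comment> \<open>On contraction with \<open>Z\<close> and its conjugate, each of the two rank one
    terms acquires the factor \<partial>\<rho>(Z) or its conjugate and drops out; \<phi> times the
    Levi form remains.\<close>
  have "0 = (\<Sum>j\<in>UNIV. \<Sum>k\<in>UNIV. (\<phi> y * pd j (pdbar k ?R) y + pdbar k ?R y * pd j \<phi> y + pd j ?R y * pdbar k \<phi> y)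
      * Z $ j * cnj (Z $ k))" unfolding eq by simp
  also have "\<dots> = \<phi> y * (\<Sum>j\<in>UNIV. \<Sum>k\<in>UNIV. pd j (pdbar k ?R) y * Z $ j * cnj (Z $ k))
      + (\<Sum>j\<in>UNIV. pd j \<phi> y * Z $ j) * (\<Sum>k\<in>UNIV. pdbar k ?R y * cnj (Z $ k))
      + (\<Sum>j\<in>UNIV. pd j ?R y * Z $ j) * (\<Sum>k\<in>UNIV. pdbar k \<phi> y * cnj (Z $ k))"
    unfolding sum_product
    by (simp add: sum_distrib_left[of "\<phi> y"] sum.distrib[symmetric] algebra_simps)
  finally have \<phi>0: "\<phi> y = 0" using levi by (simp add: Z Z')
  have "vanishes_to_order (Suc (Suc 0)) w y" using vanishes_to_order_mono[OF vw] by simp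
  then have "dir_deriv v w y = 0" by (simp add: vanishes_to_order_Suc)
  then show ?thesis
    unfolding u_eq by (simp add: dir_deriv_add[OF diff[OF w] diff[OF R\<phi>]] dir_deriv_mult[OF diff[OF R] diff[OF \<phi>]] y \<phi>0)
qed

text \<open>If all derivatives of \<open>g\<close> up to first order vanish on the hypersurface, then its Hessian there
  is a multiple of \<open>d\<rho> \<otimes> d\<rho>\<close>, so that the Hessian vanishes as soon as its mixed part does.\<close>

lemma pluriharmonic_flat:
  fixes \<rho> :: "complex^'m::finite \<Rightarrow> real"
  assumes S: "open S" and \<rho>: "smooth_on S \<rho>" and e: "\<And>y. y \<in> S \<Longrightarrow> dir_deriv e \<rho> y \<noteq> 0"
    and u: "smooth_on S u" and u0: "\<And>y. y \<in> S \<Longrightarrow> \<rho> y = 0 \<Longrightarrow> u y = 0"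
    and mixed: "\<And>y j k. y \<in> S \<Longrightarrow> \<rho> y > 0 \<Longrightarrow> pd j (pdbar k u) y = 0"
    and levi: "\<And>y. y \<in> S \<Longrightarrow> \<rho> y = 0 \<Longrightarrow>
      \<exists>Z. (\<Sum>j\<in>UNIV. pd j (\<lambda>y. complex_of_real (\<rho> y)) y * Z $ j) = 0 \<and>
      (\<Sum>j\<in>UNIV. \<Sum>k\<in>UNIV. pd j (pdbar k (\<lambda>y. complex_of_real (\<rho> y))) y * Z $ j * cnj (Z $ k)) \<noteq> 0"
    and y: "y \<in> S" "\<rho> y = 0"
  shows "vanishes_to_order n u y"
proof -
  let ?R = "\<lambda>y. complex_of_real (\<rho> y)"
  have mixed_smooth: "smooth_on S (pd j (pdbar k u))" for j k
    unfolding pd_eq_wirtinger pdbar_eq_wirtinger by (intro smooth_on_wirtinger S u)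
  have op: "open {x \<in> S. \<rho> x > 0}"
    using continuous_open_preimage[OF smooth_on_continuous[OF \<rho>] S, of "{0<..}"]
    by (simp add: vimage_def Int_def)
  \<comment> \<open>The mixed derivatives vanish on the open set where \<rho> > 0, hence so do all
    their derivatives there, and continuity extends this to the hypersurface.\<close>
  have mixed0: "foldr dir_deriv vs (pd j (pdbar k u)) y = 0" if y: "y \<in> S" "\<rho> y = 0" for vs j k y
  proof (rule zero_on_boundary[OF S y(1) smooth_on_differentiable[OF \<rho> y(1)] y(2) e[OF y(1)]])
    show "isCont (foldr dir_deriv vs (pd j (pdbar k u))) y"
      by (rule smooth_on_isCont[OF smooth_on_foldr[OF mixed_smooth] y(1)])
    fix x assume "x \<in> S" "\<rho> x > 0"
    then show "foldr dir_deriv vs (pd j (pdbar k u)) x = 0"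
      using foldr_dir_deriv_cong[OF op, of "pd j (pdbar k u)" "\<lambda>x. 0" x] mixed
      by (simp add: foldr_dir_deriv_zero)
  qed
  have "length vs = l \<Longrightarrow> y \<in> S \<Longrightarrow> \<rho> y = 0 \<Longrightarrow> foldr dir_deriv vs u y = 0" for l vs y
  proof (induction l arbitrary: vs y rule: less_induct)
    case (less l)
    note y = less.prems(2,3)
    consider "vs = []" | v where "vs = [v]" | v1 v2 ws where "vs = v1 # v2 # ws"
      by (metis list.exhaust)
    then show ?case
    proof cases
      case 1
      then show ?thesis using u0 y by simp
    next
      case 2
      obtain Z where Z: "(\<Sum>j\<in>UNIV. pd j ?R y * Z $ j) = 0"
        "(\<Sum>j\<in>UNIV. \<Sum>k\<in>UNIV. pd j (pdbar k ?R) y * Z $ j * cnj (Z $ k)) \<noteq> 0"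
        using levi[OF y] by blast
      have "dir_deriv v u y = 0"
        by (rule pluriharmonic_first_order[OF S \<rho> e u u0 y _ Z]) (use mixed0[OF y, of "[]"] in auto)
      then show ?thesis using 2 by simp
    next
      case 3
      \<comment> \<open>The two outermost directions are split off. The induction hypothesis then
        covers all first derivatives of \<open>g\<close>, at every point of the hypersurface in
        \<open>S\<close>.\<close>
      define g where "g = foldr dir_deriv ws u"
      have g: "smooth_on S g" unfolding g_def by (rule smooth_on_foldr[OF u])
      have Dg0: "dir_deriv v g x = 0" if "x \<in> S" "\<rho> x = 0" for v x
        using less.IH[of "Suc (length ws)" "v # ws" x] that less.prems(1) by (simp add: 3 g_def)
      define \<kappa> where "\<kappa> = dir_deriv e (dir_deriv e g) y / (dir_deriv e ?R y)\<^sup>2"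
      have \<rho>d: "\<rho> differentiable (at y)" by (rule smooth_on_differentiable[OF \<rho> y(1)])
      have DR: "dir_deriv v ?R y = of_real (dir_deriv v \<rho> y)" for v
        by (rule dir_deriv_of_real[OF \<rho>d])
      have 1: "dir_deriv a (dir_deriv b g) y = (dir_deriv a ?R y / dir_deriv e ?R y) * dir_deriv e (dir_deriv b g) y" for a b
        using dir_deriv_on_zero_set[where w = "dir_deriv b g" and v = a,
            OF S y(1) \<rho> smooth_on_differentiable[OF smooth_on_dir_deriv[OF g] y(1)] y(2) Dg0 e[OF y(1)]]
        by (simp add: DR scaleR_conv_of_real)
      have 2: "dir_deriv e (dir_deriv b g) y = (dir_deriv b ?R y / dir_deriv e ?R y) * dir_deriv e (dir_deriv e g) y" for b
        using dir_deriv_commute[OF S y(1) g, of e b] 1[of b e] by simp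
      have hess: "dir_deriv a (dir_deriv b g) y = dir_deriv a ?R y * dir_deriv b ?R y * \<kappa>" for a b
        unfolding 1[of a b] 2[of b] \<kappa>_def by (simp add: power2_eq_square)
      \<comment> \<open>Any index with a nonzero derivative of \<rho> will do: the diagonal mixed
        derivative of \<open>g\<close> is \<kappa> times the squared modulus of
        \<open>pd j ?R y\<close>.\<close>
      have "\<exists>j. pd j ?R y \<noteq> 0"
        using e[OF y(1)] unfolding dir_deriv_real_eq_pd[OF \<rho>d] by (metis (no_types, lifting) mult_eq_0_iff sum.neutral zero_complex.sel(1))
      then obtain j where j: "pd j ?R y \<noteq> 0" by blast
      have "pd j (pdbar j g) y = foldr dir_deriv ws (pd j (pdbar j u)) y"
      proof -
        have "foldr dir_deriv ws (wirtinger (-\<i>) j (wirtinger \<i> j u)) y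
            = wirtinger (-\<i>) j (foldr dir_deriv ws (wirtinger \<i> j u)) y"
          by (rule foldr_dir_deriv_wirtinger[OF S y(1) smooth_on_wirtinger[OF S u]])
        also have "\<dots> = wirtinger (-\<i>) j (wirtinger \<i> j g) y"
          unfolding g_def by (rule wirtinger_cong[OF S y(1) foldr_dir_deriv_wirtinger[OF S _ u]])
        finally show ?thesis by (simp add: pd_eq_wirtinger pdbar_eq_wirtinger)
      qed
      also have "\<dots> = 0" by (rule mixed0[OF y])
      finally have "pd j (pdbar j g) y = 0" .
      moreover have "pd j (pdbar j g) y = pd j ?R y * pdbar j ?R y * \<kappa>"
        unfolding pd_eq_wirtinger pdbar_eq_wirtinger wirtinger_wirtinger[OF S y(1) g] hess
        unfolding wirtinger_def by (simp add: field_simps)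
      ultimately have "\<kappa> = 0" using j by (simp add: pdbar_of_real[OF \<rho>d])
      then show ?thesis using hess[of v1 v2] by (simp add: 3 g_def)
    qed
  qed
  then show ?thesis using y by (simp add: vanishes_to_order_def)
qed

section \<open>Homogeneous functions on the ambient space\<close>

lemma bounded_linear_fibre_scale: "bounded_linear (fibre_scale \<mu>)"
  unfolding linear_conv_bounded_linear[symmetric]
  by (rule linearI) (auto simp: fibre_scale_def vec_eq_iff algebra_simps split: option.split)

lemma bounded_linear_base: "bounded_linear base"
  unfolding linear_conv_bounded_linear[symmetric]
  by (rule linearI) (auto simp: base_def vec_eq_iff)

text \<open>The linear part of the affine map \<open>unit_lift\<close>.\<close>

definition zero_lift :: "complex^'m::finite \<Rightarrow> complex^('m option)" where
  "zero_lift y = (\<chi> I. case I of None \<Rightarrow> 0 | Some j \<Rightarrow> y $ j)"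

lemma bounded_linear_zero_lift: "bounded_linear zero_lift"
  unfolding linear_conv_bounded_linear[symmetric]
  by (rule linearI) (auto simp: zero_lift_def vec_eq_iff split: option.split)

lemma unit_lift_eq: "unit_lift y = zero_lift y + axis None 1"
  by (auto simp: unit_lift_def zero_lift_def vec_eq_iff axis_def split: option.split)

lemma zero_lift_axis: "zero_lift (axis k a) = axis (Some k) a"
  by (auto simp: zero_lift_def vec_eq_iff axis_def split: option.split)

lemma base_unit_lift [simp]: "base (unit_lift y) = y"
  by (simp add: base_def unit_lift_def vec_eq_iff)

lemma unit_lift_None [simp]: "unit_lift y $ None = 1"
  by (simp add: unit_lift_def)

lemma fibre_scale_None [simp]: "fibre_scale \<mu> Z $ None = \<mu> * Z $ None"
  by (simp add: fibre_scale_def)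

lemma base_fibre_scale [simp]: "base (fibre_scale \<mu> Z) = base Z"
  by (simp add: base_def fibre_scale_def vec_eq_iff)

lemma fibre_scale_unit_lift: "fibre_scale (Z $ None) (unit_lift (base Z)) = Z"
  by (auto simp: fibre_scale_def unit_lift_def base_def vec_eq_iff split: option.split)

lemma wirtinger_unit_lift:
  assumes "f differentiable (at (unit_lift y))"
  shows "wirtinger s k (\<lambda>y. f (unit_lift y)) y = wirtinger s (Some k) f (unit_lift y)"
  using assms unfolding wirtinger_def unit_lift_eq
  by (simp add: dir_deriv_affine[OF bounded_linear_zero_lift] zero_lift_axis)

lemma smooth_on_unit_lift:
  assumes "open S" "smooth_on T f" "\<And>y. y \<in> S \<Longrightarrow> unit_lift y \<in> T"
  shows "smooth_on S (\<lambda>y. f (unit_lift y))"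
  unfolding unit_lift_eq
  by (rule smooth_on_affine[OF assms(1) bounded_linear_zero_lift assms(2)]) (use assms(3) in \<open>simp add: unit_lift_eq\<close>)

lemma smooth_on_base:
  assumes "open S" "smooth_on T f" "\<And>Z. Z \<in> S \<Longrightarrow> base Z \<in> T"
  shows "smooth_on S (\<lambda>Z. f (base Z))"
  using smooth_on_affine[OF assms(1) bounded_linear_base assms(2), where b = 0] assms(3) by simp

lemma vanishes_to_order_base:
  assumes "open S" "Z \<in> S" "smooth_on T f" "\<And>Z. Z \<in> S \<Longrightarrow> base Z \<in> T" "vanishes_to_order k f (base Z)"
  shows "vanishes_to_order k (\<lambda>Z. f (base Z)) Z"
  using vanishes_to_order_affine[OF assms(1,2) bounded_linear_base assms(3), where b = 0] assms(4,5) by simp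

lemma dir_deriv_axis:
  fixes f :: "complex^'k::finite \<Rightarrow> complex"
  assumes "f differentiable (at x)"
  shows "dir_deriv (axis j a) f x = pd j f x * a + pdbar j f x * cnj a"
proof -
  have "(\<Sum>k\<in>UNIV. pd k f x * axis j a $ k + pdbar k f x * cnj (axis j a $ k))
      = (\<Sum>k\<in>UNIV. if k = j then pd j f x * a + pdbar j f x * cnj a else 0)"
    by (rule sum.cong) (auto simp: axis_def)
  then show ?thesis by (simp add: dir_deriv_eq_wirtinger[OF assms])
qed

text \<open>The eigenvalue of \<open>fibre_scale \<mu>\<close> on the coordinate line
  \<open>I\<close>. Holomorphic derivatives pick up this factor and antiholomorphic ones its
  conjugate.\<close>

definition fibre_factor :: "complex \<Rightarrow> 'm option \<Rightarrow> complex" where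
  "fibre_factor \<mu> I = (if I = None then \<mu> else 1)"

lemma fibre_scale_axis: "fibre_scale \<mu> (axis I a) = axis I (fibre_factor \<mu> I * a)"
  by (auto simp: fibre_scale_def fibre_factor_def axis_def vec_eq_iff split: option.split)

lemma pd_fibre_scale:
  assumes "f differentiable (at (fibre_scale \<mu> Z))"
  shows "pd I (\<lambda>Y. f (fibre_scale \<mu> Y)) Z = fibre_factor \<mu> I * pd I f (fibre_scale \<mu> Z)"
    and "pdbar I (\<lambda>Y. f (fibre_scale \<mu> Y)) Z = cnj (fibre_factor \<mu> I) * pdbar I f (fibre_scale \<mu> Z)"
proof -
  have D: "dir_deriv v (\<lambda>Y. f (fibre_scale \<mu> Y)) Z = dir_deriv (fibre_scale \<mu> v) f (fibre_scale \<mu> Z)" for v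
    using dir_deriv_affine[OF bounded_linear_fibre_scale, where b = 0] assms by simp
  show "pd I (\<lambda>Y. f (fibre_scale \<mu> Y)) Z = fibre_factor \<mu> I * pd I f (fibre_scale \<mu> Z)"
    by (subst pd_eq_wirtinger)
      (simp add: wirtinger_def D fibre_scale_axis dir_deriv_axis[OF assms] algebra_simps)
  show "pdbar I (\<lambda>Y. f (fibre_scale \<mu> Y)) Z = cnj (fibre_factor \<mu> I) * pdbar I f (fibre_scale \<mu> Z)"
    by (subst pdbar_eq_wirtinger)
      (simp add: wirtinger_def D fibre_scale_axis dir_deriv_axis[OF assms] algebra_simps)
qed

lemma pd_coordinate:
  "pd I (\<lambda>Y::complex^'k::finite. Y $ J) Z = (if I = J then 1 else 0)"
  "pdbar I (\<lambda>Y::complex^'k. Y $ J) Z = 0"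
  "pd I (\<lambda>Y::complex^'k. cnj (Y $ J)) Z = 0"
  "pdbar I (\<lambda>Y::complex^'k. cnj (Y $ J)) Z = (if I = J then 1 else 0)"
proof -
  have 1: "dir_deriv v (\<lambda>Y::complex^'k. Y $ J) Z = v $ J" for v
    by (rule dir_deriv_eqI[OF bounded_linear_imp_has_derivative[OF bounded_linear_vec_nth]])
  have 2: "dir_deriv v (\<lambda>Y::complex^'k. cnj (Y $ J)) Z = cnj (v $ J)" for v
    by (rule dir_deriv_eqI[OF bounded_linear_imp_has_derivative[OF
            bounded_linear_compose[OF bounded_linear_cnj bounded_linear_vec_nth]]])
  show "pd I (\<lambda>Y::complex^'k. Y $ J) Z = (if I = J then 1 else 0)"
    "pdbar I (\<lambda>Y::complex^'k. Y $ J) Z = 0"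
    "pd I (\<lambda>Y::complex^'k. cnj (Y $ J)) Z = 0"
    "pdbar I (\<lambda>Y::complex^'k. cnj (Y $ J)) Z = (if I = J then 1 else 0)"
    by (auto simp: pd_eq_wirtinger pdbar_eq_wirtinger wirtinger_def 1 2 axis_def)
qed

locale fibred_domain =
  fixes D :: "(complex^('m::finite option)) set"
  assumes open_D: "open D"
    and scale_D: "Z \<in> D \<Longrightarrow> \<mu> \<noteq> 0 \<Longrightarrow> fibre_scale \<mu> Z \<in> D"
    and nonzero_D: "Z \<in> D \<Longrightarrow> Z $ None \<noteq> 0"
begin

text \<open>Homogeneity of degree \<open>(w, w)\<close>, with scalars written as \<open>exp s\<close>.\<close>

definition has_weight :: "real \<Rightarrow> (complex^('m option) \<Rightarrow> complex) \<Rightarrow> bool" where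
  "has_weight w \<phi> \<longleftrightarrow>
     (\<forall>Z\<in>D. \<forall>s. \<phi> (fibre_scale (exp s) Z) = of_real (exp (2 * w * Re s)) * \<phi> Z)"

text \<open>Homogeneity is differentiated at t = 0 along the curve
  \<open>fibre_scale (exp (t *\<^sub>R a)) Z\<close>. The choice a = 1 gives the radial field, and a
  = \<i> the rotation of the fibre.\<close>

lemma euler_direction:
  assumes \<phi>: "smooth_on D \<phi>" "has_weight w \<phi>" and Z: "Z \<in> D"
  shows "dir_deriv (axis None (a * Z $ None)) \<phi> Z = of_real (2 * w * Re a) * \<phi> Z"
proof -
  define \<gamma> where "\<gamma> t = Z + axis None ((exp (t *\<^sub>R a) - 1) * Z $ None)" for t :: real
  have \<gamma>: "\<gamma> t = fibre_scale (exp (t *\<^sub>R a)) Z" for t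
    by (auto simp: \<gamma>_def fibre_scale_def axis_def vec_eq_iff algebra_simps split: option.split)
  have bl: "bounded_linear (axis None :: complex \<Rightarrow> complex^('m option))"
    unfolding linear_conv_bounded_linear[symmetric] by (rule linearI) (auto simp: axis_def vec_eq_iff)
  have "((\<lambda>t. exp (t *\<^sub>R a)) has_vector_derivative a) (at 0)"
    using exp_scaleR_has_vector_derivative_right[of a 0 UNIV] by simp
  then have "((\<lambda>t. exp (t *\<^sub>R a) - 1) has_vector_derivative a) (at 0)"
    by (auto intro!: derivative_eq_intros)
  then have "((\<lambda>t. (exp (t *\<^sub>R a) - 1) * Z $ None) has_vector_derivative a * Z $ None) (at 0)"
    by (rule has_vector_derivative_mult_left)
  from bounded_linear.has_vector_derivative[OF bl this]
  have "(\<gamma> has_vector_derivative axis None (a * Z $ None)) (at 0)"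
    unfolding \<gamma>_def has_vector_derivative_def by (auto intro!: derivative_eq_intros)
  moreover have "\<gamma> 0 = Z" by (simp add: \<gamma>_def axis_def vec_eq_iff)
  ultimately have 1: "((\<lambda>t. \<phi> (\<gamma> t)) has_vector_derivative dir_deriv (axis None (a * Z $ None)) \<phi> Z) (at 0)"
    using diff_chain_at[of \<gamma> "\<lambda>h. h *\<^sub>R axis None (a * Z $ None)" 0 \<phi> "\<lambda>v. dir_deriv v \<phi> Z"]
      dir_deriv_has_derivative[OF smooth_on_differentiable[OF \<phi>(1) Z]]
    by (simp add: has_vector_derivative_def o_def dir_deriv_linear_arg(2)[OF smooth_on_differentiable[OF \<phi>(1) Z]])
  have "\<phi> (\<gamma> t) = of_real (exp (2 * w * Re a * t)) * \<phi> Z" for t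
    using \<phi>(2) Z by (simp add: \<gamma> has_weight_def algebra_simps)
  then have eq: "(\<lambda>t. \<phi> (\<gamma> t)) = (\<lambda>t. of_real (exp (2 * w * Re a * t)) * \<phi> Z)" by blast
  have "((\<lambda>t. of_real (exp (2 * w * Re a * t)) * \<phi> Z) has_vector_derivative of_real (2 * w * Re a) * \<phi> Z) (at 0)"
  proof -
    have "((\<lambda>t. exp (2 * w * Re a * t)) has_real_derivative 2 * w * Re a) (at 0)"
      by (auto intro!: derivative_eq_intros)
    then have "((\<lambda>t. complex_of_real (exp (2 * w * Re a * t))) has_vector_derivative of_real (2 * w * Re a)) (at 0)"
      unfolding has_real_derivative_iff_has_vector_derivative by (rule bounded_linear.has_vector_derivative[OF bounded_linear_of_real])
    then show ?thesis by (rule has_vector_derivative_mult_left)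
  qed
  then show ?thesis using vector_derivative_unique_at[OF 1[unfolded eq]] by blast
qed

text \<open>The radial derivative is the sum of the two Euler expressions, and invariance under
  rotation of the fibre makes them equal, so each is half of it.\<close>

lemma euler:
  assumes \<phi>: "smooth_on D \<phi>" "has_weight w \<phi>" and Z: "Z \<in> D"
  shows "Z $ None * pd None \<phi> Z = of_real w * \<phi> Z"
    and "cnj (Z $ None) * pdbar None \<phi> Z = of_real w * \<phi> Z"
proof -
  note E = euler_direction[OF assms, unfolded dir_deriv_axis[OF smooth_on_differentiable[OF \<phi>(1) Z]]]
  have 1: "Z $ None * pd None \<phi> Z + cnj (Z $ None) * pdbar None \<phi> Z = 2 * (of_real w * \<phi> Z)"
    using E[of 1] by (simp add: algebra_simps)
  have "\<i> * (Z $ None * pd None \<phi> Z - cnj (Z $ None) * pdbar None \<phi> Z) = 0"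
    using E[of \<i>] by (simp add: algebra_simps)
  then have 2: "Z $ None * pd None \<phi> Z = cnj (Z $ None) * pdbar None \<phi> Z" by simp
  show "Z $ None * pd None \<phi> Z = of_real w * \<phi> Z" "cnj (Z $ None) * pdbar None \<phi> Z = of_real w * \<phi> Z"
    using 1 unfolding 2 by simp_all
qed

text \<open>The constants \<open>a\<close> and \<open>b\<close> are kept general so that the
  conclusion has the shape of the assumption again, with \<open>a\<close> multiplied by a
  \<open>fibre_factor\<close> or its conjugate. The lemma can then be applied to the derivatives in
  turn.\<close>

lemma derivative_scaling:
  assumes f: "smooth_on D f" and sc: "\<And>Z. Z \<in> D \<Longrightarrow> a * f (fibre_scale \<mu> Z) = b * f Z"
    and Z: "Z \<in> D" and \<mu>: "\<mu> \<noteq> 0"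
  shows "(a * fibre_factor \<mu> I) * pd I f (fibre_scale \<mu> Z) = b * pd I f Z"
    and "(a * cnj (fibre_factor \<mu> I)) * pdbar I f (fibre_scale \<mu> Z) = b * pdbar I f Z"
proof -
  have fd: "f differentiable (at (fibre_scale \<mu> Z))" "f differentiable (at Z)"
    by (intro smooth_on_differentiable[OF f] scale_D Z \<mu>)+
  have fs: "(\<lambda>Y. f (fibre_scale \<mu> Y)) differentiable (at Z)"
    using differentiable_chain_at[OF bounded_linear_imp_differentiable[OF bounded_linear_fibre_scale] fd(1)]
    by (simp add: o_def)
  have "wirtinger s I (\<lambda>Y. a * f (fibre_scale \<mu> Y)) Z = wirtinger s I (\<lambda>Y. b * f Y) Z" for s
    by (rule wirtinger_cong[OF open_D Z sc])
  then have *: "a * wirtinger s I (\<lambda>Y. f (fibre_scale \<mu> Y)) Z = b * wirtinger s I f Z" for s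
    by (simp add: wirtinger_mult fd fs)
  show "(a * fibre_factor \<mu> I) * pd I f (fibre_scale \<mu> Z) = b * pd I f Z"
    using *[of "-\<i>"] pd_fibre_scale(1)[OF fd(1), of I] by (simp add: pd_eq_wirtinger mult.assoc)
  show "(a * cnj (fibre_factor \<mu> I)) * pdbar I f (fibre_scale \<mu> Z) = b * pdbar I f Z"
    using *[of \<i>] pd_fibre_scale(2)[OF fd(1), of I] by (simp add: pdbar_eq_wirtinger mult.assoc)
qed

lemma mixed_derivative_scaling:
  assumes f: "smooth_on D f" "has_weight w f" and Z: "Z \<in> D"
  shows "fibre_factor (exp s) I * cnj (fibre_factor (exp s) J) * pd I (pdbar J f) (fibre_scale (exp s) Z)
    = of_real (exp (2 * w * Re s)) * pd I (pdbar J f) Z"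
proof -
  have 1: "(1 * cnj (fibre_factor (exp s) J)) * pdbar J f (fibre_scale (exp s) Z)
      = of_real (exp (2 * w * Re s)) * pdbar J f Z" if "Z \<in> D" for Z
    by (rule derivative_scaling(2)[OF f(1) _ that]) (use f(2) in \<open>auto simp: has_weight_def\<close>)
  have "smooth_on D (pdbar J f)" unfolding pdbar_eq_wirtinger by (rule smooth_on_wirtinger[OF open_D f(1)])
  from derivative_scaling(1)[OF this 1 Z, of I] show ?thesis by (simp add: mult_ac)
qed

end

definition fibred_over :: "(complex^'m::finite) set \<Rightarrow> (complex^('m option)) set" where
  "fibred_over U = {Z. Z $ None \<noteq> 0 \<and> base Z \<in> U}"

lemma unit_lift_in_fibred_over [simp]: "unit_lift y \<in> fibred_over U \<longleftrightarrow> y \<in> U"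
  by (simp add: fibred_over_def)

lemma open_fibred_over:
  assumes "open U"
  shows "open (fibred_over U)"
proof -
  have "open {Z::complex^('a option). Z $ None \<noteq> 0}"
    by (intro open_Collect_neq continuous_intros)
  moreover have "open (base -` U)"
    by (rule open_vimage[OF assms linear_continuous_on[OF bounded_linear_base]])
  moreover have "fibred_over U = {Z. Z $ None \<noteq> 0} \<inter> base -` U" by (auto simp: fibred_over_def)
  ultimately show ?thesis by auto
qed

lemma fibred_domain_fibred_over: "open U \<Longrightarrow> fibred_domain (fibred_over U)"
  by unfold_locales (auto simp: open_fibred_over, auto simp: fibred_over_def)

section \<open>The ambient Laplacian\<close>

locale ambient_space = fibred_domain D for D :: "(complex^('m::finite option)) set" +
  fixes r :: "complex^('m option) \<Rightarrow> real"
  assumes smooth_r: "smooth_on D r"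
    and weight_r: "has_weight 1 (\<lambda>Z. complex_of_real (r Z))"
begin

abbreviation R where "R \<equiv> (\<lambda>Z. complex_of_real (r Z))"

lemma smooth_R: "smooth_on D R"
  by (rule smooth_on_of_real[OF open_D smooth_r])

lemma metric_nth: "ambient_metric r Z $ I $ J = - pd I (pdbar J R) Z"
  by (simp add: ambient_metric_def)

text \<open>Euler's equation for \<open>r\<close> is differentiated once more. The fibre coordinate
  is holomorphic and its conjugate antiholomorphic, so no derivative falls on it. In terms of the
  metric, contraction with the Euler field or its conjugate gives minus a first derivative of
  \<open>r\<close>.\<close>

lemma euler_metric:
  assumes Z: "Z \<in> D"
  shows "cnj (Z $ None) * pd I (pdbar None R) Z = pd I R Z"
    and "Z $ None * pd None (pdbar J R) Z = pdbar J R Z"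
proof -
  have sm: "smooth_on D (wirtinger s I R)" for s I by (rule smooth_on_wirtinger[OF open_D smooth_R])
  have d1: "(\<lambda>Y::complex^('m option). Y $ None) differentiable (at Z)"
    by (rule bounded_linear_imp_differentiable[OF bounded_linear_vec_nth])
  have d2: "(\<lambda>Y::complex^('m option). cnj (Y $ None)) differentiable (at Z)"
    by (rule bounded_linear_imp_differentiable[OF bounded_linear_compose[OF bounded_linear_cnj bounded_linear_vec_nth]])
  have "pd I R Z = pd I (\<lambda>Y. cnj (Y $ None) * pdbar None R Y) Z"
    unfolding pd_eq_wirtinger
    by (rule wirtinger_cong[OF open_D Z]) (simp add: euler(2)[OF smooth_R weight_r])
  also have "\<dots> = pd I (\<lambda>Y. cnj (Y $ None)) Z * pdbar None R Z + cnj (Z $ None) * pd I (pdbar None R) Z"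
    unfolding pd_eq_wirtinger pdbar_eq_wirtinger
    by (rule wirtinger_mult[OF d2 smooth_on_differentiable[OF sm Z]])
  finally show "cnj (Z $ None) * pd I (pdbar None R) Z = pd I R Z" by (simp add: pd_coordinate)
  have "pdbar J R Z = pdbar J (\<lambda>Y. Y $ None * pd None R Y) Z"
    unfolding pdbar_eq_wirtinger
    by (rule wirtinger_cong[OF open_D Z]) (simp add: euler(1)[OF smooth_R weight_r])
  also have "\<dots> = pdbar J (\<lambda>Y. Y $ None) Z * pd None R Z + Z $ None * pdbar J (pd None R) Z"
    unfolding pd_eq_wirtinger pdbar_eq_wirtinger
    by (rule wirtinger_mult[OF d1 smooth_on_differentiable[OF sm Z]])
  also have "pdbar J (pd None R) Z = pd None (pdbar J R) Z"
    unfolding pd_eq_wirtinger pdbar_eq_wirtinger by (rule wirtinger_commute[OF open_D Z smooth_R])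
  finally show "Z $ None * pd None (pdbar J R) Z = pdbar J R Z" by (simp add: pd_coordinate)
qed

text \<open>Along a fibre the metric changes by a diagonal congruence and a positive factor, so the
  new inverse \<open>B\<close> can be written down and verified. The first conclusion spreads
  nondegeneracy from one point of a fibre to all of it.\<close>

lemma inverse_metric_scaling:
  assumes Z: "Z \<in> D" and nz: "det (ambient_metric r Z) \<noteq> 0"
  shows "det (ambient_metric r (fibre_scale (exp s) Z)) \<noteq> 0"
    and "matrix_inv (transpose (ambient_metric r (fibre_scale (exp s) Z))) $ I $ J
      = fibre_factor (exp s) I * cnj (fibre_factor (exp s) J) / of_real (exp (2 * Re s))
        * matrix_inv (transpose (ambient_metric r Z)) $ I $ J"
proof -
  let ?G = "ambient_metric r Z" and ?G' = "ambient_metric r (fibre_scale (exp s) Z)"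
  let ?f = "fibre_factor (exp s) :: 'm option \<Rightarrow> complex"
  define N where "N = matrix_inv (transpose ?G)"
  define B where "B = (\<chi> I J. ?f I * cnj (?f J) / of_real (exp (2 * Re s)) * N $ I $ J)"
  have f0: "?f I \<noteq> 0" for I by (simp add: fibre_factor_def)
  have G': "cnj (?f J) * ?G' $ K $ J = of_real (exp (2 * Re s)) * ?G $ K $ J / ?f K" for K J
    using mixed_derivative_scaling[OF smooth_R weight_r Z, of s K J] f0[of K]
    by (simp add: metric_nth field_simps)
  have N: "N ** transpose ?G = mat 1"
    unfolding N_def by (rule matrix_inv_nonsingular) (simp add: nz)
  have "B ** transpose ?G' = mat 1"
  proof (simp only: vec_eq_iff, intro allI)
    fix I K
    have "(B ** transpose ?G') $ I $ K
        = (\<Sum>J\<in>UNIV. ?f I / of_real (exp (2 * Re s)) * N $ I $ J * (cnj (?f J) * ?G' $ K $ J))"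
      by (simp add: matrix_matrix_mult_def B_def transpose_def algebra_simps)
    also have "\<dots> = ?f I / ?f K * (\<Sum>J\<in>UNIV. N $ I $ J * ?G $ K $ J)"
      unfolding G' sum_distrib_left by (intro sum.cong refl) (simp add: field_simps)
    also have "(\<Sum>J\<in>UNIV. N $ I $ J * ?G $ K $ J) = (N ** transpose ?G) $ I $ K"
      by (simp add: matrix_matrix_mult_def transpose_def)
    finally show "(B ** transpose ?G') $ I $ K = (mat 1 :: complex^('m option)^('m option)) $ I $ K"
      using f0[of K] by (simp add: N mat_def)
  qed
  then have inv: "det (transpose ?G') \<noteq> 0"
    by (metis det_I det_mul mult_zero_right zero_neq_one)
  then show "det ?G' \<noteq> 0" by simp
  have "matrix_inv (transpose ?G') = (B ** transpose ?G') ** matrix_inv (transpose ?G')"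
    by (simp add: \<open>B ** transpose ?G' = mat 1\<close>)
  also have "\<dots> = B" by (simp add: matrix_mul_assoc[symmetric] matrix_inv_nonsingular[OF inv])
  finally show "matrix_inv (transpose ?G') $ I $ J = ?f I * cnj (?f J) / of_real (exp (2 * Re s))
        * matrix_inv (transpose ?G) $ I $ J"
    by (simp add: B_def N_def)
qed

text \<open>At fibre coordinate 1 the Euler relations turn the \<open>None\<close> row and column of
  the metric into \<open>- r\<close> and minus the first derivatives of \<open>r\<close>. The matrix
  in \<open>monge_ampere\<close> is therefore the negative transpose of the ambient metric.\<close>

lemma det_metric_unit_lift:
  assumes y: "unit_lift y \<in> D" and ma: "monge_ampere (\<lambda>y. r (unit_lift y)) y \<noteq> 0"
  shows "det (ambient_metric r (unit_lift y)) \<noteq> 0"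
proof
  let ?Q = "\<lambda>y. complex_of_real (r (unit_lift y))"
  assume "det (ambient_metric r (unit_lift y)) = 0"
  then have "det (transpose (ambient_metric r (unit_lift y))) = 0" by simp
  moreover define T where "T = {y. unit_lift y \<in> D}"
  have op: "open T"
  proof -
    have "continuous_on UNIV (unit_lift :: complex^'m \<Rightarrow> _)"
      unfolding unit_lift_eq[abs_def]
      by (intro continuous_intros linear_continuous_on bounded_linear_zero_lift)
    then show ?thesis using open_vimage[OF open_D] by (simp add: T_def vimage_def)
  qed
  have yT: "y \<in> T" using y by (simp add: T_def)
  have lift: "wirtinger s k (\<lambda>y. f (unit_lift y)) x = wirtinger s (Some k) f (unit_lift x)"
    if "x \<in> T" "smooth_on D f" for s k f x
    using that by (intro wirtinger_unit_lift smooth_on_differentiable[OF that(2)]) (simp add: T_def)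
  have "pd k ?Q y = pd (Some k) R (unit_lift y)" "pdbar k ?Q y = pdbar (Some k) R (unit_lift y)" for k
    unfolding pd_eq_wirtinger pdbar_eq_wirtinger by (rule lift[OF yT smooth_R])+
  moreover have "pd j (pdbar k ?Q) y = pd (Some j) (pdbar (Some k) R) (unit_lift y)" for j k
  proof -
    have "pd j (pdbar k ?Q) y = pd j (\<lambda>y. pdbar (Some k) R (unit_lift y)) y"
      unfolding pd_eq_wirtinger pdbar_eq_wirtinger
      by (rule wirtinger_cong[OF op yT]) (rule lift[OF _ smooth_R])
    also have "\<dots> = pd (Some j) (pdbar (Some k) R) (unit_lift y)"
      unfolding pd_eq_wirtinger pdbar_eq_wirtinger
      by (rule lift[OF yT smooth_on_wirtinger[OF open_D smooth_R]])
    finally show ?thesis .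
  qed
  moreover have "pd I (pdbar None R) (unit_lift y) = pd I R (unit_lift y)"
    "pd None (pdbar I R) (unit_lift y) = pdbar I R (unit_lift y)" for I
    using euler_metric[OF y] by simp_all
  moreover have "pd None R (unit_lift y) = R (unit_lift y)"
    using euler(1)[OF smooth_R weight_r y] by simp
  ultimately have eq: "(\<chi> K J. case (K, J) of
            (None, None) \<Rightarrow> ?Q y
          | (None, Some j) \<Rightarrow> pd j ?Q y
          | (Some k, None) \<Rightarrow> pdbar k ?Q y
          | (Some k, Some j) \<Rightarrow> pd j (pdbar k ?Q) y)
      = (\<chi> K. (- 1) *s transpose (ambient_metric r (unit_lift y)) $ K)"
    by (auto simp: vec_eq_iff transpose_def metric_nth split: option.split)
  have "monge_ampere (\<lambda>y. r (unit_lift y)) y = 0"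
    unfolding monge_ampere_def Let_def eq det_rows_mul vec_lambda_eta
    using \<open>det (transpose (ambient_metric r (unit_lift y))) = 0\<close> by simp
  then show False using ma by simp
qed

end

locale nondegenerate_ambient_space = ambient_space D r
  for D :: "(complex^('m::finite option)) set" and r +
  assumes nondegenerate: "Z \<in> D \<Longrightarrow> det (ambient_metric r Z) \<noteq> 0"
begin

abbreviation ginv where "ginv Z \<equiv> matrix_inv (transpose (ambient_metric r Z))"
abbreviation Lap where "Lap \<equiv> ambient_laplacian r"

lemma ginv_metric:
  assumes "Z \<in> D"
  shows "(\<Sum>J\<in>UNIV. ginv Z $ I $ J * ambient_metric r Z $ K $ J) = (if I = K then 1 else 0)"
    and "(\<Sum>I\<in>UNIV. ginv Z $ I $ J * ambient_metric r Z $ I $ K) = (if J = K then 1 else 0)"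
proof -
  have d: "det (transpose (ambient_metric r Z)) \<noteq> 0" using nondegenerate[OF assms] by simp
  have "(ginv Z ** transpose (ambient_metric r Z)) $ I $ K = mat 1 $ I $ K"
    by (simp add: matrix_inv_nonsingular[OF d])
  then show "(\<Sum>J\<in>UNIV. ginv Z $ I $ J * ambient_metric r Z $ K $ J) = (if I = K then 1 else 0)"
    by (simp add: matrix_matrix_mult_def transpose_def mat_def)
  have "(transpose (ambient_metric r Z) ** ginv Z) $ K $ J = mat 1 $ K $ J"
    by (simp add: matrix_inv_nonsingular[OF d])
  then show "(\<Sum>I\<in>UNIV. ginv Z $ I $ J * ambient_metric r Z $ I $ K) = (if J = K then 1 else 0)"
    by (simp add: matrix_matrix_mult_def transpose_def mat_def mult.commute eq_commute)
qed

lemma smooth_mixed: "smooth_on D f \<Longrightarrow> smooth_on D (pd I (pdbar J f))"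
  unfolding pd_eq_wirtinger pdbar_eq_wirtinger by (intro smooth_on_wirtinger open_D)

lemma smooth_ginv: "smooth_on D (\<lambda>Z. ginv Z $ I $ J)"
proof (rule smooth_on_matrix_inv[OF open_D])
  show "smooth_on D (\<lambda>Z. transpose (ambient_metric r Z) $ i $ j)" for i j
    by (simp add: transpose_def metric_nth smooth_on_minus open_D smooth_mixed smooth_R)
qed (simp add: nondegenerate)

lemma smooth_Lap: "smooth_on D f \<Longrightarrow> smooth_on D (Lap f)"
  unfolding ambient_laplacian_def[abs_def]
  by (intro smooth_on_minus smooth_on_sum smooth_on_mult open_D smooth_ginv smooth_mixed)

lemma smooth_Lap_power: "smooth_on D f \<Longrightarrow> smooth_on D ((Lap ^^ k) f)"
  by (induction k) (auto intro: smooth_Lap)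

lemma mixed_cong:
  assumes "Z \<in> D" "\<And>Y. Y \<in> D \<Longrightarrow> f Y = g Y"
  shows "pd I (pdbar J f) Z = pd I (pdbar J g) Z"
  unfolding pd_eq_wirtinger pdbar_eq_wirtinger
  by (intro wirtinger_cong[OF open_D assms(1)] wirtinger_cong[OF open_D] assms(2))

lemma Lap_cong:
  assumes "Z \<in> D" "\<And>Y. Y \<in> D \<Longrightarrow> f Y = g Y"
  shows "Lap f Z = Lap g Z"
  unfolding ambient_laplacian_def using mixed_cong[OF assms] by simp

lemma Lap_power_cong:
  assumes "Z \<in> D" "\<And>Y. Y \<in> D \<Longrightarrow> f Y = g Y"
  shows "(Lap ^^ k) f Z = (Lap ^^ k) g Z"
  using assms(1)
proof (induction k arbitrary: Z)
  case (Suc k)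
  then show ?case using Lap_cong[OF Suc.prems Suc.IH] by simp
qed (simp add: assms(2))

lemma mixed_add:
  assumes "smooth_on D f" "smooth_on D g" "Z \<in> D"
  shows "pd I (pdbar J (\<lambda>Y. f Y + g Y)) Z = pd I (pdbar J f) Z + pd I (pdbar J g) Z"
proof -
  have "wirtinger (-\<i>) I (wirtinger \<i> J (\<lambda>Y. f Y + g Y)) Z
      = wirtinger (-\<i>) I (\<lambda>Y. wirtinger \<i> J f Y + wirtinger \<i> J g Y) Z"
    by (rule wirtinger_cong[OF open_D assms(3)])
      (use assms in \<open>auto intro: wirtinger_add smooth_on_differentiable\<close>)
  also have "\<dots> = wirtinger (-\<i>) I (wirtinger \<i> J f) Z + wirtinger (-\<i>) I (wirtinger \<i> J g) Z"
    by (intro wirtinger_add smooth_on_differentiable[OF smooth_on_wirtinger[OF open_D]] assms)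
  finally show ?thesis by (simp add: pd_eq_wirtinger pdbar_eq_wirtinger)
qed

lemma mixed_mult:
  assumes "smooth_on D f" "smooth_on D g" "Z \<in> D"
  shows "pd I (pdbar J (\<lambda>Y. f Y * g Y)) Z = pd I (pdbar J f) Z * g Z + pdbar J f Z * pd I g Z
    + pd I f Z * pdbar J g Z + f Z * pd I (pdbar J g) Z"
proof -
  note d = smooth_on_differentiable[OF _ assms(3)]
  note sw = smooth_on_wirtinger[OF open_D]
  have "wirtinger (-\<i>) I (wirtinger \<i> J (\<lambda>Y. f Y * g Y)) Z
      = wirtinger (-\<i>) I (\<lambda>Y. wirtinger \<i> J f Y * g Y + f Y * wirtinger \<i> J g Y) Z"
    by (rule wirtinger_cong[OF open_D assms(3)])
      (use assms in \<open>auto intro: wirtinger_mult smooth_on_differentiable\<close>)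
  also have "\<dots> = wirtinger (-\<i>) I (\<lambda>Y. wirtinger \<i> J f Y * g Y) Z + wirtinger (-\<i>) I (\<lambda>Y. f Y * wirtinger \<i> J g Y) Z"
    by (intro wirtinger_add d smooth_on_mult open_D sw assms)
  also have "wirtinger (-\<i>) I (\<lambda>Y. wirtinger \<i> J f Y * g Y) Z
      = wirtinger (-\<i>) I (wirtinger \<i> J f) Z * g Z + wirtinger \<i> J f Z * wirtinger (-\<i>) I g Z"
    by (intro wirtinger_mult d sw assms)
  also have "wirtinger (-\<i>) I (\<lambda>Y. f Y * wirtinger \<i> J g Y) Z
      = wirtinger (-\<i>) I f Z * wirtinger \<i> J g Z + f Z * wirtinger (-\<i>) I (wirtinger \<i> J g) Z"
    by (intro wirtinger_mult d sw assms)
  finally show ?thesis by (simp add: pd_eq_wirtinger pdbar_eq_wirtinger algebra_simps)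
qed

lemma Lap_add:
  assumes "smooth_on D f" "smooth_on D g" "Z \<in> D"
  shows "Lap (\<lambda>Y. f Y + g Y) Z = Lap f Z + Lap g Z"
  unfolding ambient_laplacian_def mixed_add[OF assms]
  by (simp add: sum.distrib algebra_simps)

lemma Lap_power_add:
  assumes "smooth_on D f" "smooth_on D g" "Z \<in> D"
  shows "(Lap ^^ k) (\<lambda>Y. f Y + g Y) Z = (Lap ^^ k) f Z + (Lap ^^ k) g Z"
  using assms(3)
proof (induction k arbitrary: Z)
  case (Suc k)
  have "(Lap ^^ Suc k) (\<lambda>Y. f Y + g Y) Z = Lap (\<lambda>Z. (Lap ^^ k) f Z + (Lap ^^ k) g Z) Z"
    using Lap_cong[OF Suc.prems Suc.IH] by simp
  then show ?case using Lap_add[OF smooth_Lap_power[OF assms(1)] smooth_Lap_power[OF assms(2)] Suc.prems]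
    by simp
qed simp

lemma Lap_cmult:
  assumes "smooth_on D f" "Z \<in> D"
  shows "Lap (\<lambda>Y. c * f Y) Z = c * Lap f Z"
  unfolding ambient_laplacian_def mixed_mult[OF smooth_on_const assms]
  by (simp add: pd_eq_wirtinger pdbar_eq_wirtinger sum_distrib_left algebra_simps)

section \<open>Order of vanishing and weight under the Laplacian\<close>

lemma vanishes_to_order_Lap:
  assumes Z: "Z \<in> D" and f: "smooth_on D f" "vanishes_to_order (k + 2) f Z"
  shows "vanishes_to_order k (Lap f) Z"
proof -
  have m: "vanishes_to_order k (pd I (pdbar J f)) Z" for I J
    unfolding pd_eq_wirtinger pdbar_eq_wirtinger
    by (intro vanishes_to_order_wirtinger[OF open_D Z] smooth_on_wirtinger open_D) (use f in auto)
  have "vanishes_to_order k (\<lambda>Z. \<Sum>I\<in>UNIV. \<Sum>J\<in>UNIV. pd I (pdbar J f) Z * (- ginv Z $ I $ J)) Z"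
    by (intro vanishes_to_order_sum[OF open_D Z] vanishes_to_order_mult[OF open_D Z] smooth_on_sum
        smooth_on_mult smooth_on_minus open_D smooth_mixed smooth_ginv f m)
  moreover have "Lap f = (\<lambda>Z. \<Sum>I\<in>UNIV. \<Sum>J\<in>UNIV. pd I (pdbar J f) Z * (- ginv Z $ I $ J))"
    by (auto simp: ambient_laplacian_def sum_negf mult.commute)
  ultimately show ?thesis by simp
qed

text \<open>Each Laplacian costs two orders, and one order must be left at the end for the value
  itself; hence \<open>Suc (2 * k)\<close>.\<close>

lemma Lap_power_vanishes:
  assumes Z: "Z \<in> D" and f: "smooth_on D f" "vanishes_to_order (Suc (2 * k)) f Z"
  shows "(Lap ^^ k) f Z = 0"
proof -
  have "j \<le> k \<Longrightarrow> vanishes_to_order (Suc (2 * (k - j))) ((Lap ^^ j) f) Z" for j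
  proof (induction j)
    case (Suc j)
    have "Suc (2 * (k - j)) = Suc (2 * (k - Suc j)) + 2" using Suc.prems by simp
    then show ?case
      using Suc vanishes_to_order_Lap[OF Z smooth_Lap_power[OF f(1)], of "Suc (2 * (k - Suc j))" j] by simp
  qed (use f in simp)
  from this[of k] show ?thesis by (simp add: vanishes_to_order_Suc)
qed

text \<open>The fibre factors of the inverse metric cancel those of the second derivatives; what
  remains is division by \<open>exp (2 * Re s)\<close>, that is, one weight less.\<close>

lemma has_weight_Lap:
  assumes f: "smooth_on D f" "has_weight w f"
  shows "has_weight (w - 1) (Lap f)"
  unfolding has_weight_def
proof (intro ballI allI)
  fix Z s assume Z: "Z \<in> D"
  let ?f = "fibre_factor (exp s) :: 'm option \<Rightarrow> complex"
  have e: "of_real (exp (2 * w * Re s)) / of_real (exp (2 * Re s)) = complex_of_real (exp (2 * (w - 1) * Re s))"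
    unfolding of_real_divide[symmetric] exp_diff[symmetric] by (simp add: algebra_simps)
  have "ginv (fibre_scale (exp s) Z) $ I $ J * pd I (pdbar J f) (fibre_scale (exp s) Z)
      = of_real (exp (2 * (w - 1) * Re s)) * (ginv Z $ I $ J * pd I (pdbar J f) Z)" for I J
  proof -
    have "ginv (fibre_scale (exp s) Z) $ I $ J * pd I (pdbar J f) (fibre_scale (exp s) Z)
      = ginv Z $ I $ J / of_real (exp (2 * Re s)) * (?f I * cnj (?f J) * pd I (pdbar J f) (fibre_scale (exp s) Z))"
      unfolding inverse_metric_scaling(2)[OF Z nondegenerate[OF Z]] by simp
    also have "\<dots> = of_real (exp (2 * w * Re s)) / of_real (exp (2 * Re s)) * (ginv Z $ I $ J * pd I (pdbar J f) Z)"
      unfolding mixed_derivative_scaling[OF f Z] by simp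
    finally show ?thesis unfolding e .
  qed
  then show "Lap f (fibre_scale (exp s) Z) = of_real (exp (2 * (w - 1) * Re s)) * Lap f Z"
    unfolding ambient_laplacian_def by (simp add: sum_distrib_left)
qed

lemma has_weight_Lap_power:
  assumes "smooth_on D f" "has_weight w f"
  shows "has_weight (w - real k) ((Lap ^^ k) f)"
proof (induction k)
  case (Suc k)
  from has_weight_Lap[OF smooth_Lap_power[OF assms(1)] this] show ?case by (simp add: algebra_simps)
qed (use assms in simp)

text \<open>Raising the index of the differential of \<open>r\<close> produces minus the Euler
  field, which has only a fibre component. This is \<open>euler_metric\<close> multiplied by the
  inverse metric.\<close>

lemma ginv_derivative:
  assumes Z: "Z \<in> D"
  shows "(\<Sum>J\<in>UNIV. ginv Z $ I $ J * pdbar J R Z) = (if I = None then - Z $ None else 0)"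
    and "(\<Sum>I\<in>UNIV. ginv Z $ I $ J * pd I R Z) = (if J = None then - cnj (Z $ None) else 0)"
proof -
  have "pdbar J R Z = - Z $ None * ambient_metric r Z $ None $ J" for J
    using euler_metric(2)[OF Z, of J] by (simp add: metric_nth)
  then have "(\<Sum>J\<in>UNIV. ginv Z $ I $ J * pdbar J R Z)
      = - Z $ None * (\<Sum>J\<in>UNIV. ginv Z $ I $ J * ambient_metric r Z $ None $ J)"
    unfolding sum_distrib_left by (simp add: algebra_simps)
  then show "(\<Sum>J\<in>UNIV. ginv Z $ I $ J * pdbar J R Z) = (if I = None then - Z $ None else 0)"
    by (simp add: ginv_metric(1)[OF Z])
  have "pd I R Z = - cnj (Z $ None) * ambient_metric r Z $ I $ None" for I
    using euler_metric(1)[OF Z, of I] by (simp add: metric_nth)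
  then have "(\<Sum>I\<in>UNIV. ginv Z $ I $ J * pd I R Z)
      = - cnj (Z $ None) * (\<Sum>I\<in>UNIV. ginv Z $ I $ J * ambient_metric r Z $ I $ None)"
    unfolding sum_distrib_left by (simp add: algebra_simps)
  then show "(\<Sum>I\<in>UNIV. ginv Z $ I $ J * pd I R Z) = (if J = None then - cnj (Z $ None) else 0)"
    by (simp add: ginv_metric(2)[OF Z])
qed

text \<open>The trace of the metric against its inverse contributes n + 2. Each of the two cross
  terms of the product rule contributes \<open>w\<close>: the gradient of \<open>r\<close> is minus
  the Euler field, on which Euler's equation evaluates the derivative of \<phi>.\<close>

lemma Lap_mult_R:
  assumes \<phi>: "smooth_on D \<phi>" "has_weight w \<phi>" and Z: "Z \<in> D"
  shows "Lap (\<lambda>Y. R Y * \<phi> Y) Z = R Z * Lap \<phi> Z + (of_nat CARD('m option) + 2 * of_real w) * \<phi> Z"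
proof -
  have 1: "(\<Sum>I\<in>UNIV. \<Sum>J\<in>UNIV. ginv Z $ I $ J * pd I (pdbar J R) Z) = - of_nat CARD('m option)"
  proof -
    have "(\<Sum>I\<in>UNIV. \<Sum>J\<in>UNIV. ginv Z $ I $ J * pd I (pdbar J R) Z)
        = - (\<Sum>I\<in>UNIV. \<Sum>J\<in>UNIV. ginv Z $ I $ J * ambient_metric r Z $ I $ J)"
      by (simp add: metric_nth sum_negf)
    then show ?thesis by (simp add: ginv_metric(1)[OF Z])
  qed
  have 2: "(\<Sum>I\<in>UNIV. \<Sum>J\<in>UNIV. ginv Z $ I $ J * (pdbar J R Z * pd I \<phi> Z)) = - (of_real w * \<phi> Z)"
  proof -
    have "(\<Sum>I\<in>UNIV. \<Sum>J\<in>UNIV. ginv Z $ I $ J * (pdbar J R Z * pd I \<phi> Z))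
        = (\<Sum>I\<in>UNIV. (\<Sum>J\<in>UNIV. ginv Z $ I $ J * pdbar J R Z) * pd I \<phi> Z)"
      by (simp add: sum_distrib_right mult.assoc)
    also have "\<dots> = (\<Sum>I\<in>(UNIV :: 'm option set). if I = None then - Z $ None * pd None \<phi> Z else 0)"
      unfolding ginv_derivative(1)[OF Z] by (rule sum.cong[OF refl]) auto
    finally show ?thesis using euler(1)[OF \<phi> Z] by simp
  qed
  have 3: "(\<Sum>I\<in>UNIV. \<Sum>J\<in>UNIV. ginv Z $ I $ J * (pd I R Z * pdbar J \<phi> Z)) = - (of_real w * \<phi> Z)"
  proof -
    have "(\<Sum>I\<in>UNIV. \<Sum>J\<in>UNIV. ginv Z $ I $ J * (pd I R Z * pdbar J \<phi> Z))
        = (\<Sum>J\<in>UNIV. (\<Sum>I\<in>UNIV. ginv Z $ I $ J * pd I R Z) * pdbar J \<phi> Z)"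
      by (subst sum.swap) (simp add: sum_distrib_right mult.assoc)
    also have "\<dots> = (\<Sum>J\<in>(UNIV :: 'm option set). if J = None then - cnj (Z $ None) * pdbar None \<phi> Z else 0)"
      unfolding ginv_derivative(2)[OF Z] by (rule sum.cong[OF refl]) auto
    finally show ?thesis using euler(2)[OF \<phi> Z] by simp
  qed
  have "Lap (\<lambda>Y. R Y * \<phi> Y) Z = - ((\<Sum>I\<in>UNIV. \<Sum>J\<in>UNIV. ginv Z $ I $ J * pd I (pdbar J R) Z) * \<phi> Z
      + (\<Sum>I\<in>UNIV. \<Sum>J\<in>UNIV. ginv Z $ I $ J * (pdbar J R Z * pd I \<phi> Z))
      + (\<Sum>I\<in>UNIV. \<Sum>J\<in>UNIV. ginv Z $ I $ J * (pd I R Z * pdbar J \<phi> Z))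
      + R Z * (\<Sum>I\<in>UNIV. \<Sum>J\<in>UNIV. ginv Z $ I $ J * pd I (pdbar J \<phi>) Z))"
    unfolding ambient_laplacian_def mixed_mult[OF smooth_R \<phi>(1) Z]
    by (simp add: sum_distrib_left sum_distrib_right sum.distrib[symmetric] algebra_simps)
  then show ?thesis unfolding 1 2 3 by (simp add: ambient_laplacian_def algebra_simps)
qed

text \<open>Every Laplacian lowers the weight by one, so the successive commutators with
  \<open>r\<close> form an arithmetic progression with step -2; the coefficient is the sum of its
  first k + 1 terms.\<close>

lemma Lap_power_mult_R:
  assumes \<phi>: "smooth_on D \<phi>" "has_weight w \<phi>" and Z: "Z \<in> D"
  shows "(Lap ^^ Suc k) (\<lambda>Y. R Y * \<phi> Y) Z = R Z * (Lap ^^ Suc k) \<phi> Z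
    + of_nat (Suc k) * (of_nat CARD('m option) + 2 * of_real w - of_nat k) * (Lap ^^ k) \<phi> Z"
  using Z
proof (induction k arbitrary: Z)
  case 0
  then show ?case using Lap_mult_R[OF \<phi>] by simp
next
  case (Suc k)
  let ?c = "\<lambda>k. of_nat (Suc k) * (of_nat CARD('m option) + 2 * of_real w - of_nat k) :: complex"
  let ?L = "\<lambda>k. (Lap ^^ k) \<phi>"
  note sL = smooth_Lap_power[OF \<phi>(1)]
  have "(Lap ^^ Suc (Suc k)) (\<lambda>Y. R Y * \<phi> Y) Z = Lap (\<lambda>Z. R Z * ?L (Suc k) Z + ?c k * ?L k Z) Z"
    using Lap_cong[OF Suc.prems Suc.IH] by simp
  also have "\<dots> = Lap (\<lambda>Z. R Z * ?L (Suc k) Z) Z + Lap (\<lambda>Z. ?c k * ?L k Z) Z"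
    by (rule Lap_add[OF smooth_on_mult[OF open_D smooth_R sL] smooth_on_mult[OF open_D smooth_on_const sL] Suc.prems])
  also have "Lap (\<lambda>Z. ?c k * ?L k Z) Z = ?c k * Lap (?L k) Z"
    by (rule Lap_cmult[OF sL Suc.prems])
  also have "Lap (\<lambda>Z. R Z * ?L (Suc k) Z) Z = R Z * Lap (?L (Suc k)) Z
      + (of_nat CARD('m option) + 2 * of_real (w - real (Suc k))) * ?L (Suc k) Z"
    by (rule Lap_mult_R[OF sL has_weight_Lap_power[OF \<phi>] Suc.prems])
  finally show ?case by (simp add: algebra_simps)
qed

text \<open>The coefficient in \<open>Lap_power_mult_R\<close> vanishes for \<open>w = - 1\<close> and \<open>Suc k = n + 1\<close>.\<close>

proposition Lap_power_zero:
  assumes \<phi>: "smooth_on D \<phi>" "has_weight (- 1) \<phi>" and Z: "Z \<in> D" "r Z = 0"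
  shows "(Lap ^^ CARD('m)) (\<lambda>Y. R Y * \<phi> Y) Z = 0"
proof -
  obtain k where k: "CARD('m) = Suc k" using not0_implies_Suc by fastforce
  show ?thesis using Lap_power_mult_R[OF \<phi> Z(1), of k] Z(2) by (simp add: k)
qed

text \<open>This is the independence of the critical GJMS operator of the chosen extension.\<close>

proposition Lap_power_weight_zero:
  assumes D: "D = fibred_over U" and U: "open U" and a: "smooth_on U a"
    and e: "\<And>y. y \<in> U \<Longrightarrow> dir_deriv e a y \<noteq> 0"
    and h: "smooth_on D h" "has_weight 1 (\<lambda>Z. complex_of_real (h Z))" "\<And>Z. Z \<in> D \<Longrightarrow> h Z \<noteq> 0"
    and r: "\<And>Z. Z \<in> D \<Longrightarrow> r Z = h Z * a (base Z)"
    and Q: "smooth_on U Q" "\<And>y. y \<in> U \<Longrightarrow> a y = 0 \<Longrightarrow> Q y = 0"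
    and Z: "Z \<in> D" "a (base Z) = 0"
  shows "(Lap ^^ CARD('m)) (\<lambda>Y. Q (base Y)) Z = 0"
proof -
  have bD: "base Y \<in> U" if "Y \<in> D" for Y using that by (simp add: D fibred_over_def)
  obtain \<phi> where \<phi>: "smooth_on U \<phi>"
    and van: "vanishes_to_order (Suc (2 * CARD('m))) (\<lambda>y. Q y - complex_of_real (a y) * \<phi> y) (base Z)"
    using division_up_to_order[OF U a Q(1) e Q(2), of "Suc (2 * CARD('m))"] bD[OF Z(1)] Z(2) by blast
  define S where "S y = Q y - complex_of_real (a y) * \<phi> y" for y
  have S: "smooth_on U S"
    unfolding S_def[abs_def] by (intro smooth_on_diff smooth_on_mult smooth_on_of_real U Q \<phi> a)
  \<comment> \<open>Division by \<open>h\<close> trades the defining function for \<open>r\<close>: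
    over \<open>U\<close> the product of \<open>a\<close> and \<phi> equals \<open>r\<close> times
    \<psi>. Since \<phi> has weight 0 and \<open>h\<close> weight 1, \<psi> has the critical weight
    -1.\<close>
  define \<psi> where "\<psi> Y = \<phi> (base Y) / complex_of_real (h Y)" for Y
  have \<psi>: "smooth_on D \<psi>"
    unfolding \<psi>_def[abs_def]
    by (intro smooth_on_divide smooth_on_base[OF _ \<phi>] smooth_on_of_real open_D h(1) bD) (use h(3) in auto)
  have w\<psi>: "has_weight (- 1) \<psi>"
    using h(2) by (auto simp: has_weight_def \<psi>_def exp_minus field_simps)
  have SD: "smooth_on D (\<lambda>Y. S (base Y))" by (rule smooth_on_base[OF open_D S bD])
  have "(Lap ^^ CARD('m)) (\<lambda>Y. Q (base Y)) Z = (Lap ^^ CARD('m)) (\<lambda>Y. S (base Y) + R Y * \<psi> Y) Z"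
    by (rule Lap_power_cong[OF Z(1)]) (use h(3) in \<open>auto simp: S_def \<psi>_def r\<close>)
  also have "\<dots> = (Lap ^^ CARD('m)) (\<lambda>Y. S (base Y)) Z + (Lap ^^ CARD('m)) (\<lambda>Y. R Y * \<psi> Y) Z"
    by (intro Lap_power_add SD smooth_on_mult open_D smooth_R \<psi> Z)
  also have "(Lap ^^ CARD('m)) (\<lambda>Y. R Y * \<psi> Y) Z = 0"
    by (rule Lap_power_zero[OF \<psi> w\<psi> Z(1)]) (simp add: r Z)
  also have "(Lap ^^ CARD('m)) (\<lambda>Y. S (base Y)) Z = 0"
    by (intro Lap_power_vanishes[OF Z(1) SD] vanishes_to_order_base[OF open_D Z(1) S bD])
      (use van in \<open>simp_all add: S_def[abs_def]\<close>)
  finally show ?thesis by simp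
qed

end

section \<open>Charts and hypersurfaces\<close>

lemma cimg_iff:
  assumes "is_chart c"
  shows "y \<in> cimg c S \<longleftrightarrow> y \<in> snd c ` fst c \<and> pt c y \<in> S"
  using assms unfolding is_chart_def homeomorphism_def cimg_def by force

lemma open_cimg:
  assumes c: "is_chart c" and S: "open S"
  shows "open (cimg c S)"
proof -
  have "openin (top_of_set (snd c ` fst c)) (snd c ` (fst c \<inter> S))"
    using c S unfolding is_chart_def by (intro homeomorphism_imp_open_map[of "fst c" _ _ "pt c"]) auto
  then show ?thesis
    using c unfolding is_chart_def cimg_def by (metis openin_open_eq)
qed

lemma charts_is_chart: "c \<in> charts A \<Longrightarrow> is_chart c"
  by (simp add: charts_def)

lemma over_eq_fibred_over: "over c S = fibred_over (cimg c S)"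
  by (simp add: over_def fibred_over_def)

lemma smooth_fun_chart:
  "smooth_fun A W F \<Longrightarrow> c \<in> charts A \<Longrightarrow> smooth_on (cimg c W) (\<lambda>y. F (pt c y))"
  by (simp add: smooth_fun_def o_def)

lemma cut_out_chart:
  assumes "cut_out A M W \<rho>" and c: "c \<in> charts A"
  shows "open (cimg c W)" "smooth_on (cimg c W) (\<lambda>y. \<rho> (pt c y))" "cimg c M \<subseteq> cimg c W"
    "y \<in> cimg c W \<Longrightarrow> y \<in> cimg c M \<longleftrightarrow> \<rho> (pt c y) = 0"
    "y \<in> cimg c M \<Longrightarrow> \<exists>v. dir_deriv v (\<lambda>y. \<rho> (pt c y)) y \<noteq> 0"
  using assms charts_is_chart[OF c] smooth_fun_chart[of A W \<rho> c]
  by (auto simp: cut_out_def open_cimg cimg_iff dir_deriv_def o_def)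

text \<open>On \<open>M\<close>, the differential of a function that vanishes on \<open>M\<close>
  annihilates the kernel of d\<rho>, so kernel vectors satisfy the definition of tangency, which
  does not mention \<rho>.\<close>

lemma kernel_subset_tangent_space:
  fixes A :: "('x::topological_space, 'm::finite) chart set"
  assumes \<rho>: "cut_out A M W \<rho>" and c: "c \<in> charts A" and y: "y \<in> cimg c M"
    and v: "dir_deriv v (\<lambda>y. \<rho> (pt c y)) y = 0"
  shows "v \<in> tangent_space M c y"
  unfolding tangent_space_def
proof (intro CollectI allI impI, elim conjE)
  fix V and u :: "complex^'m \<Rightarrow> real"
  assume V: "open V" "y \<in> V" and u: "smooth_on V u" and u0: "\<forall>y\<in>V \<inter> cimg c M. u y = 0"
  note C = cut_out_chart[OF \<rho> c]
  obtain e where e: "dir_deriv e (\<lambda>y. \<rho> (pt c y)) y \<noteq> 0" using C(5)[OF y] by blast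
  have sm: "smooth_on (V \<inter> cimg c W) (\<lambda>y. \<rho> (pt c y))" by (rule smooth_on_subset[OF C(2)]) simp
  have y': "y \<in> V \<inter> cimg c W" "\<rho> (pt c y) = 0" using C(3,4) V y by auto
  have "dir_deriv v u y = 0"
    by (rule derivative_zero_on_kernel[OF _ y'(1) smooth_on_continuous[OF sm]
          dir_deriv_has_derivative[OF smooth_on_differentiable[OF sm y'(1)]]
          dir_deriv_has_derivative[OF smooth_on_differentiable[OF u V(2)]] y'(2) _ e v])
      (use C(1,4) V u0 in auto)
  then show "frechet_derivative u (at y) v = 0" by (simp add: dir_deriv_def)
qed

text \<open>With a = \<partial>\<rho>(v), the normalization says \<theta>(v) = (\<i>/2)(a - cnj a) =
  - Im a, while the derivative of \<rho> along \<open>\<i> *s v\<close> is - 2 Im a.\<close>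

lemma normalized_by_dir_deriv:
  assumes \<rho>: "cut_out A M W \<rho>" and n: "normalized_by A M \<theta> \<rho>" and c: "c \<in> charts A"
    and y: "y \<in> cimg c M" and v: "v \<in> tangent_space M c y"
  shows "\<theta> c y v = dir_deriv (\<i> *s v) (\<lambda>y. \<rho> (pt c y)) y / 2"
proof -
  let ?R = "\<lambda>y. complex_of_real (\<rho> (pt c y))"
  have d: "(\<lambda>y. \<rho> (pt c y)) differentiable (at y)"
    using cut_out_chart[OF \<rho> c] y by (blast intro: smooth_on_differentiable)
  define a where "a = (\<Sum>j\<in>UNIV. pd j ?R y * v $ j)"
  have a: "(\<Sum>j\<in>UNIV. pdbar j ?R y * cnj (v $ j)) = cnj a"
    by (simp add: a_def pdbar_of_real[OF d])
  have "complex_of_real (\<theta> c y v) = \<i> / 2 * (a - (\<Sum>j\<in>UNIV. pdbar j ?R y * cnj (v $ j)))"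
    using n c y v unfolding normalized_by_def a_def by blast
  also have "\<dots> = complex_of_real (- Im a)" unfolding a by (simp add: complex_eq_iff)
  finally have "\<theta> c y v = - Im a" using of_real_eq_iff by blast
  then show ?thesis unfolding dir_deriv_i_scale[OF d] a_def by simp
qed

text \<open>One linear equation in at least two unknowns: either a coordinate vector solves it, or
  two coefficients are exchanged with one sign changed.\<close>

lemma exists_kernel_vector:
  fixes p :: "'m::finite \<Rightarrow> complex"
  assumes "CARD('m) \<ge> 2"
  obtains Z :: "complex^'m" where "Z \<noteq> 0" "(\<Sum>j\<in>UNIV. p j * Z $ j) = 0"
proof -
  obtain j k :: 'm where jk: "j \<noteq> k"
    using assms card_le_Suc0_iff_eq[of "UNIV :: 'm set"] by force
  have ax: "(\<Sum>i\<in>UNIV. p i * axis j a $ i) = p j * a" for j a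
  proof -
    have "(\<Sum>i\<in>UNIV. p i * axis j a $ i) = (\<Sum>i\<in>UNIV. if i = j then p j * a else 0)"
      by (rule sum.cong) (auto simp: axis_def)
    then show ?thesis by simp
  qed
  show ?thesis
  proof (cases "p k = 0")
    case True
    show ?thesis by (rule that[of "axis k 1"]) (use True in \<open>auto simp: ax axis_eq_0_iff\<close>)
  next
    case False
    have "(axis j (p k) - axis k (p j)) $ j = p k" using jk by (simp add: axis_def)
    then have "axis j (p k) - axis k (p j) \<noteq> 0" using False by (metis zero_index)
    then show ?thesis
      by (rule that) (simp add: algebra_simps sum_subtractf ax)
  qed
qed

text \<open>Here the dimension enters: \<partial>\<rho> annihilates some
  \<open>Z \<noteq> 0\<close>. Then \<open>Z\<close> and \<open>\<i> *s Z\<close> are both in the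
  kernel of d\<rho>, so \<open>Z\<close> lies in \<open>T10\<close>, where the Levi form is
  definite.\<close>

lemma levi_nonzero:
  fixes A :: "('x::topological_space, 'm::finite) chart set"
  assumes card: "CARD('m) \<ge> 2" and \<rho>: "defining_function A M W \<rho>" and c: "c \<in> charts A" and y: "y \<in> cimg c M"
  shows "\<exists>Z. (\<Sum>j\<in>UNIV. pd j (\<lambda>y. complex_of_real (\<rho> (pt c y))) y * Z $ j) = 0 \<and>
    (\<Sum>j\<in>UNIV. \<Sum>k\<in>UNIV. pd j (pdbar k (\<lambda>y. complex_of_real (\<rho> (pt c y)))) y * Z $ j * cnj (Z $ k)) \<noteq> 0"
proof -
  have co: "cut_out A M W \<rho>" and lp: "levi_positive A M \<rho>" using \<rho> by (auto simp: defining_function_def)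
  have d: "(\<lambda>y. \<rho> (pt c y)) differentiable (at y)"
    using cut_out_chart[OF co c] y by (blast intro: smooth_on_differentiable)
  obtain Z :: "complex^'m" where Z: "Z \<noteq> 0" "(\<Sum>j\<in>UNIV. pd j (\<lambda>y. complex_of_real (\<rho> (pt c y))) y * Z $ j) = 0"
    using exists_kernel_vector[OF card, where p = "\<lambda>j. pd j (\<lambda>y. complex_of_real (\<rho> (pt c y))) y"] .
  have "dir_deriv Z (\<lambda>y. \<rho> (pt c y)) y = 0" "dir_deriv (\<i> *s Z) (\<lambda>y. \<rho> (pt c y)) y = 0"
    by (simp only: dir_deriv_real_eq_pd[OF d, of Z] Z(2), simp) (simp only: dir_deriv_i_scale[OF d] Z(2), simp)
  then have "Z \<in> T10 M c y"
    unfolding T10_def by (auto intro!: kernel_subset_tangent_space[OF co c y])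
  then have pos: "0 < Re (- (\<Sum>j\<in>UNIV. \<Sum>k\<in>UNIV.
      pd j (pdbar k (\<lambda>y. complex_of_real (\<rho> (pt c y)))) y * Z $ j * cnj (Z $ k)))" (is "0 < Re (- ?s)")
    using lp c y Z(1) unfolding levi_positive_def by blast
  have "?s \<noteq> 0"
  proof
    assume "?s = 0"
    from pos[unfolded this] show False by simp
  qed
  then show ?thesis using Z(2) by blast
qed

text \<open>The vector \<open>\<i> *s e\<close> is projected along \<open>e\<close> to the kernel of
  d\<rho>. Multiplication by \<i> sends \<open>\<i> *s e\<close> to \<open>- e\<close>, so the
  derivative along \<open>\<i> *s v\<close> is - (1 + t^2) times the one along \<open>e\<close>. A
  normalized contact form is nonzero on such a \<open>v\<close>.\<close>

lemma exists_contact_transversal: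
  fixes \<rho> :: "complex^'m::finite \<Rightarrow> real"
  assumes d: "\<rho> differentiable (at y)" and e: "dir_deriv e \<rho> y \<noteq> 0"
  obtains v where "dir_deriv v \<rho> y = 0" "dir_deriv (\<i> *s v) \<rho> y \<noteq> 0"
proof -
  define t where "t = dir_deriv (\<i> *s e) \<rho> y / dir_deriv e \<rho> y"
  define v where "v = \<i> *s e - t *\<^sub>R e"
  have iv: "\<i> *s v = - e - t *\<^sub>R (\<i> *s e)"
    by (simp add: v_def vec_eq_iff algebra_simps scaleR_conv_of_real)
  have "dir_deriv (\<i> *s e) \<rho> y = t * dir_deriv e \<rho> y" using e by (simp add: t_def)
  then have "dir_deriv (\<i> *s v) \<rho> y = - dir_deriv e \<rho> y * (1 + t\<^sup>2)"
    unfolding iv by (simp add: dir_deriv_linear_arg[OF d] algebra_simps power2_eq_square)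
  moreover have "1 + t\<^sup>2 \<noteq> 0" by (smt (verit) zero_le_power2)
  moreover have "dir_deriv v \<rho> y = 0"
    using e by (simp add: v_def dir_deriv_linear_arg[OF d] t_def)
  ultimately show ?thesis using that e by simp
qed

lemma density_weight:
  assumes f: "ambient_density A 1 W f" and c: "c \<in> charts A" and U: "U \<subseteq> cimg c W" "open U"
  shows "smooth_on (fibred_over U) (f c)"
    and "fibred_domain.has_weight (fibred_over U) 1 (\<lambda>Z. complex_of_real (f c Z))"
    and "Z \<in> fibred_over U \<Longrightarrow> \<mu> \<noteq> 0 \<Longrightarrow> f c (fibre_scale \<mu> Z) = (norm \<mu>)\<^sup>2 * f c Z"
proof -
  interpret fibred_domain "fibred_over U" by (rule fibred_domain_fibred_over[OF U(2)])
  have sub: "fibred_over U \<subseteq> over c W" using U by (auto simp: fibred_over_def over_def)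
  then show "smooth_on (fibred_over U) (f c)"
    using f c unfolding ambient_density_def by (blast intro: smooth_on_subset)
  show sc: "f c (fibre_scale \<mu> Z) = (norm \<mu>)\<^sup>2 * f c Z" if "Z \<in> fibred_over U" "\<mu> \<noteq> 0" for \<mu> Z
    using f c that sub unfolding ambient_density_def homogeneous_family_def by (auto simp: power_int_def)
  show "has_weight 1 (\<lambda>Z. complex_of_real (f c Z))"
    unfolding has_weight_def by (auto simp: sc exp_double[symmetric] power2_eq_square exp_add[symmetric])
qed

text \<open>Since \<open>\<theta>(v) = d\<rho>(J v) / 2\<close>, rescaling \<open>\<theta>\<close> rescales \<open>d\<rho>\<close> along \<open>M\<close>.\<close>

lemma normalized_quotient:
  fixes A :: "('x::topological_space, 'm::finite) chart set"
  assumes \<rho>1: "cut_out A M W1 \<rho>1" "normalized_by A M \<theta> \<rho>1"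
    and \<rho>2: "cut_out A M W2 \<rho>2" "normalized_by A M (rescale_form \<Upsilon> \<theta>) \<rho>2"
    and c: "c \<in> charts A" and y: "y \<in> cimg c M" and T: "open T" "y \<in> T"
    and k: "smooth_on T k1" "smooth_on T k2"
    and eq: "\<And>x. x \<in> T \<Longrightarrow> k1 x * \<rho>1 (pt c x) = k2 x * \<rho>2 (pt c x)"
  shows "k1 y = exp (\<Upsilon> (pt c y)) * k2 y"
proof -
  let ?a1 = "\<lambda>y. \<rho>1 (pt c y)" and ?a2 = "\<lambda>y. \<rho>2 (pt c y)"
  note C1 = cut_out_chart[OF \<rho>1(1) c] and C2 = cut_out_chart[OF \<rho>2(1) c]
  have d: "?a1 differentiable (at y)" "?a2 differentiable (at y)"
    using C1(3) C2(3) y by (auto intro: smooth_on_differentiable[OF C1(2)] smooth_on_differentiable[OF C2(2)])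
  have z: "?a1 y = 0" "?a2 y = 0" using C1(3,4) C2(3,4) y by auto
  have dk: "k1 differentiable (at y)" "k2 differentiable (at y)"
    using k T by (auto intro: smooth_on_differentiable)
  \<comment> \<open>Both defining functions vanish at \<open>y\<close>, so the derivatives of
    \<open>k1\<close> and \<open>k2\<close> disappear from the product rule.\<close>
  have D: "k1 y * dir_deriv v ?a1 y = k2 y * dir_deriv v ?a2 y" for v
  proof -
    have "dir_deriv v (\<lambda>x. k1 x * \<rho>1 (pt c x)) y = dir_deriv v (\<lambda>x. k2 x * \<rho>2 (pt c x)) y"
      by (rule dir_deriv_cong[OF T]) (rule eq)
    then show ?thesis by (simp add: dir_deriv_mult d dk z)
  qed
  obtain e where "dir_deriv e ?a1 y \<noteq> 0" using C1(5)[OF y] by blast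
  from exists_contact_transversal[OF d(1) this]
  obtain v where v: "dir_deriv v ?a1 y = 0" "dir_deriv (\<i> *s v) ?a1 y \<noteq> 0" by blast
  have vt: "v \<in> tangent_space M c y" by (rule kernel_subset_tangent_space[OF \<rho>1(1) c y v(1)])
  have "dir_deriv (\<i> *s v) ?a1 y = 2 * \<theta> c y v"
    using normalized_by_dir_deriv[OF \<rho>1 c y vt] by simp
  moreover have "dir_deriv (\<i> *s v) ?a2 y = 2 * (exp (\<Upsilon> (pt c y)) * \<theta> c y v)"
    using normalized_by_dir_deriv[OF \<rho>2 c y vt] by (simp add: rescale_form_def)
  ultimately have "dir_deriv (\<i> *s v) ?a2 y = exp (\<Upsilon> (pt c y)) * dir_deriv (\<i> *s v) ?a1 y" by simp
  then show ?thesis using D[of "\<i> *s v"] v(2) by simp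
qed

text \<open>If both factors vanished at \<open>Z\<close>, the product rule would make the
  differential of \<open>r\<close> zero there.\<close>

lemma density_factor_nonzero:
  assumes Z: "Z \<in> fibred_over U" and U: "open U" and h: "smooth_on (fibred_over U) h" and a: "smooth_on U a"
    and r: "\<And>Y. Y \<in> fibred_over U \<Longrightarrow> r Y = h Y * a (base Y)"
    and "a (base Z) = (0::real)" "dir_deriv v r Z \<noteq> 0"
  shows "h Z \<noteq> (0::real)"
proof
  assume h0: "h Z = 0"
  have sa: "smooth_on (fibred_over U) (\<lambda>Y. a (base Y))"
    by (rule smooth_on_base[OF open_fibred_over[OF U] a]) (simp add: fibred_over_def)
  have "dir_deriv v r Z = dir_deriv v (\<lambda>Y. h Y * a (base Y)) Z"
    by (rule dir_deriv_cong[OF open_fibred_over[OF U] Z r])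
  also have "\<dots> = 0"
    by (simp add: dir_deriv_mult smooth_on_differentiable[OF h Z] smooth_on_differentiable[OF sa Z] h0 assms)
  finally show False using assms by simp
qed

section \<open>The transformation law\<close>

theorem proposition4p3:
  fixes n :: nat
    and A :: "('x::{t2_space, second_countable_topology}, 'm::finite) chart set"
    and M :: "'x set"
    and r :: "('x, 'm, real) family"
    and \<theta> :: "('x, 'm) form1"
    and \<Upsilon> :: "'x \<Rightarrow> real"
    and P :: "('x \<Rightarrow> complex) \<Rightarrow> ('x, 'm, complex) family"
    and P' P'_hat :: "('x \<Rightarrow> real) \<Rightarrow> ('x, 'm, complex) family"
  assumes "n \<ge> 1" and "CARD('m) = n + 1"
    and "complex_atlas A"
    and "strictly_pseudoconvex_hypersurface A M"
    and "fefferman_defining A M r"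
    and "contact_form A M \<theta>"
    and "smooth_fun_along A M \<Upsilon>"
    and "critical_GJMS A M r P"
    and "P_prime_operator A M r \<theta> P'"
    and "P_prime_operator A M r (rescale_form \<Upsilon> \<theta>) P'_hat"
  shows "\<forall>f. CR_pluriharmonic A M f \<longrightarrow>
           (\<forall>c\<in>charts A. \<forall>Z\<in>over c M.
              P'_hat f c Z = P' f c Z + P (\<lambda>x. complex_of_real (\<Upsilon> x * f x)) c Z)"
proof (intro allI impI ballI)
  fix f c Z assume f: "CR_pluriharmonic A M f" and c: "c \<in> charts A" and Z: "Z \<in> over c M"
  have card: "CARD('m) \<ge> 2" using assms(1,2) by simp
  \<comment> \<open>The data for \<theta> and for the rescaled form are independent of each other;
    even the two pluriharmonic extensions of \<open>f\<close> may differ.\<close>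
  obtain W1 \<rho>1 h1 F1 where
    df1: "defining_function A M W1 \<rho>1" and n1: "normalized_by A M \<theta> \<rho>1" and ad1: "ambient_density A 1 W1 h1"
    and r1: "\<forall>c\<in>charts A. \<forall>Z\<in>over c W1. r c Z = h1 c Z * \<rho>1 (pt c (base Z))"
    and F1: "pluriharmonic_extension A M W1 \<rho>1 f F1"
    and P1: "\<forall>c\<in>charts A. \<forall>Z\<in>over c M. P' f c Z = - (ambient_laplacian (r c) ^^ CARD('m))
                                 (\<lambda>Y. complex_of_real (F1 (pt c (base Y)) * ln (h1 c Y))) Z"
    using assms(9)[unfolded P_prime_operator_def, THEN spec, THEN mp, OF f, THEN conjunct2]
    by (elim exE conjE) (rule that)
  obtain W2 \<rho>2 h2 F2 where
    df2: "defining_function A M W2 \<rho>2" and n2: "normalized_by A M (rescale_form \<Upsilon> \<theta>) \<rho>2"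
    and ad2: "ambient_density A 1 W2 h2"
    and r2: "\<forall>c\<in>charts A. \<forall>Z\<in>over c W2. r c Z = h2 c Z * \<rho>2 (pt c (base Z))"
    and F2: "pluriharmonic_extension A M W2 \<rho>2 f F2"
    and P2: "\<forall>c\<in>charts A. \<forall>Z\<in>over c M. P'_hat f c Z = - (ambient_laplacian (r c) ^^ CARD('m))
                                 (\<lambda>Y. complex_of_real (F2 (pt c (base Y)) * ln (h2 c Y))) Z"
    using assms(10)[unfolded P_prime_operator_def, THEN spec, THEN mp, OF f, THEN conjunct2]
    by (elim exE conjE) (rule that)
  have co1: "cut_out A M W1 \<rho>1" and co2: "cut_out A M W2 \<rho>2"
    using df1 df2 by (auto simp: defining_function_def)
  have \<Upsilon>f: "smooth_fun_along A M (\<lambda>x. complex_of_real (\<Upsilon> x * f x))"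
    unfolding smooth_fun_along_def smooth_along_def
  proof (intro ballI)
    fix d y assume d: "d \<in> charts A" and y: "y \<in> cimg d M"
    obtain V1 g1 where g1: "open V1" "y \<in> V1" "smooth_on V1 g1" "\<forall>x\<in>V1 \<inter> cimg d M. g1 x = \<Upsilon> (pt d x)"
      using assms(7) d y unfolding smooth_fun_along_def smooth_along_def comp_def by metis
    obtain V2 g2 where g2: "open V2" "y \<in> V2" "smooth_on V2 g2" "\<forall>x\<in>V2 \<inter> cimg d M. g2 x = f (pt d x)"
      using f d y unfolding CR_pluriharmonic_def smooth_fun_along_def smooth_along_def comp_def by metis
    show "\<exists>V g. open V \<and> y \<in> V \<and> smooth_on V g \<and>
        (\<forall>x\<in>V \<inter> cimg d M. g x = ((\<lambda>x. complex_of_real (\<Upsilon> x * f x)) \<circ> pt d) x)"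
      using g1 g2
      by (intro exI[of _ "V1 \<inter> V2"] exI[of _ "\<lambda>x. complex_of_real (g1 x * g2 x)"])
        (auto intro!: smooth_on_of_real smooth_on_mult intro: smooth_on_subset)
  qed
  obtain W3 G where W3: "open W3" "M \<subseteq> W3" and G: "smooth_fun A W3 G"
    and GM: "\<forall>x\<in>M. G x = complex_of_real (\<Upsilon> x * f x)"
    and PG: "\<forall>c\<in>charts A. \<forall>Z\<in>over c M. P (\<lambda>x. complex_of_real (\<Upsilon> x * f x)) c Z
        = (ambient_laplacian (r c) ^^ CARD('m)) (\<lambda>Y. G (pt c (base Y))) Z"
    using assms(8)[unfolded critical_GJMS_def, THEN spec, THEN mp, OF \<Upsilon>f, THEN conjunct2]
    by (elim exE conjE) (rule that)
  obtain W0 \<rho>0 where df0: "defining_function A M W0 \<rho>0" and ad0: "ambient_density A 1 W0 r"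
    and dr: "\<forall>c\<in>charts A. \<forall>Z\<in>over c M. \<exists>v. frechet_derivative (r c) (at Z) v \<noteq> 0"
    and MA: "\<forall>c\<in>charts A. \<forall>z\<in>cimg c M. (\<lambda>y. monge_ampere (\<lambda>y. r c (unit_lift y)) y - 1)
               \<in> O[nhds z](\<lambda>y. complex_of_real (\<rho>0 (pt c y) ^ CARD('m option)))"
    using assms(5)[unfolded fefferman_defining_def] by (elim exE conjE) (rule that)
  have co0: "cut_out A M W0 \<rho>0" using df0 by (simp add: defining_function_def)
  define z where "z = base Z"
  have zM: "z \<in> cimg c M" and Z0: "Z $ None \<noteq> 0" using Z by (auto simp: over_def z_def)
  note C0 = cut_out_chart[OF co0 c] and C1 = cut_out_chart[OF co1 c] and C2 = cut_out_chart[OF co2 c]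
  have oW3: "open (cimg c W3)" by (rule open_cimg[OF charts_is_chart[OF c] W3(1)])
  have MW3: "cimg c M \<subseteq> cimg c W3" using W3(2) by (auto simp: cimg_def)
  define T where "T = cimg c W0 \<inter> cimg c W1 \<inter> cimg c W2 \<inter> cimg c W3"
  have T: "open T" using C0 C1 C2 oW3 by (auto simp: T_def)
  have zT: "z \<in> T" using C0(3) C1(3) C2(3) MW3 zM by (auto simp: T_def)
  have TM: "y \<in> cimg c M \<longleftrightarrow> \<rho>1 (pt c y) = 0" "y \<in> cimg c M \<longleftrightarrow> \<rho>2 (pt c y) = 0" if "y \<in> T" for y
    using that C1(4) C2(4) by (auto simp: T_def)
  have sub: "T \<subseteq> cimg c W0" "T \<subseteq> cimg c W1" "T \<subseteq> cimg c W2" "T \<subseteq> cimg c W3" by (auto simp: T_def)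
  define a1 where "a1 y = \<rho>1 (pt c y)" for y
  define a2 where "a2 y = \<rho>2 (pt c y)" for y
  have sa: "smooth_on T a1" "smooth_on T a2"
    unfolding a1_def[abs_def] a2_def[abs_def]
    by (rule smooth_on_subset[OF C1(2) sub(2)], rule smooth_on_subset[OF C2(2) sub(3)])
  \<comment> \<open>Restriction to fibre coordinate 1. By homogeneity this determines
    \<open>h1 c\<close> and \<open>h2 c\<close>, and their comparison becomes one of functions on
    the base.\<close>
  define k1 where "k1 y = h1 c (unit_lift y)" for y
  define k2 where "k2 y = h2 c (unit_lift y)" for y
  have oDT: "open (fibred_over T)" by (rule open_fibred_over[OF T])
  note wr = density_weight[OF ad0 c sub(1) T] and wh1 = density_weight[OF ad1 c sub(2) T]
    and wh2 = density_weight[OF ad2 c sub(3) T]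
  have sk: "smooth_on T k1" "smooth_on T k2"
    unfolding k1_def[abs_def] k2_def[abs_def]
    by (rule smooth_on_unit_lift[OF T wh1(1)], simp, rule smooth_on_unit_lift[OF T wh2(1)], simp)
  have rh1: "r c Y = h1 c Y * a1 (base Y)" and rh2: "r c Y = h2 c Y * a2 (base Y)"
    if "Y \<in> fibred_over T" for Y
  proof -
    have "Y \<in> over c W1" "Y \<in> over c W2"
      using that sub by (auto simp: over_eq_fibred_over fibred_over_def)
    then show "r c Y = h1 c Y * a1 (base Y)" "r c Y = h2 c Y * a2 (base Y)"
      unfolding a1_def a2_def using r1 r2 c by blast+
  qed
  have k_eq: "k1 y * a1 y = k2 y * a2 y" if "y \<in> T" for y
    using rh1[of "unit_lift y"] rh2[of "unit_lift y"] that by (simp add: k1_def k2_def)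
  have k_M: "k1 y = exp (\<Upsilon> (pt c y)) * k2 y" if "y \<in> T" "y \<in> cimg c M" for y
    by (rule normalized_quotient[OF co1 n1 co2 n2 c that(2) T that(1) sk]) (use k_eq in \<open>simp add: a1_def a2_def\<close>)
  have "k2 z \<noteq> 0"
  proof -
    have "unit_lift z \<in> over c M" using zM by (simp add: over_eq_fibred_over)
    then obtain v where "dir_deriv v (r c) (unit_lift z) \<noteq> 0" using dr c by (auto simp: dir_deriv_def)
    then show ?thesis
      unfolding k2_def using zT zM TM(2)
      by (intro density_factor_nonzero[OF _ T wh2(1) sa(2), where r = "r c"]) (auto simp: a2_def rh2)
  qed
  \<comment> \<open>Over \<open>M\<close> the two quotients differ by a positive factor, so near
    \<open>z\<close> they have equal signs. Consequently \<rho>1 and \<rho>2 are positive on the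
    same side.\<close>
  moreover have "k1 z * k2 z = exp (\<Upsilon> (pt c z)) * (k2 z)\<^sup>2"
    using k_M[OF zT zM] by (simp add: power2_eq_square)
  ultimately have kz: "k1 z * k2 z > 0" by simp
  obtain e where ez: "dir_deriv e a1 z \<noteq> 0" using C1(5)[OF zM] by (auto simp: a1_def[abs_def])
  interpret T: fibred_domain "fibred_over T" by (rule fibred_domain_fibred_over[OF T])
  interpret T: ambient_space "fibred_over T" "r c"
    by unfold_locales (use wr in auto)
  \<comment> \<open>The filter \<open>nhds z\<close> includes the point \<open>z\<close> itself,
    where \<rho>0 vanishes; the bound therefore gives equality at \<open>z\<close>.\<close>
  have "monge_ampere (\<lambda>y. r c (unit_lift y)) z = 1"
  proof -
    have "(\<lambda>y. monge_ampere (\<lambda>y. r c (unit_lift y)) y - 1)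
        \<in> O[nhds z](\<lambda>y. complex_of_real (\<rho>0 (pt c y) ^ CARD('m option)))"
      using MA c zM by blast
    then obtain K where "eventually (\<lambda>y. norm (monge_ampere (\<lambda>y. r c (unit_lift y)) y - 1)
        \<le> K * norm (complex_of_real (\<rho>0 (pt c y) ^ CARD('m option)))) (nhds z)"
      by (rule landau_o.bigE)
    from eventually_nhds_x_imp_x[OF this] show ?thesis
      using C0(3,4) zM by auto
  qed
  then have detz: "det (ambient_metric (r c) (unit_lift z)) \<noteq> 0"
    by (intro T.det_metric_unit_lift) (use zT in auto)
  define dm where "dm y = det (ambient_metric (r c) (unit_lift y))" for y
  have sdm: "smooth_on T dm"
  proof -
    have "smooth_on (fibred_over T) (\<lambda>Y. - pd I (pdbar J (\<lambda>Y. complex_of_real (r c Y))) Y)" for I J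
      unfolding pd_eq_wirtinger pdbar_eq_wirtinger
      by (intro smooth_on_minus smooth_on_wirtinger oDT T.smooth_R)
    then have "smooth_on (fibred_over T) (\<lambda>Y. det (ambient_metric (r c) Y))"
      unfolding ambient_metric_def by (intro smooth_on_det oDT)
    from smooth_on_unit_lift[OF T this] show ?thesis by (simp add: dm_def[abs_def])
  qed
  \<comment> \<open>Three open conditions that hold at \<open>z\<close>: equal signs of the
    quotients, transversality of \<open>e\<close> for the division, and nondegeneracy of the metric
    over the unit section.\<close>
  define U where "U = {y \<in> T. k1 y * k2 y > 0} \<inter> {y \<in> T. dir_deriv e a1 y \<noteq> 0} \<inter> {y \<in> T. dm y \<noteq> 0}"
  have U: "open U"
  proof -
    have "open {y \<in> T. k1 y * k2 y > 0}"
      using continuous_open_preimage[OF smooth_on_continuous[OF smooth_on_mult[OF T sk]] T, of "{0<..}"]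
      by (simp add: vimage_def Int_def open_Compl)
    moreover have "open {y \<in> T. dir_deriv e a1 y \<noteq> 0}"
      using continuous_open_preimage[OF smooth_on_continuous[OF smooth_on_dir_deriv[OF sa(1)]] T, of "- {0}"]
      by (simp add: vimage_def Int_def open_Compl)
    moreover have "open {y \<in> T. dm y \<noteq> 0}"
      using continuous_open_preimage[OF smooth_on_continuous[OF sdm] T, of "- {0}"]
      by (simp add: vimage_def Int_def open_Compl)
    ultimately show ?thesis by (auto simp: U_def)
  qed
  have UT: "U \<subseteq> T" by (auto simp: U_def)
  have zU: "z \<in> U" using zT kz ez detz by (auto simp: U_def dm_def)
  have kU: "k1 y * k2 y > 0" and eU: "dir_deriv e a1 y \<noteq> 0" if "y \<in> U" for y using that by (auto simp: U_def)
  have knz: "k1 y \<noteq> 0" "k2 y \<noteq> 0" if "y \<in> U" for y using kU[OF that] by auto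
  define D where "D = fibred_over U"
  have DT: "D \<subseteq> fibred_over T" using UT by (auto simp: D_def fibred_over_def)
  have ZD: "Z \<in> D" using Z0 zU by (simp add: D_def fibred_over_def z_def)
  have subU: "U \<subseteq> cimg c W0" "U \<subseteq> cimg c W1" "U \<subseteq> cimg c W2" "U \<subseteq> cimg c W3" using sub UT by auto
  note vr = density_weight[OF ad0 c subU(1) U, folded D_def] and vh1 = density_weight[OF ad1 c subU(2) U, folded D_def]
    and vh2 = density_weight[OF ad2 c subU(3) U, folded D_def]
  have bU: "base Y \<in> U" if "Y \<in> D" for Y using that by (simp add: D_def fibred_over_def)
  have lift: "unit_lift (base Y) \<in> D" "Y $ None \<noteq> 0" if "Y \<in> D" for Y
    using that by (auto simp: D_def fibred_over_def)
  interpret fibred_domain D unfolding D_def by (rule fibred_domain_fibred_over[OF U])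
  interpret ambient_space D "r c" by unfold_locales (use vr in auto)
  interpret nondegenerate_ambient_space D "r c"
  proof
    fix Y assume Y: "Y \<in> D"
    have "det (ambient_metric (r c) (unit_lift (base Y))) \<noteq> 0"
      using bU[OF Y] by (auto simp: U_def dm_def)
    \<comment> \<open>\<open>Y\<close> is the unit lift of its base point, scaled by the fibre
      coordinate; \<open>Ln\<close> writes that nonzero scalar as an exponential.\<close>
    from inverse_metric_scaling(1)[OF lift(1)[OF Y] this, of "Ln (Y $ None)"]
    show "det (ambient_metric (r c) Y) \<noteq> 0" using lift(2)[OF Y] by (simp add: fibre_scale_unit_lift)
  qed
  have h1Y: "h1 c Y = (norm (Y $ None))\<^sup>2 * k1 (base Y)" and h2Y: "h2 c Y = (norm (Y $ None))\<^sup>2 * k2 (base Y)"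
    if "Y \<in> D" for Y
    using vh1(3)[OF lift[OF that]] vh2(3)[OF lift[OF that]] by (simp_all add: fibre_scale_unit_lift k1_def k2_def)
  have hnz: "h1 c Y \<noteq> 0" "h2 c Y \<noteq> 0" if "Y \<in> D" for Y
    using h1Y[OF that] h2Y[OF that] knz[OF bU[OF that]] lift(2)[OF that] by auto
  define f1 where "f1 y = F1 (pt c y)" for y
  define f2 where "f2 y = F2 (pt c y)" for y
  define g where "g y = G (pt c y)" for y
  have sF: "smooth_fun A W1 F1" "smooth_fun A W2 F2" using F1 F2 by (auto simp: pluriharmonic_extension_def)
  have sf: "smooth_on U f1" "smooth_on U f2" "smooth_on U g"
    unfolding f1_def[abs_def] f2_def[abs_def] g_def[abs_def]
    by (rule smooth_on_subset[OF smooth_fun_chart[OF sF(1) c] subU(2)],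
        rule smooth_on_subset[OF smooth_fun_chart[OF sF(2) c] subU(3)],
        rule smooth_on_subset[OF smooth_fun_chart[OF G c] subU(4)])
  have saU: "smooth_on U a1" "smooth_on U a2" "smooth_on U k1" "smooth_on U k2"
    using sa sk smooth_on_subset[OF _ UT] by blast+
  have onM: "f1 y = f (pt c y)" "f2 y = f (pt c y)" "g y = complex_of_real (\<Upsilon> (pt c y) * f (pt c y))"
    "y \<in> cimg c M" "y \<in> T" if "y \<in> U" "a1 y = 0" for y
  proof -
    show "y \<in> T" using that UT by auto
    then show yM: "y \<in> cimg c M" using TM(1) that by (simp add: a1_def)
    then have "pt c y \<in> M" using cimg_iff[OF charts_is_chart[OF c]] by blast
    then show "f1 y = f (pt c y)" "f2 y = f (pt c y)" "g y = complex_of_real (\<Upsilon> (pt c y) * f (pt c y))"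
      using F1 F2 GM by (auto simp: pluriharmonic_extension_def f1_def f2_def g_def)
  qed
  define u where "u y = complex_of_real (f1 y) - complex_of_real (f2 y)" for y
  have sf': "smooth_on U (\<lambda>y. complex_of_real (f1 y))" "smooth_on U (\<lambda>y. complex_of_real (f2 y))"
    by (intro smooth_on_of_real U sf)+
  have su: "smooth_on U u" unfolding u_def[abs_def] by (intro smooth_on_diff U sf')
  have flat: "vanishes_to_order m u z" for m
  proof (rule pluriharmonic_flat[OF U saU(1) eU su])
    show "u y = 0" if "y \<in> U" "a1 y = 0" for y using onM[OF that] by (simp add: u_def)
    show "z \<in> U" by (rule zU)
    show "a1 z = 0" using TM(1)[OF zT] zM by (simp add: a1_def)
    show "\<exists>Z. (\<Sum>j\<in>UNIV. pd j (\<lambda>y. complex_of_real (a1 y)) y * Z $ j) = 0 \<and>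
      (\<Sum>j\<in>UNIV. \<Sum>k\<in>UNIV. pd j (pdbar k (\<lambda>y. complex_of_real (a1 y))) y * Z $ j * cnj (Z $ k)) \<noteq> 0"
      if "y \<in> U" "a1 y = 0" for y
      unfolding a1_def using levi_nonzero[OF card df1 c onM(4)[OF that]] .
    show "pd j (pdbar k u) y = 0" if y: "y \<in> U" "0 < a1 y" for y j k
    proof -
      \<comment> \<open>Multiplication of \<open>k_eq\<close> by \<open>k2 y\<close> gives a
        positive left-hand side and a square times \<open>a2 y\<close> on the right, so
        \<open>a2 y\<close> is positive. Both extensions are thus pluriharmonic at
        \<open>y\<close>.\<close>
      have "k1 y * k2 y * a1 y = k2 y * k2 y * a2 y" using k_eq[of y] y UT by (auto simp: algebra_simps)
      moreover have "k1 y * k2 y * a1 y > 0" using kU[OF y(1)] y(2) by simp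
      ultimately have a2: "a2 y > 0" by (metis zero_less_mult_pos zero_less_mult_iff not_square_less_zero)
      have mem: "y \<in> snd c ` fst c" "pt c y \<in> W1" "pt c y \<in> W2"
        using y(1) subU cimg_iff[OF charts_is_chart[OF c]] by blast+
      have "y \<in> cimg c {x \<in> W1. 0 < \<rho>1 x}" "y \<in> cimg c {x \<in> W2. 0 < \<rho>2 x}"
        using mem y(2) a2 by (auto simp: cimg_iff[OF charts_is_chart[OF c]] a1_def a2_def)
      then have "pd j (pdbar k (\<lambda>y. complex_of_real (f1 y))) y = 0" "pd j (pdbar k (\<lambda>y. complex_of_real (f2 y))) y = 0"
        using F1 F2 c unfolding pluriharmonic_extension_def f1_def f2_def by blast+
      then show ?thesis
        unfolding u_def[abs_def] mixed_diff[OF U y(1) sf'] by simp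
    qed
  qed
  \<comment> \<open>The factor \<open>(norm (Y $ None))\<^sup>2\<close> common to
    \<open>h1 c\<close> and \<open>h2 c\<close> cancels in the difference of logarithms, which is
    therefore a function on the base. On \<open>M\<close> it equals \<open>\<Upsilon>\<close>, so
    \<open>Q\<close> vanishes there whatever extension \<open>g\<close> is.\<close>
  define Q where "Q y = complex_of_real (f2 y * (ln (k1 y) - ln (k2 y))) - g y" for y
  have sQ: "smooth_on U Q"
    unfolding Q_def[abs_def]
    by (intro smooth_on_diff smooth_on_of_real smooth_on_mult smooth_on_ln U sf saU) (use knz in auto)
  have Q0: "Q y = 0" if "y \<in> U" "a1 y = 0" for y
  proof -
    have "ln (k1 y) = \<Upsilon> (pt c y) + ln (k2 y)"
      unfolding k_M[OF onM(5,4)[OF that]] using knz[OF that(1)] by (simp add: ln_mult)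
    then show ?thesis using onM[OF that] by (simp add: Q_def algebra_simps)
  qed
  let ?L = "\<lambda>h Y. complex_of_real (ln (h c Y))"
  have sL: "smooth_on D (?L h1)" "smooth_on D (?L h2)"
    by (intro smooth_on_of_real smooth_on_ln open_D vh1 vh2; use hnz in blast)+
  have sbase: "smooth_on D (\<lambda>Y. q (base Y))" if "smooth_on U q" for q :: "complex^'m \<Rightarrow> complex"
    by (rule smooth_on_base[OF open_D that bU])
  have sb: "smooth_on D (\<lambda>Y. u (base Y))" "smooth_on D (\<lambda>Y. Q (base Y))" "smooth_on D (\<lambda>Y. g (base Y))"
    "smooth_on D (\<lambda>Y. complex_of_real (f2 (base Y)))"
    by (rule sbase[OF su], rule sbase[OF sQ], rule sbase[OF sf(3)], rule sbase[OF sf'(2)])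
  have s1: "smooth_on D (\<lambda>Y. u (base Y) * ?L h1 Y)" and s2: "smooth_on D (\<lambda>Y. complex_of_real (f2 (base Y)) * ?L h2 Y)"
    by (intro smooth_on_mult open_D sb sL)+
  have a1Z: "a1 (base Z) = 0" using TM(1)[OF zT] zM by (simp add: a1_def z_def)
  \<comment> \<open>With f1 = f2 + u the left-hand function is f2 log h2 + u log h1 + f2 (log h1 -
    log h2), and the last product is \<open>Q + g\<close>.\<close>
  have "(Lap ^^ CARD('m)) (\<lambda>Y. complex_of_real (f1 (base Y) * ln (h1 c Y))) Z
      = (Lap ^^ CARD('m)) (\<lambda>Y. complex_of_real (f2 (base Y)) * ?L h2 Y + (u (base Y) * ?L h1 Y + (Q (base Y) + g (base Y)))) Z"
  proof (rule Lap_power_cong[OF ZD])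
    fix Y assume Y: "Y \<in> D"
    have "ln (h1 c Y) - ln (h2 c Y) = ln (k1 (base Y)) - ln (k2 (base Y))"
      unfolding h1Y[OF Y] h2Y[OF Y] using knz[OF bU[OF Y]] lift(2)[OF Y] by (simp add: ln_mult)
    then have "f2 (base Y) * (ln (k1 (base Y)) - ln (k2 (base Y))) = f2 (base Y) * (ln (h1 c Y) - ln (h2 c Y))" by simp
    then show "complex_of_real (f1 (base Y) * ln (h1 c Y))
      = complex_of_real (f2 (base Y)) * ?L h2 Y + (u (base Y) * ?L h1 Y + (Q (base Y) + g (base Y)))"
      unfolding Q_def u_def by (simp only:) (simp add: algebra_simps)
  qed
  also have "\<dots> = (Lap ^^ CARD('m)) (\<lambda>Y. complex_of_real (f2 (base Y)) * ?L h2 Y) Z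
      + ((Lap ^^ CARD('m)) (\<lambda>Y. u (base Y) * ?L h1 Y) Z
        + ((Lap ^^ CARD('m)) (\<lambda>Y. Q (base Y)) Z + (Lap ^^ CARD('m)) (\<lambda>Y. g (base Y)) Z))"
    by (simp only: Lap_power_add[OF s2 smooth_on_add[OF open_D s1 smooth_on_add[OF open_D sb(2,3)]] ZD]
        Lap_power_add[OF s1 smooth_on_add[OF open_D sb(2,3)] ZD] Lap_power_add[OF sb(2,3) ZD])
  also have "(Lap ^^ CARD('m)) (\<lambda>Y. u (base Y) * ?L h1 Y) Z = 0"
    using flat unfolding z_def
    by (intro Lap_power_vanishes[OF ZD s1] vanishes_to_order_mult[OF open_D ZD sb(1) sL(1)]
        vanishes_to_order_base[OF open_D ZD su bU])
  also have "(Lap ^^ CARD('m)) (\<lambda>Y. Q (base Y)) Z = 0"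
    by (rule Lap_power_weight_zero[OF D_def U saU(1) eU vh1(1,2) hnz(1) _ sQ Q0 ZD a1Z])
      (use rh1 DT in auto)
  \<comment> \<open>Both primed operators carry a minus sign and \<open>P\<close> does not, so the
    term in \<open>g\<close> appears with a plus sign on the side of \<open>P'\<close>.\<close>
  finally show "P'_hat f c Z = P' f c Z + P (\<lambda>x. complex_of_real (\<Upsilon> x * f x)) c Z"
    using P1 P2 PG c Z by (simp add: f1_def f2_def g_def)
qed

end
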